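(* Let $m\ge 1$ be an integer. For every $\ell\in\mathbb{Z}_{\ge0}$ the restricted spherical functions $\Psi_{\pm}(\ell)$ of type $\tau_m$ for the pair $(\mathrm{Spin}(2m+2),\mathrm{Spin}(2m+1))$ are expressed in terms of the ($\mathbb{C}^2$-valued) non-symmetric Jacobi polynomials of type $BC_1$ with root multiplicity $k=(0,m)$ by $$\Psi_{+}(\ell)(z)=\frac{(\ell+2m+1)_{\ell}}{2^{2\ell}(m+\frac12)_{\ell}}\begin{pmatrix}z^{-1}&0\\0&z\end{pmatrix}P(\ell+1,(0,m))(z^2),$$ $$\Psi_{-}(\ell)(z)=\frac{(\ell+2m+1)_{\ell}}{2^{2\ell}(m+\frac12)_{\ell}}\begin{pmatrix}z^{-1}&0\\0&z\end{pmatrix}P(-\ell,(0,m))(z^2).$$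
   Context: Pochhammer symbol: $(a)_0=1$, $(a)_\ell=a(a+1)\cdots(a+\ell-1)$. Non-symmetric Jacobi polynomials. For $k=(k_1,k_2)$ with real $k_1,k_2\ge0$ put $\delta_k(z)=\left(1-\frac{z+z^{-1}}{2}\right)^{k_1}\left(1-\frac{z^2+z^{-2}}{2}\right)^{k_2}$ and, on $\mathbb{C}[z^{\pm1}]$, the inner product $(p,q)_k=\int_{S^1}\overline{p(z)}q(z)\delta_k(z)\frac{dz}{iz}$. Order the monomials by $1<z<z^{-1}<z^2<z^{-2}<z^3<\cdots$. For $n\in\mathbb{Z}$, $E(n,k)\in\mathbb{C}[z^{\pm1}]$ is the unique Laurent polynomial with $E(n,k)=z^n+$ (linear combination of monomials smaller than $z^n$) and $(E(n,k),z^j)_k=0$ for all monomials $z^j<z^n$. Put $P(n,k)(z)=(E(n,k)(z),E(n,k)(z^{-1}))^T$. Spherical functions. Let $U=\mathrm{Spin}(2m+2)$, with standard basis $e_1,\dots,e_{2m+2}$ of $\mathbb{R}^{2m+2}$. Let $K=\mathrm{Spin}(2m+1)$ be the stabilizer of $e_1$ in $U$. Let $A\subset U$ be the one-dimensional torus covering the rotations in the plane spanned by $e_1,e_2$; its centralizer in $K$ is $M=\mathrm{Spin}(2m)$, the stabilizer of $e_1$ and $e_2$. Use the standard maximal torus of $U$ (covering the rotations in the planes spanned by $e_{2j-1},e_{2j}$) with standard weights $\epsilon_1,\dots,\epsilon_{m+1}$ (so $A$ is the torus of the first plane), the standard positive system, and for $M$ the weights $\epsilon_2,\dots,\epsilon_{m+1}$.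 The coordinate $z:A\to S^1$ is the isomorphism given by the weight $\epsilon_1/2$; functions on $A$ are written as functions of $z$, and $\mathbb{C}[A]=\mathbb{C}[z^{\pm1}]$. Let $\varpi_1=\epsilon_1$ (highest weight of the vector representation of $U$), $\varpi_+=\frac12(\epsilon_1+\cdots+\epsilon_{m+1})$, $\varpi_-=\frac12(\epsilon_1+\cdots+\epsilon_m-\epsilon_{m+1})$. Let $\tau_m:K\to\mathrm{GL}(V_{\tau_m})$ be the (unique) fundamental spin representation of $K$; on $M$ it splits as $\sigma_m^+\oplus\sigma_m^-$, where $\sigma_m^{\pm}$ is the irreducible (half-spin) representation of $M$ of highest weight $\frac12(\epsilon_2+\cdots+\epsilon_m\pm\epsilon_{m+1})$. The irreducible $U$-representations whose restriction to $K$ contains $\tau_m$ are precisely $\pi_{\varpi_{\pm}+\ell\varpi_1}$, $\ell\in\mathbb{Z}_{\ge0}$, and they contain it with multiplicity one. For such $\pi:U\to\mathrm{GL}(V_\pi)$ let $j:V_{\tau_m}\to V_\pi$ and $p:V_\pi\to V_{\tau_m}$ be unitary $K$-intertwiners with $p\circ j=\mathrm{Id}$; the spherical function of type $\tau_m$ associated to $\pi$ is $U\to\mathrm{End}(V_{\tau_m})$, $u\mapsto p\circ\pi(u)\circ j$. Its restriction to $A$ takes values in $\mathrm{End}_M(V_{\tau_m})$, which is identified with $\mathbb{C}^2$ by sending an endomorphism to (its scalar on $\sigma_m^+$, its scalar on $\sigma_m^-$)$^T$. For $\pi=\pi_{\varpi_\pm+\ell\varpi_1}$ the resulting function $A\to\mathbb{C}^2$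 is denoted $\Psi_\pm(\ell)$. *)

theory Defs
  imports
    "HOL-Complex_Analysis.Complex_Analysis"
    "HOL-Algebra.Group"
    "HOL-Library.Poly_Mapping"
begin

section \<open>Non-symmetric Jacobi polynomials\<close>

text \<open>The ring of Laurent polynomials is the group algebra of the integers: the coefficient of
  $z^n$ in \<open>p\<close> is \<open>lookup p n\<close>.\<close>

type_synonym laurent = "int \<Rightarrow>\<^sub>0 complex"

definition laurent_eval :: "laurent \<Rightarrow> complex \<Rightarrow> complex" where
  "laurent_eval p z = (\<Sum>n\<in>Poly_Mapping.keys p. Poly_Mapping.lookup p n * z powi n)"

definition laurent_monom :: "int \<Rightarrow> laurent" where
  "laurent_monom n = Poly_Mapping.single n 1"

text \<open>Position of $z^n$ in the list $1, z, z^{-1}, z^2, z^{-2}, z^3, \ldots$\<close>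

definition monom_rank :: "int \<Rightarrow> int" where
  "monom_rank n = (if n > 0 then 2 * n - 1 else - 2 * n)"

definition monom_less :: "int \<Rightarrow> int \<Rightarrow> bool" where
  "monom_less i j \<longleftrightarrow> monom_rank i < monom_rank j"

text \<open>In the library \<open>0 powr 0 = 0\<close>; the weight needs the convention $0^0 = 1$.\<close>

definition real_pow :: "real \<Rightarrow> real \<Rightarrow> real" where
  "real_pow x a = (if a = 0 then 1 else x powr a)"

text \<open>The weight is only used on the unit circle, where both bases are real and nonnegative, so
  that taking real parts does not change them.\<close>

definition jacobi_weight :: "real \<times> real \<Rightarrow> complex \<Rightarrow> real" where
  "jacobi_weight k z =
     real_pow (Re (1 - (z + inverse z) / 2)) (fst k) *
     real_pow (Re (1 - (z ^ 2 + inverse (z ^ 2)) / 2)) (snd k)"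

definition jacobi_inner :: "real \<times> real \<Rightarrow> laurent \<Rightarrow> laurent \<Rightarrow> complex" where
  "jacobi_inner k p q =
     contour_integral (circlepath 0 1)
       (\<lambda>z. cnj (laurent_eval p z) * laurent_eval q z * of_real (jacobi_weight k z) / (\<i> * z))"

definition is_nonsym_jacobi :: "int \<Rightarrow> real \<times> real \<Rightarrow> laurent \<Rightarrow> bool" where
  "is_nonsym_jacobi n k p \<longleftrightarrow>
     Poly_Mapping.lookup p n = 1 \<and>
     (\<forall>j\<in>Poly_Mapping.keys p. j = n \<or> monom_less j n) \<and>
     (\<forall>j. monom_less j n \<longrightarrow> jacobi_inner k p (laurent_monom j) = 0)"

definition nonsym_jacobi :: "int \<Rightarrow> real \<times> real \<Rightarrow> laurent" where
  "nonsym_jacobi n k = (THE p. is_nonsym_jacobi n k p)"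

definition vector_jacobi :: "int \<Rightarrow> real \<times> real \<Rightarrow> complex \<Rightarrow> complex ^ 2" where
  "vector_jacobi n k z =
     vector [laurent_eval (nonsym_jacobi n k) z, laurent_eval (nonsym_jacobi n k) (inverse z)]"


section \<open>Clifford algebra and spin groups\<close>

text \<open>The Clifford algebra of Euclidean $N$-space with relations
  $e_i^2 = -1$ and $e_i e_j = - e_j e_i$ for $i \neq j$. An element is the family of its
  coordinates in the basis \<open>blade S\<close> (\<open>S \<subseteq> {1..N}\<close>), where \<open>blade S\<close> is the product of the
  $e_i$, $i \in S$, in increasing order.\<close>

type_synonym cliff = "nat set \<Rightarrow> real"

definition blade :: "nat set \<Rightarrow> cliff" where
  "blade S = (\<lambda>R. if R = S then 1 else 0)"

text \<open>\<open>blade S\<close> times \<open>blade T\<close> is \<open>blade_sign S T\<close> times the blade of the symmetric difference: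
  each pair \<open>t < s\<close> costs a transposition, each \<open>t = s\<close> a factor $e_s^2 = -1$.\<close>

definition blade_sign :: "nat set \<Rightarrow> nat set \<Rightarrow> real" where
  "blade_sign S T = (- 1) ^ card {(s, t). s \<in> S \<and> t \<in> T \<and> t \<le> s}"

definition cl_mult :: "nat \<Rightarrow> cliff \<Rightarrow> cliff \<Rightarrow> cliff" where
  "cl_mult N x y = (\<lambda>R. \<Sum>S\<in>Pow {1..N}. \<Sum>T\<in>Pow {1..N}.
      x S * y T * blade_sign S T * blade ((S - T) \<union> (T - S)) R)"

definition cl_one :: cliff where
  "cl_one = blade {}"

definition cl_vec :: "nat \<Rightarrow> (nat \<Rightarrow> real) \<Rightarrow> cliff" where
  "cl_vec N x = (\<lambda>S. \<Sum>i=1..N. x i * blade {i} S)"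

definition unit_vectors :: "nat \<Rightarrow> cliff set" where
  "unit_vectors N = {cl_vec N x | x. (\<Sum>i=1..N. (x i)\<^sup>2) = 1}"

definition Spin :: "nat \<Rightarrow> cliff monoid" where
  "Spin N =
     \<lparr>carrier = {foldr (cl_mult N) vs cl_one | vs. even (length vs) \<and> set vs \<subseteq> unit_vectors N},
      monoid.mult = cl_mult N,
      one = cl_one\<rparr>"

text \<open>The double cover of $\mathrm{SO}(N)$: \<open>u\<close> acts on vectors by $v \mapsto u v u^{-1}$.\<close>

definition spin_act :: "nat \<Rightarrow> cliff \<Rightarrow> cliff \<Rightarrow> cliff" where
  "spin_act N u v = cl_mult N (cl_mult N u v) (inv\<^bsub>Spin N\<^esub> u)"

text \<open>The groups $U \supset K \supset M$ attached to $m$.\<close>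

definition U_group :: "nat \<Rightarrow> cliff monoid" where
  "U_group m = Spin (2 * m + 2)"

definition K_group :: "nat \<Rightarrow> cliff monoid" where
  "K_group m = (U_group m)
     \<lparr>carrier := {u \<in> carrier (U_group m). spin_act (2 * m + 2) u (blade {1}) = blade {1}}\<rparr>"

definition M_group :: "nat \<Rightarrow> cliff monoid" where
  "M_group m = (U_group m)
     \<lparr>carrier := {u \<in> carrier (U_group m).
        spin_act (2 * m + 2) u (blade {1}) = blade {1} \<and>
        spin_act (2 * m + 2) u (blade {2}) = blade {2}}\<rparr>"

text \<open>\<open>plane_rot j t\<close> covers the rotation by the angle \<open>t\<close> in the plane of
  $e_{2j-1}, e_{2j}$, turning $e_{2j-1}$ towards $e_{2j}$.\<close>

definition plane_rot :: "nat \<Rightarrow> real \<Rightarrow> cliff" where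
  "plane_rot j t = (\<lambda>R. cos (t / 2) * cl_one R + sin (t / 2) * blade {2 * j - 1, 2 * j} R)"

text \<open>The subtorus of the standard maximal torus of $U$ consisting of the rotations in the planes
  number \<open>a, ..., m + 1\<close>: for \<open>a = 1\<close> it is the maximal torus of $U$, for \<open>a = 2\<close> that of both
  $K$ and $M$.\<close>

definition torus_elem :: "nat \<Rightarrow> nat \<Rightarrow> (nat \<Rightarrow> real) \<Rightarrow> cliff" where
  "torus_elem m a t = foldr (cl_mult (2 * m + 2)) (map (\<lambda>j. plane_rot j (t j)) [a..<m + 2]) cl_one"

text \<open>The element of $A$ whose coordinate is \<open>z\<close>, for \<open>z\<close> on the unit circle.\<close>

definition A_elem :: "complex \<Rightarrow> cliff" where
  "A_elem z = (\<lambda>R. Re z * cl_one R + Im z * blade {1, 2} R)"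

text \<open>The coordinate is the character of weight $\epsilon_1 / 2$.\<close>

lemma A_elem_cis: "A_elem (cis (t / 2)) = plane_rot 1 t"
  by (simp add: A_elem_def plane_rot_def)


section \<open>Unitary representations and highest weights\<close>

definition conj_transpose :: "complex ^ 'n ^ 'm \<Rightarrow> complex ^ 'm ^ 'n" where
  "conj_transpose A = (\<chi> i j. cnj (A $ j $ i))"

definition unitary_group :: "(complex ^ 'd ^ 'd) monoid" where
  "unitary_group =
     \<lparr>carrier = {A. conj_transpose A ** A = mat 1}, monoid.mult = (**), one = mat 1\<rparr>"

definition unitary_rep :: "cliff monoid \<Rightarrow> (cliff \<Rightarrow> complex ^ 'd ^ 'd) \<Rightarrow> bool" where
  "unitary_rep G \<pi> \<longleftrightarrow> \<pi> \<in> hom G unitary_group \<and> continuous_on (carrier G) \<pi>"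

definition invariant_subspace ::
  "cliff monoid \<Rightarrow> (cliff \<Rightarrow> complex ^ 'd ^ 'd) \<Rightarrow> (complex ^ 'd) set \<Rightarrow> bool" where
  "invariant_subspace G \<pi> W \<longleftrightarrow>
     vec.subspace W \<and> (\<forall>g\<in>carrier G. \<forall>w\<in>W. \<pi> g *v w \<in> W)"

definition irreducible_on ::
  "cliff monoid \<Rightarrow> (cliff \<Rightarrow> complex ^ 'd ^ 'd) \<Rightarrow> (complex ^ 'd) set \<Rightarrow> bool" where
  "irreducible_on G \<pi> W \<longleftrightarrow>
     invariant_subspace G \<pi> W \<and> W \<noteq> {0} \<and>
     (\<forall>W'. invariant_subspace G \<pi> W' \<and> W' \<subseteq> W \<longrightarrow> W' = {0} \<or> W' = W)"

text \<open>Weights are written in the coordinates $\epsilon_1, \ldots, \epsilon_{m+1}$; a weight of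
  the torus of index \<open>a\<close> is supported on \<open>{a..m + 1}\<close>.\<close>

type_synonym weight = "nat \<Rightarrow> real"

definition eps :: "nat \<Rightarrow> weight" where
  "eps i = (\<lambda>j. if j = i then 1 else 0)"

definition is_weight ::
  "nat \<Rightarrow> nat \<Rightarrow> (cliff \<Rightarrow> complex ^ 'd ^ 'd) \<Rightarrow> (complex ^ 'd) set \<Rightarrow> weight \<Rightarrow> bool" where
  "is_weight m a \<pi> W \<mu> \<longleftrightarrow>
     (\<forall>j. j \<notin> {a..m + 1} \<longrightarrow> \<mu> j = 0) \<and>
     (\<exists>v\<in>W. v \<noteq> 0 \<and>
        (\<forall>t. \<pi> (torus_elem m a t) *v v = cis (\<Sum>j=a..m + 1. \<mu> j * t j) *s v))"

definition pos_roots_D :: "nat \<Rightarrow> nat \<Rightarrow> weight set" where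
  "pos_roots_D a b =
     {\<lambda>r. eps i r - eps j r | i j. a \<le> i \<and> i < j \<and> j \<le> b} \<union>
     {\<lambda>r. eps i r + eps j r | i j. a \<le> i \<and> i < j \<and> j \<le> b}"

definition pos_roots_B :: "nat \<Rightarrow> nat \<Rightarrow> weight set" where
  "pos_roots_B a b = pos_roots_D a b \<union> eps ` {a..b}"

text \<open>\<open>\<mu>\<close> is dominated by \<open>\<Lambda>\<close> if \<open>\<Lambda> - \<mu>\<close> is a sum of positive roots.\<close>

definition dominated :: "weight set \<Rightarrow> weight \<Rightarrow> weight \<Rightarrow> bool" where
  "dominated R \<mu> \<Lambda> \<longleftrightarrow>
     (\<exists>c :: weight \<Rightarrow> nat. \<forall>r. \<Lambda> r - \<mu> r = (\<Sum>\<alpha>\<in>R. real (c \<alpha>) * \<alpha> r))"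

definition has_highest_weight ::
  "nat \<Rightarrow> nat \<Rightarrow> weight set \<Rightarrow> (cliff \<Rightarrow> complex ^ 'd ^ 'd) \<Rightarrow> (complex ^ 'd) set \<Rightarrow> weight \<Rightarrow> bool"
where
  "has_highest_weight m a R \<pi> W \<Lambda> \<longleftrightarrow>
     is_weight m a \<pi> W \<Lambda> \<and> (\<forall>\<mu>. is_weight m a \<pi> W \<mu> \<longrightarrow> dominated R \<mu> \<Lambda>)"

definition U_irrep :: "nat \<Rightarrow> weight \<Rightarrow> (cliff \<Rightarrow> complex ^ 'd ^ 'd) \<Rightarrow> bool" where
  "U_irrep m \<Lambda> \<pi> \<longleftrightarrow>
     unitary_rep (U_group m) \<pi> \<and> irreducible_on (U_group m) \<pi> UNIV \<and>
     has_highest_weight m 1 (pos_roots_D 1 (m + 1)) \<pi> UNIV \<Lambda>"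

definition K_irrep :: "nat \<Rightarrow> weight \<Rightarrow> (cliff \<Rightarrow> complex ^ 'd ^ 'd) \<Rightarrow> bool" where
  "K_irrep m \<Lambda> \<tau> \<longleftrightarrow>
     unitary_rep (K_group m) \<tau> \<and> irreducible_on (K_group m) \<tau> UNIV \<and>
     has_highest_weight m 2 (pos_roots_B 2 (m + 1)) \<tau> UNIV \<Lambda>"

text \<open>\<open>W\<close> is an irreducible constituent of highest weight \<open>\<Lambda>\<close> of the restriction to $M$.\<close>

definition M_constituent ::
  "nat \<Rightarrow> weight \<Rightarrow> (cliff \<Rightarrow> complex ^ 'd ^ 'd) \<Rightarrow> (complex ^ 'd) set \<Rightarrow> bool" where
  "M_constituent m \<Lambda> \<tau> W \<longleftrightarrow>
     irreducible_on (M_group m) \<tau> W \<and>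
     has_highest_weight m 2 (pos_roots_D 2 (m + 1)) \<tau> W \<Lambda>"

definition varpi_1 :: weight where
  "varpi_1 = eps 1"

definition varpi_plus :: "nat \<Rightarrow> weight" where
  "varpi_plus m = (\<lambda>r. 1 / 2 * (\<Sum>j=1..m + 1. eps j r))"

definition varpi_minus :: "nat \<Rightarrow> weight" where
  "varpi_minus m = (\<lambda>r. 1 / 2 * ((\<Sum>j=1..m. eps j r) - eps (m + 1) r))"

definition tau_weight :: "nat \<Rightarrow> weight" where
  "tau_weight m = (\<lambda>r. 1 / 2 * (\<Sum>j=2..m + 1. eps j r))"

definition sigma_plus_weight :: "nat \<Rightarrow> weight" where
  "sigma_plus_weight m = (\<lambda>r. 1 / 2 * ((\<Sum>j=2..m. eps j r) + eps (m + 1) r))"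

definition sigma_minus_weight :: "nat \<Rightarrow> weight" where
  "sigma_minus_weight m = (\<lambda>r. 1 / 2 * ((\<Sum>j=2..m. eps j r) - eps (m + 1) r))"


section \<open>Spherical functions\<close>

text \<open>Unitarity of the two maps means that \<open>j\<close> is isometric and \<open>p\<close> is co-isometric.\<close>

definition unitary_intertwiners ::
  "cliff monoid \<Rightarrow> (cliff \<Rightarrow> complex ^ 't ^ 't) \<Rightarrow> (cliff \<Rightarrow> complex ^ 'd ^ 'd) \<Rightarrow>
   complex ^ 't ^ 'd \<Rightarrow> complex ^ 'd ^ 't \<Rightarrow> bool" where
  "unitary_intertwiners G \<tau> \<pi> j p \<longleftrightarrow>
     (\<forall>g\<in>carrier G. \<pi> g ** j = j ** \<tau> g) \<and>
     (\<forall>g\<in>carrier G. p ** \<pi> g = \<tau> g ** p) \<and>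
     conj_transpose j ** j = mat 1 \<and>
     p ** conj_transpose p = mat 1 \<and>
     p ** j = mat 1"

definition spherical_function ::
  "(cliff \<Rightarrow> complex ^ 'd ^ 'd) \<Rightarrow> complex ^ 't ^ 'd \<Rightarrow> complex ^ 'd ^ 't \<Rightarrow>
   cliff \<Rightarrow> complex ^ 't ^ 't" where
  "spherical_function \<pi> j p u = p ** \<pi> u ** j"

definition scalar_on :: "(complex ^ 't) set \<Rightarrow> complex ^ 't ^ 't \<Rightarrow> complex" where
  "scalar_on W F = (THE c. \<forall>w\<in>W. F *v w = c *s w)"

definition restricted_spherical ::
  "(cliff \<Rightarrow> complex ^ 'd ^ 'd) \<Rightarrow> complex ^ 't ^ 'd \<Rightarrow> complex ^ 'd ^ 't \<Rightarrow>
   (complex ^ 't) set \<Rightarrow> (complex ^ 't) set \<Rightarrow> complex \<Rightarrow> complex ^ 2" where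
  "restricted_spherical \<pi> j p Wplus Wminus z =
     vector [scalar_on Wplus (spherical_function \<pi> j p (A_elem z)),
             scalar_on Wminus (spherical_function \<pi> j p (A_elem z))]"

end

theory Submission
  imports Defs "HOL-Computational_Algebra.Fundamental_Theorem_Algebra"
begin

text \<open>Let \<open>X\<^sub>a\<^sub>b\<close> be the generator of the rotations \<open>R\<^sub>a\<^sub>b(t)\<close> in the plane of \<open>e\<^sub>a, e\<^sub>b\<close> and put
  \<open>F t = p R\<^sub>1\<^sub>2(t) j\<close>. In the spin representation of \<open>K\<close> every \<open>X\<^sub>a\<^sub>b\<close> squares to \<open>-1/4\<close>, and conjugation by
  \<open>R\<^sub>2\<^sub>k(pi)\<close> turns \<open>F t\<close> into \<open>F (- t)\<close>. The Casimir operator of \<open>U\<close> is a scalar, computed on the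
  eigenspace of \<open>X\<^sub>1\<^sub>2\<close> for its top eigenvalue; writing it as the Casimir operator of \<open>K\<close> plus the squares of
  the \<open>X\<^sub>1\<^sub>k\<close>, and \<open>sin t X\<^sub>1\<^sub>k\<close> as a combination of \<open>X\<^sub>2\<^sub>k\<close> and its conjugate by \<open>R\<^sub>1\<^sub>2(t)\<close>, gives a second-order
  equation that couples \<open>F t w\<close> with \<open>F (- t) w\<close>. The product of the rotations by \<open>pi\<close> in all \<open>m + 1\<close>
  coordinate planes acts by scalars on \<open>V\<^sub>\<pi>\<close> and, without the first factor, on each half-spin
  constituent; comparing them shows that for \<open>w\<close> in one of the two constituents only the frequencies
  \<open>l + 1/2 - 2s\<close>, \<open>0 \<le> s \<le> l\<close>, occur in \<open>F t w\<close>. The equation then becomes a recurrence that determines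
  the coefficients up to a common factor, fixed by \<open>F 0 = 1\<close>. The other constituent is reached by
  \<open>R\<^sub>2\<^sub>3(pi)\<close>.

  The same coefficients give the Jacobi polynomials: in the window that matters they are the values of
  a polynomial of degree less than \<open>2m\<close>, so its differences of order \<open>2m\<close> vanish, which is the
  orthogonality with respect to the weight \<open>(1 - cos 2t)\<^sup>m\<close>.\<close>

section \<open>The radial equation on trigonometric polynomials\<close>

text \<open>Representations are only assumed continuous, and highest weights are given by torus
  eigenvectors and dominance. Generators, their diagonalizability and their commutation relations
  are therefore won from the one-parameter groups of plane rotations.

  The parity of the frequencies is what makes the coupled equation tractable. Negation maps the set
  of the numbers \<open>l + 1/2 - 2s\<close> to itself shifted by one, and the factor
  \<open>cos t\<close> in front of \<open>F (- t) w\<close> makes up for this shift. After one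
  exponential is removed, the equation is a polynomial identity in \<open>cis (- 2t)\<close>.

  The numbers \<open>dcoef m l s\<close> are the coefficients of the Gegenbauer polynomial of degree
  \<open>l\<close> and parameter \<open>m\<close>, that is, up to scale, of the zonal spherical
  function on the sphere \<open>U / K\<close>; \<open>ecoef\<close> modifies them by a linear
  factor.

  The constant in the theorem compares two normalizations: spherical functions have value 1 at the
  identity, Jacobi polynomials have leading coefficient 1. A Vandermonde sum and the duplication
  formula for Pochhammer symbols give the quotient.\<close>

text \<open>For a sequence \<open>v\<close> supported on \<open>{0..l}\<close>, \<open>radial_op m l v\<close> lists the coefficients, up to a
  constant factor, of the radial equation applied to the trigonometric polynomial
  \<open>y t = (\<Sum>s. v s * cis ((2 * l + 1 - 4 * s) / 2 * t))\<close>. Passing from \<open>y t\<close> to \<open>y (- t)\<close> replaces \<open>v s\<close> by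
  \<open>v (l - s)\<close>, up to the factor \<open>cis (- t)\<close>.\<close>

definition radial_op :: "nat \<Rightarrow> nat \<Rightarrow> (int \<Rightarrow> complex) \<Rightarrow> int \<Rightarrow> complex" where
  "radial_op m l v k =
    (let n = (\<lambda>s::int. 2 * of_nat l + 1 - 4 * of_int s :: complex);
         N = 2 * of_nat l + 1 :: complex;
         W = (\<lambda>s. (n s * n s / 4 - N * N / 4 - of_nat m * N + of_nat m / 2) * v s)
     in W k - 2 * W (k - 1) + W (k - 2)
        - 2 * of_nat m * (v k / 4 + 3 / 2 * v (k - 1) + v (k - 2) / 4)
        + 2 * of_nat m * (v (int l - (k - 1)) + v (int l - (k - 2)))
        + of_nat m * (n k * v k - n (k - 2) * v (k - 2)))"

text \<open>The reflected entries tie the two ends of the sequence together, so the induction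
  eliminates from both ends at once: among the entries not yet known to vanish, equation
  \<open>i\<close> contains only \<open>v i\<close>, and then equation \<open>l - i + 2\<close> only
  \<open>v (l - i)\<close>.\<close>

lemma radial_op_unique:
  assumes m: "m \<ge> 1" and sup: "\<And>s. s < 0 \<or> s > int l \<Longrightarrow> v s = 0" and v0: "v 0 = 0"
    and rec: "\<And>k. radial_op m l v k = 0"
  shows "v s = 0"
proof -
  have "\<forall>i. (i \<le> l \<longrightarrow> v (int i) = 0 \<and> v (int l - int i) = 0)"
  proof (rule allI, rule impI)
    fix i assume "i \<le> l"
    then show "v (int i) = 0 \<and> v (int l - int i) = 0"
    proof (induction i rule: less_induct)
      case (less i)
      have low: "v x = 0" if "x < int i" for x
      proof (cases "x < 0")
        case False
        then show ?thesis using less.IH[of "nat x"] less.prems that by auto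
      qed (use sup in auto)
      have high: "v x = 0" if "x > int l - int i" for x
      proof (cases "x > int l")
        case False
        then show ?thesis using less.IH[of "nat (int l - x)"] less.prems that by auto
      qed (use sup in auto)
      have vi: "v (int i) = 0"
      proof (cases "i = 0")
        case True
        then show ?thesis using v0 by simp
      next
        case False
        have "v (int i - 1) = 0" "v (int i - 2) = 0" "v (int l - (int i - 1)) = 0" "v (int l - (int i - 2)) = 0"
          using low high by auto
        \<comment> \<open>For \<open>i <= l\<close> this pivot vanishes only at
          \<open>i = 0\<close>; that is the one free parameter, which \<open>v0\<close>
          removes.\<close>
        then have "radial_op m l v (int i) = - (2 * of_nat i * (2 * of_nat l + 1 - 2 * of_nat i + 2 * of_nat m)) * v (int i)"
          unfolding radial_op_def Let_def by (simp add: field_simps)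
        then have "(2 * of_nat i * (2 * of_nat l + 1 - 2 * of_nat i + 2 * of_nat m)) * v (int i) = 0"
          using rec[of "int i"] by simp
        moreover have "2 * of_nat i * (2 * of_nat l + 1 - 2 * of_nat i + 2 * of_nat m) = (of_nat (2 * i * (2 * (l - i) + 1 + 2 * m)) :: complex)"
        proof -
          obtain d where "l = i + d" using less.prems le_Suc_ex by blast
          then show ?thesis by (simp add: algebra_simps)
        qed
        ultimately show ?thesis using False by (simp only: mult_eq_0_iff of_nat_eq_0_iff) simp
      qed
      have "v (int l - int i) = 0"
      proof -
        define x where "x = l - i"
        have x: "int x = int l - int i" using less.prems by (simp add: x_def)
        have "v (int x + 2) = 0" "v (int x + 1) = 0" "v (int l - (int x + 1)) = 0" "v (int l - int x) = 0"
          using low high vi by (auto simp: x)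
        \<comment> \<open>This pivot is nonzero down to \<open>x = 0\<close> because
          \<open>m >= 1\<close>.\<close>
        then have "radial_op m l v (int x + 2) = - (2 * (2 * of_nat l + 1 - 2 * of_nat x) * (of_nat x + of_nat m)) * v (int x)"
          unfolding radial_op_def Let_def by (simp add: field_simps)
        then have "(2 * (2 * of_nat l + 1 - 2 * of_nat x) * (of_nat x + of_nat m)) * v (int x) = 0"
          using rec[of "int x + 2"] by simp
        moreover have "2 * (2 * of_nat l + 1 - 2 * of_nat x) * (of_nat x + of_nat m) = (of_nat (2 * (2 * (l - x) + 1) * (x + m)) :: complex)"
        proof -
          have "l - x = i" "l = x + i" using less.prems by (simp_all add: x_def)
          then show ?thesis by (simp add: algebra_simps)
        qed
        ultimately have "v (int x) = 0" using m by (simp only: mult_eq_0_iff of_nat_eq_0_iff) simp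
        then show ?thesis by (simp add: x)
      qed
      then show ?case using vi by simp
    qed
  qed
  then show ?thesis using sup[of s] by (cases "s < 0 \<or> s > int l") (auto dest: spec[of _ "nat s"])
qed

lemma radial_op_diff: "radial_op m l (\<lambda>s. v s - c * w s) k = radial_op m l v k - c * radial_op m l w k"
  unfolding radial_op_def Let_def by (simp add: field_simps)

text \<open>\<open>ecoef\<close> is the solution of the recurrence, and \<open>ecoef m l (int l - s)\<close> is again a multiple of
  \<open>dcoef m l s\<close>; this makes the equation close up.\<close>

definition dcoef :: "nat \<Rightarrow> nat \<Rightarrow> int \<Rightarrow> complex" where
  "dcoef m l s = (if 0 \<le> s \<and> s \<le> int l then pochhammer (of_nat m) (nat s) * pochhammer (of_nat m) (nat (int l - s)) /
      (fact (nat s) * fact (nat (int l - s))) else 0)"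

definition ecoef :: "nat \<Rightarrow> nat \<Rightarrow> int \<Rightarrow> complex" where
  "ecoef m l s = dcoef m l s * (of_nat m + of_nat l - of_int s)"

text \<open>The ratio of consecutive entries, cleared of denominators so that it also holds across
  the ends of the support: at \<open>s = -1\<close> and at \<open>s = int l\<close> a factor
  vanishes where \<open>dcoef\<close> jumps.\<close>

lemma dcoef_step: "of_int (s + 1) * (of_nat m + of_nat l - of_int s - 1) * dcoef m l (s + 1) =
    (of_nat m + of_int s) * (of_nat l - of_int s) * dcoef m l s"
proof (cases "0 \<le> s \<and> s < int l")
  case True
  define a where "a = nat s"
  define b where "b = nat (int l - s - 1)"
  have s: "s = int a" "l = a + b + 1" using True by (auto simp: a_def b_def)
  have "nat (1 + int a) = Suc a" "nat (1 + int b) = Suc b" "nat (int b) = b" by auto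
  moreover have "1 + (of_nat a :: complex) \<noteq> 0" "1 + (of_nat b :: complex) \<noteq> 0"
    by (metis of_nat_Suc of_nat_neq_0)+
  ultimately show ?thesis
    by (simp add: s dcoef_def pochhammer_Suc add_ac)
next
  case False
  then consider "s = -1" | "s = int l" | "s < -1" | "s > int l" by linarith
  then show ?thesis by cases (auto simp: dcoef_def)
qed

lemma ecoef_reflect: "ecoef m l (int l - s) = dcoef m l s * (of_nat m + of_int s)"
  by (auto simp: ecoef_def dcoef_def mult_ac)

lemma radial_op_ecoef: "radial_op m l (ecoef m l) k = 0"
proof -
  define a where "a = dcoef m l (k - 2)"
  define b where "b = dcoef m l (k - 1)"
  define c where "c = dcoef m l k"
  define K where "K = (of_int k :: complex)"
  define M where "M = (of_nat m :: complex)"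
  define L where "L = (of_nat l :: complex)"
  have 1: "K * (M + L - K) * c = (M + K - 1) * (L - K + 1) * b"
    using dcoef_step[of "k - 1" m l] by (simp add: b_def c_def K_def M_def L_def algebra_simps)
  have 2: "(K - 1) * (M + L - K + 1) * b = (M + K - 2) * (L - K + 2) * a"
    using dcoef_step[of "k - 2" m l] by (simp add: a_def b_def K_def M_def L_def algebra_simps)
  have e: "ecoef m l k = c * (M + L - K)" "ecoef m l (k - 1) = b * (M + L - K + 1)" "ecoef m l (k - 2) = a * (M + L - K + 2)"
    "ecoef m l (int l - (k - 1)) = b * (M + K - 1)" "ecoef m l (int l - (k - 2)) = a * (M + K - 2)"
    unfolding ecoef_reflect by (simp_all add: ecoef_def a_def b_def c_def K_def M_def L_def algebra_simps)
  \<comment> \<open>A linear form in \<open>a\<close>, \<open>b\<close>, \<open>c\<close> that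
    combines the two ratio relations; the multipliers are read off from the coefficients of
    \<open>c\<close> and \<open>a\<close>, and \<open>b\<close> then agrees.\<close>
  have "radial_op m l (ecoef m l) k =
      - (2 * (2 * L + 1 - 2 * K + 2 * M)) * (K * (M + L - K) * c - (M + K - 1) * (L - K + 1) * b)
      + 2 * (2 * M + 2 * (L - K + 2) + 1) * ((K - 1) * (M + L - K + 1) * b - (M + K - 2) * (L - K + 2) * a)"
    unfolding radial_op_def Let_def e of_int_diff K_def[symmetric] M_def[symmetric] L_def[symmetric]
    by (simp add: field_simps)
  then show ?thesis by (simp add: 1 2)
qed

section \<open>From the differential equation to the recurrence\<close>

lemma infinite_unit_circle_image: "infinite (range (\<lambda>t::real. cis (- (2 * t))))"
proof
  assume fin: "finite (range (\<lambda>t::real. cis (- (2 * t))))"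
  have "inj_on (\<lambda>t::real. cis (- (2 * t))) {0..1}"
  proof (rule inj_onI)
    fix x y :: real assume xy: "x \<in> {0..1}" "y \<in> {0..1}" "cis (- (2 * x)) = cis (- (2 * y))"
    then have "cos (2 * x) = cos (2 * y)" by (simp add: complex_eq_iff)
    moreover have "2 * x \<le> pi" "2 * y \<le> pi" using xy pi_gt3 by auto
    ultimately show "x = y" using xy cos_inj_pi[of "2 * x" "2 * y"] by auto
  qed
  moreover have "finite ((\<lambda>t::real. cis (- (2 * t))) ` {0..1})" using fin by (rule finite_subset[rotated]) auto
  ultimately have "finite {0..1::real}" by (rule finite_imageD[rotated])
  then show False using infinite_Icc[of "0::real" 1] by simp
qed

text \<open>Indexing by \<open>int\<close> turns multiplication by the variable into the shift to
  \<open>k - 1\<close> without a boundary case, which is the shape of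
  \<open>radial_op\<close>.\<close>

definition int_coeff :: "complex poly \<Rightarrow> int \<Rightarrow> complex" where
  "int_coeff q k = (if 0 \<le> k then coeff q (nat k) else 0)"

lemma int_coeff_pCons: "int_coeff (pCons 0 q) k = int_coeff q (k - 1)"
proof (cases "k \<ge> 1")
  case True
  then have "nat k = Suc (nat (k - 1))" by simp
  then show ?thesis using True by (simp add: int_coeff_def)
next
  case False
  then show ?thesis by (cases "k = 0") (auto simp: int_coeff_def)
qed

lemma int_coeff_add: "int_coeff (q + r) k = int_coeff q k + int_coeff r k" and int_coeff_diff: "int_coeff (q - r) k = int_coeff q k - int_coeff r k"
  and int_coeff_smult: "int_coeff (smult c q) k = c * int_coeff q k"
  by (simp_all add: int_coeff_def)

lemma int_coeff_sum_monom: "int_coeff (\<Sum>s\<le>l. monom (f s) s) k = (if 0 \<le> k \<and> k \<le> int l then f (nat k) else 0)"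
  by (auto simp: int_coeff_def coeff_sum le_nat_iff nat_le_iff)

definition freq :: "nat \<Rightarrow> nat \<Rightarrow> real" where
  "freq l s = 2 * real l + 1 - 4 * real s"

definition trig :: "nat \<Rightarrow> (nat \<Rightarrow> complex) \<Rightarrow> real \<Rightarrow> complex" where
  "trig l u t = (\<Sum>s\<le>l. cis (freq l s / 2 * t) * u s)"

lemma trig_poly: "trig l u t = cis ((2 * real l + 1) / 2 * t) * poly (\<Sum>s\<le>l. monom (u s) s) (cis (- (2 * t)))"
proof -
  have "cis (freq l s / 2 * t) = cis ((2 * real l + 1) / 2 * t) * cis (- (2 * t)) ^ s" for s
  proof -
    have "freq l s / 2 * t = (2 * real l + 1) / 2 * t + real s * (- (2 * t))" by (simp add: freq_def field_simps)
    then show ?thesis unfolding Complex.DeMoivre cis_mult by (simp only:)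
  qed
  then show ?thesis by (simp add: trig_def poly_sum poly_monom sum_distrib_left mult_ac)
qed

lemma trig_neg: "trig l u (- t) = cis (- t) * trig l (\<lambda>s. u (l - s)) t"
proof -
  have "trig l u (- t) = (\<Sum>s\<le>l. cis (freq l (l - s) / 2 * - t) * u (l - s))"
    unfolding trig_def by (rule sum.reindex_bij_witness[of _ "\<lambda>s. l - s" "\<lambda>s. l - s"]) auto
  also have "\<dots> = (\<Sum>s\<le>l. cis (- t) * (cis (freq l s / 2 * t) * u (l - s)))"
  proof (rule sum.cong[OF refl])
    fix s assume "s \<in> {..l}"
    then have "freq l (l - s) / 2 * - t = - t + freq l s / 2 * t" by (simp add: freq_def of_nat_diff field_simps)
    then show "cis (freq l (l - s) / 2 * - t) * u (l - s) = cis (- t) * (cis (freq l s / 2 * t) * u (l - s))"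
      unfolding mult.assoc[symmetric] cis_mult by (simp only:)
  qed
  finally show ?thesis by (simp add: trig_def sum_distrib_left)
qed

text \<open>Without the common factor \<open>Z\<close> the equation relates polynomials in
  \<open>Y = cis (- 2t)\<close>. It holds at infinitely many points, so coefficients may be
  compared.\<close>

lemma ode_imp_radial_op:
  fixes l m :: nat and u :: "nat \<Rightarrow> complex"
  defines "K \<equiv> - ((2 * real l + 1)\<^sup>2 / 4 + real m * (2 * real l + 1) - real m / 2)"
  assumes ode: "\<And>t. of_real ((sin t)\<^sup>2) * (of_real K * trig l u t - trig l (\<lambda>s. (\<i> * of_real (freq l s / 2)) ^ 2 * u s) t) =
     of_real (- (real m / 2) * (1 + (cos t)\<^sup>2)) * trig l u t + of_real (real m * cos t) * trig l u (- t)
     + of_real (2 * real m * (sin t * cos t)) * trig l (\<lambda>s. (\<i> * of_real (freq l s / 2)) * u s) t"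
  shows "radial_op m l (\<lambda>s. if 0 \<le> s \<and> s \<le> int l then u (nat s) else 0) k = 0"
proof -
  let ?P = "\<lambda>f. \<Sum>s\<le>l. monom (f s) s"
  let ?n = "\<lambda>s. of_real (freq l s) :: complex"
  let ?PU = "?P u" and ?W = "?P (\<lambda>s. (of_real K + ?n s * ?n s / 4) * u s)" and ?R = "?P (\<lambda>s. u (l - s))" and ?M = "?P (\<lambda>s. ?n s * u s)"
  define T where "T = ?W - smult 2 (pCons 0 ?W) + pCons 0 (pCons 0 ?W)
     - smult (2 * of_nat m) (smult (1/4) (?P u) + smult (3/2) (pCons 0 (?P u)) + smult (1/4) (pCons 0 (pCons 0 (?P u))))
     + smult (2 * of_nat m) (pCons 0 ?R + pCons 0 (pCons 0 ?R)) + smult (of_nat m) (?M - pCons 0 (pCons 0 ?M))"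
  have zero: "poly T (cis (- (2 * t))) = 0" for t
  proof -
    define c where "c = cis (- t)"
    define Z where "Z = cis ((2 * real l + 1) / 2 * t)"
    define Y where "Y = cis (- (2 * t))"
    have Y: "Y = c * c" by (simp add: Y_def c_def cis_mult)
    have c0: "c \<noteq> 0" "Z \<noteq> 0" by (simp_all add: c_def Z_def)
    have inv: "cis t = 1 / c" by (simp add: c_def divide_inverse cis_inverse)
    have "of_real (cos t) = (cis t + cis (- t)) / 2" "of_real (sin t) = (cis t - cis (- t)) / (2 * \<i>)"
      by (simp_all add: complex_eq_iff)
    then have ct: "of_real (cos t) = (1 + c * c) / (2 * c)" and st: "of_real (sin t) = (1 - c * c) / (2 * \<i> * c)"
      unfolding inv c_def[symmetric] using c0 by (simp_all add: field_simps)
    have "of_real K * trig l u t - trig l (\<lambda>s. (\<i> * of_real (freq l s / 2)) ^ 2 * u s) t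
        = trig l (\<lambda>s. (of_real K + ?n s * ?n s / 4) * u s) t"
      unfolding trig_def sum_distrib_left sum_subtractf[symmetric]
      by (intro sum.cong refl) (simp add: power2_eq_square field_simps)
    then have W: "of_real K * trig l u t - trig l (\<lambda>s. (\<i> * of_real (freq l s / 2)) ^ 2 * u s) t = Z * poly ?W Y"
      unfolding trig_poly[of l "\<lambda>s. (of_real K + ?n s * ?n s / 4) * u s"] Z_def Y_def .
    have "trig l (\<lambda>s. (\<i> * of_real (freq l s / 2)) * u s) t = \<i> / 2 * trig l (\<lambda>s. ?n s * u s) t"
      unfolding trig_def sum_distrib_left by (intro sum.cong refl) simp
    then have M: "trig l (\<lambda>s. (\<i> * of_real (freq l s / 2)) * u s) t = Z * (\<i> / 2 * poly ?M Y)"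
      unfolding trig_poly[of l "\<lambda>s. ?n s * u s"] Z_def Y_def by (simp only: mult.left_commute)
    have R: "trig l u (- t) = Z * (c * poly ?R Y)"
      unfolding trig_neg trig_poly[of l "\<lambda>s. u (l - s)"] by (simp add: c_def Z_def Y_def)
    have P: "trig l u t = Z * poly (?P u) Y" unfolding trig_poly by (simp add: Z_def Y_def)
    have "of_real ((sin t)\<^sup>2) * (Z * poly ?W Y) = of_real (- (real m / 2) * (1 + (cos t)\<^sup>2)) * (Z * poly (?P u) Y)
       + of_real (real m * cos t) * (Z * (c * poly ?R Y)) + of_real (2 * real m * (sin t * cos t)) * (Z * (\<i> / 2 * poly ?M Y))"
      by (rule ode[of t, unfolded W, unfolded M R P])
    then have "Z * (of_real ((sin t)\<^sup>2) * poly ?W Y) = Z * (of_real (- (real m / 2) * (1 + (cos t)\<^sup>2)) * poly (?P u) Y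
       + of_real (real m * cos t) * (c * poly ?R Y) + of_real (2 * real m * (sin t * cos t)) * (\<i> / 2 * poly ?M Y))"
      by (simp add: algebra_simps)
    then have "(of_real (sin t))\<^sup>2 * poly ?W Y = - (of_nat m / 2) * (1 + (of_real (cos t))\<^sup>2) * poly (?P u) Y
       + of_nat m * of_real (cos t) * (c * poly ?R Y) + 2 * of_nat m * (of_real (sin t) * of_real (cos t)) * (\<i> / 2 * poly ?M Y)"
      using c0(2) by simp
    note h = this
    \<comment> \<open>The factor \<open>-4Y\<close> clears the denominators of \<open>sin^2\<close>,
      \<open>cos^2\<close>, \<open>sin cos\<close> and of \<open>c cos t\<close>, all written
      through \<open>c = cis (- t)\<close>.\<close>
    have scale: "(-4 * Y * S) * W' = (-4 * Y * B) * P' + (-4 * Y * (C * c)) * R' + (-4 * Y * (D * (\<i> / 2))) * M'"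
      if "S * W' = B * P' + C * (c * R') + D * (\<i> / 2 * M')" for S W' B P' C R' D M'
    proof -
      have "(-4 * Y * S) * W' = -4 * Y * (S * W')" by simp
      also have "\<dots> = (-4 * Y * B) * P' + (-4 * Y * (C * c)) * R' + (-4 * Y * (D * (\<i> / 2))) * M'"
        unfolding that by (simp add: algebra_simps)
      finally show ?thesis .
    qed
    note eq = scale[OF h]
    have k1: "-4 * Y * (of_real (sin t))\<^sup>2 = (1 - Y)\<^sup>2"
      unfolding st Y using c0(1) by (simp add: field_simps power2_eq_square)
    have k2: "-4 * Y * (- (of_nat m / 2) * (1 + (of_real (cos t))\<^sup>2)) = 2 * of_nat m * (Y + (1 + Y)\<^sup>2 / 4)"
      unfolding ct Y using c0(1) by (simp add: field_simps power2_eq_square)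
    have k3: "-4 * Y * (of_nat m * of_real (cos t) * c) = - (2 * of_nat m * Y * (1 + Y))"
      unfolding ct Y using c0(1) by (simp add: field_simps)
    have k4: "-4 * Y * (2 * of_nat m * (of_real (sin t) * of_real (cos t)) * (\<i> / 2)) = - (of_nat m * (1 - Y\<^sup>2))"
      unfolding ct st Y using c0(1) by (simp add: field_simps power2_eq_square)
    have "(1 - Y)\<^sup>2 * poly ?W Y = 2 * of_nat m * (Y + (1 + Y)\<^sup>2 / 4) * poly ?PU Y
       - 2 * of_nat m * Y * (1 + Y) * poly ?R Y - of_nat m * (1 - Y\<^sup>2) * poly ?M Y"
      using eq unfolding k1 k2 k3 k4 by simp
    then show ?thesis unfolding T_def Y_def[symmetric] by (simp add: algebra_simps power2_eq_square)
  qed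
  have "T = 0"
  proof (rule ccontr)
    assume "T \<noteq> 0"
    then have "finite {x. poly T x = 0}" by (rule poly_roots_finite)
    moreover have "range (\<lambda>t::real. cis (- (2 * t))) \<subseteq> {x. poly T x = 0}" using zero by auto
    ultimately show False using infinite_unit_circle_image finite_subset by blast
  qed
  then have "int_coeff T k = 0" by (simp add: int_coeff_def)
  moreover have "int_coeff T k = radial_op m l (\<lambda>s. if 0 \<le> s \<and> s \<le> int l then u (nat s) else 0) k"
  proof -
    let ?v = "\<lambda>s. if 0 \<le> s \<and> s \<le> int l then u (nat s) else 0"
    define n where "n = (\<lambda>s::int. 2 * of_nat l + 1 - 4 * of_int s :: complex)"
    have nn: "?n (nat s) = n s" if "0 \<le> s" for s using that by (simp add: n_def freq_def)
    have KK: "of_real K = - ((2 * of_nat l + 1) * (2 * of_nat l + 1) / 4 + of_nat m * (2 * of_nat l + 1) - of_nat m / (2::complex))"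
      by (simp add: K_def power2_eq_square)
    have eP: "int_coeff (?P u) s = ?v s" for s by (simp add: int_coeff_sum_monom)
    have eR: "int_coeff ?R s = ?v (int l - s)" for s
      unfolding int_coeff_sum_monom by (auto simp: nat_diff_distrib)
    have eM: "int_coeff ?M s = n s * ?v s" for s unfolding int_coeff_sum_monom by (auto simp: nn)
    have eW: "int_coeff ?W s = (n s * n s / 4 - (2 * of_nat l + 1) * (2 * of_nat l + 1) / 4 - of_nat m * (2 * of_nat l + 1) + of_nat m / 2) * ?v s" for s
      unfolding int_coeff_sum_monom by (auto simp: nn KK)
    show ?thesis unfolding T_def int_coeff_add int_coeff_diff int_coeff_smult int_coeff_pCons eP eR eM eW radial_op_def Let_def n_def[symmetric]
      by (simp add: n_def)
  qed
  ultimately show ?thesis by simp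
qed

section \<open>Normalization of the solution\<close>

lemma dcoef_0: "dcoef m l 0 = pochhammer (of_nat m) l / fact l"
  by (simp add: dcoef_def)

text \<open>The linear factor of \<open>ecoef\<close> raises \<open>pochhammer m (l - s)\<close> to
  \<open>m * pochhammer (m + 1) (l - s)\<close>. In this form the sum over \<open>s\<close> is a
  Vandermonde convolution.\<close>

lemma ecoef_eq:
  assumes "s \<le> l" "m \<ge> 1"
  shows "ecoef m l (int s) = of_nat m * (of_nat (l choose s) * pochhammer (of_nat m) s * pochhammer (of_nat m + 1) (l - s)) / fact l"
proof -
  have "pochhammer (of_nat m) (Suc (l - s)) = of_nat m * pochhammer (of_nat m + 1 :: complex) (l - s)"
    by (rule pochhammer_rec)
  then have p: "pochhammer (of_nat m) (l - s) * (of_nat m + of_nat (l - s)) = of_nat m * pochhammer (of_nat m + 1 :: complex) (l - s)"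
    by (simp add: pochhammer_Suc)
  have b: "of_nat (l choose s) = (fact l / (fact s * fact (l - s)) :: complex)"
    using assms(1) by (rule binomial_fact)
  have "nat (int l - int s) = l - s" using assms(1) by simp
  then have "ecoef m l (int s) = pochhammer (of_nat m) s * (pochhammer (of_nat m) (l - s) * (of_nat m + of_nat (l - s))) / (fact s * fact (l - s))"
    using assms(1) by (simp add: ecoef_def dcoef_def of_nat_diff algebra_simps)
  then show ?thesis unfolding p b by simp
qed

lemma sum_ecoef:
  assumes "m \<ge> 1"
  shows "(\<Sum>s\<le>l. ecoef m l (int s)) = of_nat m * pochhammer (of_nat (2 * m + 1)) l / fact l"
proof -
  have "(\<Sum>s\<le>l. ecoef m l (int s)) = of_nat m * (\<Sum>s\<le>l. of_nat (l choose s) * pochhammer (of_nat m) s * pochhammer (of_nat m + 1) (l - s)) / fact l"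
    using assms by (simp add: ecoef_eq sum_distrib_left sum_divide_distrib)
  also have "(\<Sum>s\<le>l. of_nat (l choose s) * pochhammer (of_nat m) s * pochhammer (of_nat m + 1) (l - s)) = pochhammer (of_nat m + (of_nat m + 1) :: complex) l"
    by (rule pochhammer_binomial_sum[symmetric])
  also have "of_nat m + (of_nat m + 1) = (of_nat (2 * m + 1) :: complex)" by simp
  finally show ?thesis .
qed

lemma pochhammer_of_nat_neq_0:
  assumes a: "a \<ge> 1"
  shows "pochhammer (of_nat a :: complex) k \<noteq> 0"
proof
  assume "pochhammer (of_nat a :: complex) k = 0"
  then obtain i where "of_nat a = - (of_nat i :: complex)" by (auto simp: pochhammer_eq_0_iff)
  then have "of_nat (a + i) = (0 :: complex)" by simp
  then have "a + i = 0" unfolding of_nat_eq_0_iff .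
  then show False using a by simp
qed

text \<open>The recurrence leaves one constant \<open>c\<close>. At \<open>t = 0\<close> all
  exponentials are 1, so \<open>c\<close> is the initial value divided by the sum of the
  coefficients.\<close>

lemma radial_solution:
  fixes l m :: nat and u :: "nat \<Rightarrow> complex"
  assumes m: "m \<ge> 1"
    and ode: "\<And>t. of_real ((sin t)\<^sup>2) * (of_real (- ((2 * real l + 1)\<^sup>2 / 4 + real m * (2 * real l + 1) - real m / 2)) * trig l u t
        - trig l (\<lambda>s. (\<i> * of_real (freq l s / 2)) ^ 2 * u s) t) =
     of_real (- (real m / 2) * (1 + (cos t)\<^sup>2)) * trig l u t + of_real (real m * cos t) * trig l u (- t)
     + of_real (2 * real m * (sin t * cos t)) * trig l (\<lambda>s. (\<i> * of_real (freq l s / 2)) * u s) t"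
  shows "trig l u t = trig l u 0 * (fact l / (of_nat m * pochhammer (of_nat (2 * m + 1)) l) * trig l (\<lambda>s. ecoef m l (int s)) t)"
proof -
  define v where "v = (\<lambda>s. if 0 \<le> s \<and> s \<le> int l then u (nat s) else 0)"
  define c where "c = v 0 / ecoef m l 0"
  have e0: "ecoef m l 0 \<noteq> 0"
    using m pochhammer_of_nat_neq_0[of m l] by (simp add: ecoef_def dcoef_0) (simp flip: of_nat_add)
  have vanish: "v s - c * ecoef m l s = 0" for s
  proof (rule radial_op_unique[OF m, where v="\<lambda>s. v s - c * ecoef m l s"])
    show "v s - c * ecoef m l s = 0" if "s < 0 \<or> s > int l" for s
      using that by (auto simp: v_def ecoef_def dcoef_def)
    show "v 0 - c * ecoef m l 0 = 0" using e0 by (simp add: c_def)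
    show "radial_op m l (\<lambda>s. v s - c * ecoef m l s) k = 0" for k
      using ode_imp_radial_op[OF ode, of k] unfolding radial_op_diff radial_op_ecoef v_def by simp
  qed
  have "u s = c * ecoef m l (int s)" if "s \<le> l" for s
    using vanish[of "int s"] that by (simp add: v_def)
  then have eq: "trig l u t = c * trig l (\<lambda>s. ecoef m l (int s)) t" for t
    by (simp add: trig_def sum_distrib_left mult_ac)
  have "trig l (\<lambda>s. ecoef m l (int s)) 0 = of_nat m * pochhammer (of_nat (2 * m + 1)) l / fact l"
    using sum_ecoef[OF m, of l] by (simp add: trig_def)
  moreover have "pochhammer (of_nat (2 * m + 1) :: complex) l \<noteq> 0" by (rule pochhammer_of_nat_neq_0) simp
  ultimately show ?thesis unfolding eq[of t] eq[of 0] using m by (simp add: field_simps)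
qed

section \<open>Non-symmetric Jacobi polynomials with multiplicity \<open>(0, m)\<close>\<close>

lemma alternating_binomial_Suc:
  fixes f :: "nat \<Rightarrow> 'a::comm_ring_1"
  shows "(\<Sum>k\<le>Suc n. (-1) ^ k * of_nat (Suc n choose k) * f k) =
    (\<Sum>k\<le>n. (-1) ^ k * of_nat (n choose k) * (f k - f (Suc k)))"
proof -
  have "(\<Sum>k\<le>n. (-1) ^ k * of_nat (n choose k) * f k) = (\<Sum>k\<le>Suc n. (-1) ^ k * of_nat (n choose k) * f k)"
    by (simp add: binomial_eq_0)
  also have "\<dots> = f 0 + (\<Sum>k\<le>n. (-1) ^ Suc k * of_nat (n choose Suc k) * f (Suc k))"
    by (subst sum.atMost_Suc_shift) simp
  finally have 1: "(\<Sum>k\<le>n. (-1) ^ k * of_nat (n choose k) * f k) =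
      f 0 + (\<Sum>k\<le>n. (-1) ^ Suc k * of_nat (n choose Suc k) * f (Suc k))" .
  have "(\<Sum>k\<le>Suc n. (-1) ^ k * of_nat (Suc n choose k) * f k) =
      f 0 + (\<Sum>k\<le>n. (-1) ^ Suc k * of_nat (Suc n choose Suc k) * f (Suc k))"
    by (subst sum.atMost_Suc_shift) simp
  also have "\<dots> = (f 0 + (\<Sum>k\<le>n. (-1) ^ Suc k * of_nat (n choose Suc k) * f (Suc k))) -
      (\<Sum>k\<le>n. (-1) ^ k * of_nat (n choose k) * f (Suc k))"
    by (simp add: algebra_simps sum.distrib sum_subtractf sum_negf)
  also have "\<dots> = (\<Sum>k\<le>n. (-1) ^ k * of_nat (n choose k) * (f k - f (Suc k)))"
    unfolding 1[symmetric] by (simp add: algebra_simps sum_subtractf)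
  finally show ?thesis .
qed

lemma degree_difference_less:
  fixes q :: "'a::{idom,ring_char_0} poly"
  assumes "degree q > 0"
  shows "degree (q - pcompose q [:-1, 1:]) < degree q"
proof -
  let ?r = "pcompose q [:-1, 1:]"
  have d: "degree ?r = degree q" by (simp add: degree_pcompose)
  have "lead_coeff ?r = lead_coeff q" by (subst lead_coeff_comp) auto
  then have "coeff (q - ?r) (degree q) = 0" by (simp add: d)
  moreover have "degree (q - ?r) \<le> degree q" using degree_diff_le_max[of q ?r] by (simp add: d)
  ultimately show ?thesis using assms
    by (metis degree_0 le_neq_implies_less leading_coeff_0_iff)
qed

text \<open>A difference of order \<open>n\<close>: each single difference lowers the degree, so
  \<open>n\<close> of them annihilate \<open>q\<close>.\<close>

lemma alternating_binomial_sum_poly: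
  fixes q :: "'a::{idom,ring_char_0} poly"
  assumes "degree q < n"
  shows "(\<Sum>k\<le>n. (-1) ^ k * of_nat (n choose k) * poly q (x - of_nat k)) = 0"
  using assms
proof (induction n arbitrary: q)
  case (Suc n)
  let ?d = "q - pcompose q [:-1, 1:]"
  have "(\<Sum>k\<le>Suc n. (-1) ^ k * of_nat (Suc n choose k) * poly q (x - of_nat k)) =
      (\<Sum>k\<le>n. (-1) ^ k * of_nat (n choose k) * poly ?d (x - of_nat k))"
    by (simp only: alternating_binomial_Suc) (simp add: poly_pcompose algebra_simps)
  also have "\<dots> = 0"
  proof (cases "degree q = 0")
    case True
    then obtain c where "q = [:c:]" by (rule degree_eq_zeroE)
    then show ?thesis by (simp add: pcompose_pCons)
  next
    case False
    then show ?thesis using Suc degree_difference_less[of q] by (intro Suc.IH) auto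
  qed
  finally show ?case .
qed simp

text \<open>Since \<open>pochhammer m s / s! = pochhammer (s + 1) (m - 1) / (m - 1)!\<close>, and
  similarly for the other factor, the entries are values of a polynomial of degree at most
  \<open>2m - 1\<close>. Its roots \<open>-1, ..., -(m - 1)\<close> and
  \<open>l + 1, ..., l + m\<close> match the zero entries outside \<open>{0..l}\<close>; this gives
  the window.\<close>

lemma ecoef_poly:
  assumes m: "m \<ge> 1"
  obtains q :: "complex poly" where "degree q < 2 * m"
    "\<And>s. - int m < s \<Longrightarrow> s \<le> int l + int m \<Longrightarrow> ecoef m l s = poly q (of_int s)"
proof -
  define q :: "complex poly" where
    "q = (\<Prod>i<m - 1. [:1 + of_nat i, 1:]) * (\<Prod>i<m. [:of_nat l + 1 + of_nat i, -1:])"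
  have q: "poly q x = pochhammer (x + 1) (m - 1) * pochhammer (of_nat l + 1 - x) m" for x
    by (simp add: q_def poly_prod pochhammer_prod atLeast0LessThan algebra_simps)
  define c :: complex where "c = of_nat m / (fact (m - 1) * fact m)"
  have "degree (\<Prod>i<m - 1. [:1 + of_nat i, 1 :: complex:]) \<le> (\<Sum>i<m - 1. 1)"
    by (rule order_trans[OF degree_prod_sum_le]) auto
  moreover have "degree (\<Prod>i<m. [:of_nat l + 1 + of_nat i, -1 :: complex:]) \<le> (\<Sum>i<m. 1)"
    by (rule order_trans[OF degree_prod_sum_le]) auto
  ultimately have "degree q \<le> (m - 1) + m"
    unfolding q_def by (intro order_trans[OF degree_mult_le]) simp
  then have "degree (smult c q) < 2 * m" using m degree_smult_le[of c q] by linarith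
  moreover have "ecoef m l s = poly (smult c q) (of_int s)" if "- int m < s" "s \<le> int l + int m" for s
  proof -
    consider "s < 0" | "s > int l" | "0 \<le> s \<and> s \<le> int l" by linarith
    then show ?thesis
    proof cases
      case 1
      define i where "i = nat (- s - 1)"
      have "s = - int i - 1" "i < m - 1" using 1 that by (auto simp: i_def)
      then have "pochhammer (of_int s + 1 :: complex) (m - 1) = 0"
        by (auto simp: pochhammer_eq_0_iff)
      then show ?thesis using 1 by (simp add: q ecoef_def dcoef_def)
    next
      case 2
      define i where "i = nat (s - int l - 1)"
      have "s = int l + int i + 1" "i < m" using 2 that by (auto simp: i_def)
      then have "pochhammer (of_nat l + 1 - of_int s :: complex) m = 0"
        by (auto simp: pochhammer_eq_0_iff)
      then show ?thesis using 2 by (simp add: q ecoef_def dcoef_def)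
    next
      case 3
      define k where "k = nat s"
      have k: "s = int k" "k \<le> l" using 3 by (auto simp: k_def)
      define M where "M = m - 1"
      have M: "m = Suc M" using m by (simp add: M_def)
      have mm: "(of_nat m :: complex) = 1 + of_nat M" by (simp add: M)
      \<comment> \<open>Both sides equal \<open>fact (M + k)\<close>; in \<open>b\<close> both sides
        equal \<open>fact (m + (l - k))\<close>.\<close>
      have a: "pochhammer (of_nat m) k * fact M = fact k * (pochhammer (of_nat k + 1) M :: complex)"
        using pochhammer_product[of M "M + k" "1::complex"] pochhammer_product[of k "M + k" "1::complex"]
        unfolding mm by (simp add: pochhammer_fact mult.commute add.commute)
      have b: "pochhammer (of_nat m + 1) (l - k) * fact m = fact (l - k) * (pochhammer (of_nat (l - k) + 1) m :: complex)"
        using pochhammer_product[of m "m + (l - k)" "1::complex"] pochhammer_product[of "l - k" "m + (l - k)" "1::complex"]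
        by (simp add: pochhammer_fact mult.commute add.commute)
      have "of_nat (l choose k) = (fact l / (fact k * fact (l - k)) :: complex)"
        using k(2) by (rule binomial_fact)
      then have "ecoef m l s = of_nat m * (pochhammer (of_nat m) k / fact k) * (pochhammer (of_nat m + 1) (l - k) / fact (l - k))"
        using ecoef_eq[OF k(2) m] by (simp add: k)
      also have "pochhammer (of_nat m) k / fact k = (pochhammer (of_nat k + 1) M / fact M :: complex)"
        using a by (simp add: field_simps)
      also have "pochhammer (of_nat m + 1) (l - k) / fact (l - k) = (pochhammer (of_nat (l - k) + 1) m / fact m :: complex)"
        using b by (simp add: field_simps)
      finally show ?thesis using k by (simp add: q c_def M_def of_nat_diff algebra_simps)
    qed
  qed
  ultimately show ?thesis using that by blast
qed

text \<open>The bounds on \<open>R\<close> keep all \<open>2m + 1\<close> arguments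
  \<open>R - 2m, ..., R\<close> in the window of \<open>ecoef_poly\<close>.\<close>

lemma ecoef_alternating_sum:
  assumes m: "m \<ge> 1" and R: "int m < R" "R \<le> int m + int l"
  shows "(\<Sum>r\<le>2 * m. (-1) ^ r * of_nat (2 * m choose r) * ecoef m l (R - int r)) = 0"
proof -
  obtain q :: "complex poly" where q: "degree q < 2 * m"
    "\<And>s. - int m < s \<Longrightarrow> s \<le> int l + int m \<Longrightarrow> ecoef m l s = poly q (of_int s)"
    using ecoef_poly[OF m, of l] by blast
  have "(\<Sum>r\<le>2 * m. (-1) ^ r * of_nat (2 * m choose r) * ecoef m l (R - int r)) =
      (\<Sum>r\<le>2 * m. (-1) ^ r * of_nat (2 * m choose r) * poly q (of_int R - of_nat r))"
    using R by (intro sum.cong refl) (auto simp: q(2))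
  then show ?thesis using alternating_binomial_sum_poly[OF q(1), of "of_int R"] by simp
qed

section \<open>Laurent polynomials on the circle and integration against the weight\<close>

lemma laurent_eval_superset:
  assumes "finite S" "Poly_Mapping.keys p \<subseteq> S"
  shows "laurent_eval p z = (\<Sum>n\<in>S. Poly_Mapping.lookup p n * z powi n)"
  unfolding laurent_eval_def using assms by (intro sum.mono_neutral_left) (auto simp: in_keys_iff)

lemma laurent_eval_diff: "laurent_eval (p - q) z = laurent_eval p z - laurent_eval q z"
proof -
  let ?S = "Poly_Mapping.keys p \<union> Poly_Mapping.keys q"
  have "Poly_Mapping.keys (p - q) \<subseteq> ?S" by (auto simp: in_keys_iff lookup_minus)
  then show ?thesis
    using laurent_eval_superset[of ?S "p - q" z] laurent_eval_superset[of ?S p z] laurent_eval_superset[of ?S q z]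
    by (simp add: lookup_minus algebra_simps sum_subtractf)
qed

lemma cis_powi: "cis t powi n = cis (of_int n * t)"
  by (simp add: cis_power_int)

lemma laurent_eval_cis: "laurent_eval p (cis t) = (\<Sum>n\<in>Poly_Mapping.keys p. Poly_Mapping.lookup p n * cis (of_int n * t))"
  by (simp add: laurent_eval_def cis_powi)

lemma laurent_eval_monom: "laurent_eval (laurent_monom n) (cis t) = cis (of_int n * t)"
  by (simp add: laurent_eval_cis laurent_monom_def)

lemma continuous_laurent: "continuous_on S (\<lambda>t. laurent_eval p (cis t))"
  unfolding laurent_eval_cis by (intro continuous_intros)

definition circle_weight :: "nat \<Rightarrow> real \<Rightarrow> real" where "circle_weight m t = (1 - cos (2 * t)) ^ m"

lemma jacobi_weight_cis:
  assumes "m \<ge> 1"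
  shows "jacobi_weight (0, real m) (cis t) = circle_weight m t"
proof -
  have "Re (1 - (cis t ^ 2 + inverse (cis t ^ 2)) / 2) = 1 - cos (2 * t)"
    by (simp add: Complex.DeMoivre)
  moreover have "1 - cos (2 * t) \<ge> 0" by simp
  ultimately show ?thesis
    using assms by (auto simp: jacobi_weight_def real_pow_def circle_weight_def powr_realpow' )
qed

lemma jacobi_inner_integral:
  assumes "m \<ge> 1"
  shows "jacobi_inner (0, real m) p q =
    integral {0..2 * pi} (\<lambda>t. cnj (laurent_eval p (cis t)) * laurent_eval q (cis t) * of_real (circle_weight m t))"
  unfolding jacobi_inner_def circlepath_def
  by (subst contour_integral_part_circlepath_eq)
    (auto simp: jacobi_weight_cis[OF assms] intro!: integral_cong)

lemma integral_cis: "integral {0..2 * pi} (\<lambda>t. cis (of_int k * t)) = (if k = 0 then of_real (2 * pi) else 0)"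
proof (cases "k = 0")
  case False
  let ?f = "\<lambda>t. cis (of_int k * t) / (\<i> * of_int k)"
  have "((\<lambda>t. cis (of_int k * t)) has_integral (?f (2 * pi) - ?f 0)) {0..2 * pi}"
  proof (rule fundamental_theorem_of_calculus)
    fix t assume "t \<in> {0..2 * pi}"
    show "(?f has_vector_derivative cis (of_int k * t)) (at t within {0..2 * pi})"
      unfolding cis_conv_exp using False
      by (auto intro!: derivative_eq_intros has_vector_derivative_real_field simp: field_simps)
  qed simp
  moreover have "?f (2 * pi) = ?f 0"
    by (simp add: cis_conv_exp exp_eq_1 mult_ac)
  ultimately show ?thesis using False by (simp add: integral_unique)
qed (simp add: scaleR_conv_of_real)

text \<open>With \<open>y = cis (2t)\<close> one has
  \<open>1 - cos (2t) = - (1 - y)^2 / (2y)\<close>. So the Fourier coefficients of the weight are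
  signed binomial coefficients of order \<open>2m\<close>, and integrating against it takes a
  difference of that order.\<close>

lemma circle_weight_expand: "of_real (circle_weight m t) = (\<Sum>r\<le>2 * m. ((-1) ^ m * (-1) ^ r * of_nat (2 * m choose r) / 2 ^ m) * cis (of_int (2 * int r - 2 * int m) * t))"
proof -
  define y where "y = cis (2 * t)"
  have iy: "inverse y = cis (- (2 * t))" by (simp add: y_def)
  have "of_real (1 - cos (2 * t)) = (- (1/2)) * (inverse y * (1 - y) ^ 2)"
  proof -
    have "of_real (cos (2 * t)) = (y + inverse y) / 2" unfolding iy by (simp add: y_def complex_eq_iff)
    moreover have "y \<noteq> 0" by (simp add: y_def)
    ultimately show ?thesis by (simp add: field_simps power2_eq_square)
  qed
  then have "of_real (circle_weight m t) = ((- (1/2)) * (inverse y * (1 - y) ^ 2)) ^ m"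
    unfolding circle_weight_def of_real_power by (simp only:)
  also have "\<dots> = (- (1/2)) ^ m * (inverse y ^ m * (1 - y) ^ (2 * m))"
    by (simp only: power_mult_distrib power_mult)
  also have "(1 - y) ^ (2 * m) = (\<Sum>r\<le>2 * m. of_nat (2 * m choose r) * (- y) ^ r)"
    using binomial_ring[of "- y" 1 "2 * m"] by simp
  also have "(- (1/2)) ^ m * (inverse y ^ m * (\<Sum>r\<le>2 * m. of_nat (2 * m choose r) * (- y) ^ r)) =
      (\<Sum>r\<le>2 * m. ((-1) ^ m * (-1) ^ r * of_nat (2 * m choose r) / 2 ^ m) * (inverse y ^ m * y ^ r))"
    unfolding sum_distrib_left
    by (intro sum.cong refl) (simp add: power_minus[of y] power_minus[of "1/2"] power_divide)
  also have "\<dots> = (\<Sum>r\<le>2 * m. ((-1) ^ m * (-1) ^ r * of_nat (2 * m choose r) / 2 ^ m) * cis (of_int (2 * int r - 2 * int m) * t))"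
  proof (intro sum.cong refl arg_cong2[of _ _ _ _ "(*)"])
    fix r
    have "inverse y ^ m * y ^ r = cis (real m * - (2 * t) + real r * (2 * t))"
      unfolding iy unfolding y_def Complex.DeMoivre cis_mult ..
    also have "real m * - (2 * t) + real r * (2 * t) = of_int (2 * int r - 2 * int m) * t" by (simp add: algebra_simps)
    finally show "inverse y ^ m * y ^ r = cis (of_int (2 * int r - 2 * int m) * t)" .
  qed
  finally show ?thesis .
qed

lemma integral_cis_circle_weight: "integral {0..2 * pi} (\<lambda>t. cis (of_int k * t) * of_real (circle_weight m t)) =
   (2 * of_real pi * (-1) ^ m / 2 ^ m :: complex) * (\<Sum>r\<le>2 * m. (-1) ^ r * of_nat (2 * m choose r) * (if k + 2 * int r - 2 * int m = 0 then 1 else 0))"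
proof -
  let ?a = "\<lambda>r. (-1) ^ m * (-1) ^ r * of_nat (2 * m choose r) / 2 ^ m :: complex"
  have "integral {0..2 * pi} (\<lambda>t. cis (of_int k * t) * of_real (circle_weight m t)) =
      integral {0..2 * pi} (\<lambda>t. \<Sum>r\<le>2 * m. ?a r * cis (of_int (k + 2 * int r - 2 * int m) * t))"
  proof (rule integral_cong)
    fix t :: real
    have "cis (of_int k * t) * (?a r * cis (of_int (2 * int r - 2 * int m) * t)) = ?a r * cis (of_int (k + 2 * int r - 2 * int m) * t)" for r
    proof -
      have "cis (of_int k * t) * cis (of_int (2 * int r - 2 * int m) * t) = cis (of_int (k + 2 * int r - 2 * int m) * t)"
        unfolding cis_mult by (simp add: algebra_simps)
      then show ?thesis by (metis mult.left_commute)
    qed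
    then show "cis (of_int k * t) * of_real (circle_weight m t) = (\<Sum>r\<le>2 * m. ?a r * cis (of_int (k + 2 * int r - 2 * int m) * t))"
      unfolding circle_weight_expand sum_distrib_left by (intro sum.cong refl)
  qed
  also have "\<dots> = (\<Sum>r\<le>2 * m. integral {0..2 * pi} (\<lambda>t. ?a r * cis (of_int (k + 2 * int r - 2 * int m) * t)))"
    by (intro integral_sum integrable_continuous_real continuous_intros) auto
  also have "\<dots> = (\<Sum>r\<le>2 * m. ?a r * (if k + 2 * int r - 2 * int m = 0 then of_real (2 * pi) else 0))"
    by (simp only: integral_mult_right integral_cis)
  also have "\<dots> = (2 * of_real pi * (-1) ^ m / 2 ^ m :: complex) * (\<Sum>r\<le>2 * m. (-1) ^ r * of_nat (2 * m choose r) * (if k + 2 * int r - 2 * int m = 0 then 1 else 0))"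
    unfolding sum_distrib_left by (intro sum.cong refl) (simp add: field_simps)
  finally show ?thesis .
qed

lemma jacobi_inner_diff_left:
  assumes "m \<ge> 1"
  shows "jacobi_inner (0, real m) (p - q) r = jacobi_inner (0, real m) p r - jacobi_inner (0, real m) q r"
proof -
  have c: "(\<lambda>t. cnj (laurent_eval p (cis t)) * laurent_eval r (cis t) * of_real (circle_weight m t)) integrable_on {0..2 * pi}" for p
    unfolding circle_weight_def by (intro integrable_continuous_real continuous_intros continuous_laurent continuous_on_cnj)
  show ?thesis unfolding jacobi_inner_integral[OF assms] integral_diff[OF c c, symmetric]
    by (intro integral_cong) (simp add: laurent_eval_diff algebra_simps)
qed

lemma jacobi_inner_expand_right:
  assumes "m \<ge> 1"
  shows "jacobi_inner (0, real m) p q = (\<Sum>n\<in>Poly_Mapping.keys q. Poly_Mapping.lookup q n * jacobi_inner (0, real m) p (laurent_monom n))"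
proof -
  let ?f = "\<lambda>n t. cnj (laurent_eval p (cis t)) * cis (of_int n * t) * of_real (circle_weight m t)"
  have c: "(\<lambda>t. Poly_Mapping.lookup q n * ?f n t) integrable_on {0..2 * pi}" for n
    unfolding circle_weight_def by (intro integrable_continuous_real continuous_intros continuous_laurent continuous_on_cnj)
  have "jacobi_inner (0, real m) p q = integral {0..2 * pi} (\<lambda>t. \<Sum>n\<in>Poly_Mapping.keys q. Poly_Mapping.lookup q n * ?f n t)"
    unfolding jacobi_inner_integral[OF assms] laurent_eval_cis[of q]
    by (intro integral_cong) (simp add: sum_distrib_left sum_distrib_right mult_ac)
  also have "\<dots> = (\<Sum>n\<in>Poly_Mapping.keys q. integral {0..2 * pi} (\<lambda>t. Poly_Mapping.lookup q n * ?f n t))"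
    by (intro integral_sum c) auto
  also have "\<dots> = (\<Sum>n\<in>Poly_Mapping.keys q. Poly_Mapping.lookup q n * jacobi_inner (0, real m) p (laurent_monom n))"
    unfolding jacobi_inner_integral[OF assms] laurent_eval_monom by (simp only: integral_mult_right)
  finally show ?thesis .
qed

lemma lookup_fourier: "of_real (2 * pi) * Poly_Mapping.lookup p k = integral {0..2 * pi} (\<lambda>t. laurent_eval p (cis t) * cis (of_int (- k) * t))"
proof -
  have "integral {0..2 * pi} (\<lambda>t. laurent_eval p (cis t) * cis (of_int (- k) * t)) =
     integral {0..2 * pi} (\<lambda>t. \<Sum>n\<in>Poly_Mapping.keys p. Poly_Mapping.lookup p n * cis (of_int (n - k) * t))"
  proof (rule integral_cong)
    fix t :: real
    have "cis (of_int n * t) * cis (of_int (- k) * t) = cis (of_int (n - k) * t)" for n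
      unfolding cis_mult by (simp add: algebra_simps)
    then show "laurent_eval p (cis t) * cis (of_int (- k) * t) = (\<Sum>n\<in>Poly_Mapping.keys p. Poly_Mapping.lookup p n * cis (of_int (n - k) * t))"
      unfolding laurent_eval_cis sum_distrib_right by (simp only: mult.assoc)
  qed
  also have "\<dots> = (\<Sum>n\<in>Poly_Mapping.keys p. integral {0..2 * pi} (\<lambda>t. Poly_Mapping.lookup p n * cis (of_int (n - k) * t)))"
    by (intro integral_sum integrable_continuous_real continuous_intros) auto
  also have "\<dots> = (\<Sum>n\<in>Poly_Mapping.keys p. if n = k then Poly_Mapping.lookup p n * of_real (2 * pi) else 0)"
    by (intro sum.cong refl) (simp only: integral_mult_right integral_cis, simp)
  also have "\<dots> = of_real (2 * pi) * Poly_Mapping.lookup p k"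
    by (simp add: in_keys_iff)
  finally show ?thesis ..
qed

text \<open>The weight vanishes only at multiples of \<open>pi\<close>. A null vector therefore
  vanishes off a finite set of angles, and its coefficients are integrals of functions that vanish
  almost everywhere.\<close>

lemma jacobi_inner_definite:
  assumes m: "m \<ge> 1" and "jacobi_inner (0, real m) p p = 0"
  shows "p = 0"
proof -
  let ?g = "\<lambda>t. (cmod (laurent_eval p (cis t)))\<^sup>2 * circle_weight m t"
  have cont: "continuous_on {0..2 * pi} ?g"
    unfolding circle_weight_def by (intro continuous_intros continuous_laurent)
  have "(\<lambda>t. cnj (laurent_eval p (cis t)) * laurent_eval p (cis t) * of_real (circle_weight m t)) = (\<lambda>t. of_real (?g t))"
    by (simp add: complex_norm_square[symmetric] mult.commute)
  then have "integral {0..2 * pi} (\<lambda>t. of_real (?g t) :: complex) = 0"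
    using assms(2) unfolding jacobi_inner_integral[OF m] by simp
  moreover have "integral {0..2 * pi} (\<lambda>t. of_real (?g t) :: complex) = of_real (integral {0..2 * pi} ?g)"
    using integral_linear[OF integrable_continuous_real[OF cont] bounded_linear_of_real[where 'a=complex]] by (simp add: o_def)
  ultimately have "integral {0..2 * pi} ?g = 0" by simp
  moreover have nn: "0 \<le> ?g t" for t by (simp add: circle_weight_def)
  ultimately have g0: "?g t = 0" if "t \<in> {0..2 * pi}" for t
    using integral_eq_0_iff[OF cont] that by auto
  have z: "laurent_eval p (cis t) = 0" if "t \<in> {0..2 * pi} - {0, pi, 2 * pi}" for t
  proof -
    have "cos (2 * t) \<noteq> 1"
    proof
      assume "cos (2 * t) = 1"
      then obtain n :: int where "2 * t = of_int n * 2 * pi" by (auto simp: cos_one_2pi_int)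
      then have t: "t = of_int n * pi" by simp
      have "0 < t" "t < 2 * pi" using that by auto
      then have "0 < of_int n * pi" "of_int n * pi < 2 * pi" unfolding t .
      then have "0 < n" "n < 2" by (auto simp: zero_less_mult_iff)
      then have "n = 1" by simp
      then show False using t that by simp
    qed
    then have "circle_weight m t \<noteq> 0" by (simp add: circle_weight_def)
    then show ?thesis using g0[of t] that by auto
  qed
  have "Poly_Mapping.lookup p k = 0" for k
  proof -
    have "((\<lambda>t. laurent_eval p (cis t) * cis (of_int (- k) * t)) has_integral 0) {0..2 * pi}"
      by (rule has_integral_spike_finite[where S="{0, pi, 2 * pi}" and f="\<lambda>_. 0"]) (use z in auto)
    then have "of_real (2 * pi) * Poly_Mapping.lookup p k = 0"
      unfolding lookup_fourier by (rule integral_unique)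
    then show ?thesis by simp
  qed
  then show ?thesis by (intro poly_mapping_eqI) simp
qed

text \<open>This resolves the definite description. In the difference of two candidates the leading
  terms cancel; what remains is a combination of lower monomials, to all of which it is orthogonal,
  so definiteness makes it zero.\<close>

lemma nonsym_jacobi_eq:
  assumes m: "m \<ge> 1" and p: "is_nonsym_jacobi n (0, real m) p"
  shows "nonsym_jacobi n (0, real m) = p"
  unfolding nonsym_jacobi_def
proof (rule the_equality[where P="is_nonsym_jacobi n (0, real m)", OF p])
  fix q assume q: "is_nonsym_jacobi n (0, real m) q"
  let ?d = "q - p"
  have low: "monom_less j n" if "j \<in> Poly_Mapping.keys ?d" for j
  proof -
    have "j \<in> Poly_Mapping.keys p \<or> j \<in> Poly_Mapping.keys q" using that by (auto simp: in_keys_iff lookup_minus)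
    moreover have "j \<noteq> n" using that p q by (auto simp: is_nonsym_jacobi_def in_keys_iff lookup_minus)
    ultimately show ?thesis using p q unfolding is_nonsym_jacobi_def by blast
  qed
  have "jacobi_inner (0, real m) ?d ?d = (\<Sum>j\<in>Poly_Mapping.keys ?d. Poly_Mapping.lookup ?d j * jacobi_inner (0, real m) ?d (laurent_monom j))"
    by (rule jacobi_inner_expand_right[OF m])
  also have "\<dots> = 0"
    using p q low unfolding is_nonsym_jacobi_def by (intro sum.neutral) (auto simp: jacobi_inner_diff_left[OF m])
  finally have "?d = 0" by (rule jacobi_inner_definite[OF m])
  then show "q = p" by simp
qed

section \<open>Explicit Jacobi polynomials\<close>

lemma lookup_sum_single:
  fixes f :: "nat \<Rightarrow> int"
  assumes "inj_on f {..l}"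
  shows "Poly_Mapping.lookup (\<Sum>s\<le>l. Poly_Mapping.single (f s) (c s)) k =
    (if k \<in> f ` {..l} then c (the_inv_into {..l} f k) else 0)"
proof -
  have "Poly_Mapping.lookup (\<Sum>s\<le>l. Poly_Mapping.single (f s) (c s)) k = (\<Sum>s\<le>l. if f s = k then c s else 0)"
    by (simp add: lookup_sum lookup_single when_def)
  also have "\<dots> = (if k \<in> f ` {..l} then c (the_inv_into {..l} f k) else 0)"
  proof (cases "k \<in> f ` {..l}")
    case True
    then obtain r where r: "r \<le> l" "k = f r" by auto
    have "(\<Sum>s\<le>l. if f s = k then c s else 0) = (\<Sum>s\<le>l. if s = r then c s else 0)"
      using r assms by (intro sum.cong) (auto simp: inj_on_def)
    then show ?thesis using r assms by (simp add: the_inv_into_f_f)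
  qed (auto intro!: sum.neutral)
  finally show ?thesis .
qed

lemma laurent_eval_sum_single:
  fixes f :: "nat \<Rightarrow> int"
  assumes "inj_on f {..l}"
  shows "laurent_eval (\<Sum>s\<le>l. Poly_Mapping.single (f s) (c s)) z = (\<Sum>s\<le>l. c s * z powi f s)"
proof -
  let ?p = "\<Sum>s\<le>l. Poly_Mapping.single (f s) (c s)"
  have "Poly_Mapping.keys ?p \<subseteq> f ` {..l}"
    by (auto simp: in_keys_iff lookup_sum_single[OF assms] split: if_splits)
  then have "laurent_eval ?p z = (\<Sum>n\<in>f ` {..l}. Poly_Mapping.lookup ?p n * z powi n)"
    by (intro laurent_eval_superset) auto
  also have "\<dots> = (\<Sum>s\<le>l. c s * z powi f s)"
    unfolding sum.reindex[OF assms] o_def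
    by (intro sum.cong refl) (simp add: lookup_sum_single[OF assms] the_inv_into_f_f[OF assms])
  finally show ?thesis .
qed

lemma cnj_ecoef: "cnj (ecoef m l s) = ecoef m l s"
proof -
  have "cnj (pochhammer (of_nat a) k) = (pochhammer (of_nat a) k :: complex)" for a k
    by (simp add: pochhammer_prod)
  then show ?thesis by (simp add: ecoef_def dcoef_def)
qed

lemma ecoef_outside: "\<not> (0 \<le> s \<and> s \<le> int l) \<Longrightarrow> ecoef m l s = 0"
  unfolding ecoef_def dcoef_def by (simp only: if_False mult_zero_left mult_zero_right)

text \<open>The polynomials for \<open>n = l + 1\<close> and \<open>n = - l\<close> share these
  coefficients and differ only in the exponents \<open>f\<close>. Index 0 carries the leading
  monomial, hence the divisor.\<close>

definition jacobi_sum :: "nat \<Rightarrow> nat \<Rightarrow> (nat \<Rightarrow> int) \<Rightarrow> laurent" where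
  "jacobi_sum m l f = (\<Sum>s\<le>l. Poly_Mapping.single (f s) (ecoef m l (int s) / ecoef m l 0))"

text \<open>Pairing with \<open>z^i\<close> selects, for each term \<open>r\<close> of the weight,
  the index \<open>s = N div 2 - g r\<close>, where \<open>N\<close> encodes \<open>i\<close>. For
  odd \<open>N\<close> nothing is selected, because the weight has even frequencies only; for even
  \<open>N\<close> the result is a difference of order \<open>2m\<close>. If the exponents increase
  with \<open>s\<close>, the binomial coefficients appear reversed, which their symmetry
  absorbs.\<close>

lemma jacobi_inner_sum:
  assumes m: "m \<ge> 1" and inj: "inj_on f {..l}"
    and R: "\<And>s r. s \<le> l \<Longrightarrow> r \<le> 2 * m \<Longrightarrow> i - f s + 2 * int r - 2 * int m = 0 \<longleftrightarrow> even N \<and> int s = N div 2 - int (g r)"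
    and N: "even N \<Longrightarrow> int m < N div 2 \<and> N div 2 \<le> int m + int l"
    and g: "g = id \<or> g = (\<lambda>r. 2 * m - r)"
  shows "jacobi_inner (0, real m) (jacobi_sum m l f) (laurent_monom i) = 0"
proof -
  let ?c = "\<lambda>s. ecoef m l (int s) / ecoef m l 0"
  let ?k = "2 * of_real pi * (-1) ^ m / 2 ^ m :: complex"
  let ?b = "\<lambda>r. (-1) ^ r * of_nat (2 * m choose r) :: complex"
  have "jacobi_inner (0, real m) (jacobi_sum m l f) (laurent_monom i) =
     integral {0..2 * pi} (\<lambda>t. \<Sum>s\<le>l. ?c s * (cis (of_int (i - f s) * t) * of_real (circle_weight m t)))"
    unfolding jacobi_inner_integral[OF m]
  proof (rule integral_cong)
    fix t :: real
    have "cnj (cis (of_int (f s) * t)) * cis (of_int i * t) = cis (of_int (i - f s) * t)" for s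
      unfolding cis_cnj cis_mult by (simp add: algebra_simps)
    then have "cnj (?c s * cis (of_int (f s) * t)) * cis (of_int i * t) * of_real (circle_weight m t) =
        ?c s * (cis (of_int (i - f s) * t) * of_real (circle_weight m t))" for s
      by (simp add: cnj_ecoef flip: mult.assoc)
    then show "cnj (laurent_eval (jacobi_sum m l f) (cis t)) * laurent_eval (laurent_monom i) (cis t) * of_real (circle_weight m t) =
        (\<Sum>s\<le>l. ?c s * (cis (of_int (i - f s) * t) * of_real (circle_weight m t)))"
      unfolding jacobi_sum_def laurent_eval_sum_single[OF inj] laurent_eval_monom cis_powi cnj_sum sum_distrib_right by simp
  qed
  also have "\<dots> = (\<Sum>s\<le>l. ?c s * integral {0..2 * pi} (\<lambda>t. cis (of_int (i - f s) * t) * of_real (circle_weight m t)))"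
    unfolding integral_mult_right[symmetric] circle_weight_def
    by (intro integral_sum integrable_continuous_real continuous_intros) auto
  also have "\<dots> = (\<Sum>s\<le>l. ?c s * (?k * (\<Sum>r\<le>2 * m. ?b r * (if even N \<and> int s = N div 2 - int (g r) then 1 else 0))))"
    unfolding integral_cis_circle_weight using R by (intro sum.cong refl arg_cong2[of _ _ _ _ "(*)"]) auto
  also have "\<dots> = ?k * (\<Sum>r\<le>2 * m. ?b r * (\<Sum>s\<le>l. ?c s * (if even N \<and> int s = N div 2 - int (g r) then 1 else 0)))"
    unfolding sum_distrib_left by (subst sum.swap) (simp add: mult_ac)
  also have "(\<Sum>r\<le>2 * m. ?b r * (\<Sum>s\<le>l. ?c s * (if even N \<and> int s = N div 2 - int (g r) then 1 else 0))) = 0"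
  proof (cases "even N")
    case True
    have inner: "(\<Sum>s\<le>l. ?c s * (if even N \<and> int s = N div 2 - int (g r) then 1 else 0)) = ecoef m l (N div 2 - int (g r)) / ecoef m l 0" for r
    proof (cases "0 \<le> N div 2 - int (g r) \<and> N div 2 - int (g r) \<le> int l")
      case True
      define s0 where "s0 = nat (N div 2 - int (g r))"
      have s0: "s0 \<le> l" "N div 2 - int (g r) = int s0" using True by (auto simp: s0_def)
      have "(\<Sum>s\<le>l. ?c s * (if even N \<and> int s = N div 2 - int (g r) then 1 else 0)) = (\<Sum>s\<le>l. if s = s0 then ?c s else 0)"
        unfolding s0(2) using \<open>even N\<close> by (intro sum.cong) auto
      also have "\<dots> = ?c s0" using s0(1) by simp
      finally show ?thesis by (simp only: s0(2))
    next
      case False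
      then have "(\<Sum>s\<le>l. ?c s * (if even N \<and> int s = N div 2 - int (g r) then 1 else 0)) = 0"
        by (intro sum.neutral) auto
      moreover have "ecoef m l (N div 2 - int (g r)) = 0" using False by (rule ecoef_outside)
      ultimately show ?thesis by (simp only:) simp
    qed
    have "(\<Sum>r\<le>2 * m. ?b r * ecoef m l (N div 2 - int (g r))) = (\<Sum>r\<le>2 * m. ?b r * ecoef m l (N div 2 - int r))"
      using g
    proof
      assume g: "g = (\<lambda>r. 2 * m - r)"
      have "even r \<longleftrightarrow> even (2 * m - r)" if "r \<le> 2 * m" for r using that by auto
      then have "?b (2 * m - r) = ?b r" if "r \<le> 2 * m" for r
        using that binomial_symmetric[of r "2 * m"] by (auto simp: minus_one_power_iff)
      then show ?thesis unfolding g
        by (intro sum.reindex_bij_witness[of _ "\<lambda>r. 2 * m - r" "\<lambda>r. 2 * m - r"]) auto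
    qed simp
    also have "\<dots> = 0" using ecoef_alternating_sum[OF m, of "N div 2" l] N[OF True] by simp
    finally show ?thesis unfolding inner times_divide_eq_right sum_divide_distrib[symmetric] by simp
  qed simp
  finally show ?thesis by simp
qed

lemma ecoef_0_neq: "m \<ge> 1 \<Longrightarrow> ecoef m l 0 \<noteq> 0"
  using pochhammer_of_nat_neq_0[of m l] by (simp add: ecoef_def dcoef_0) (simp flip: of_nat_add)

text \<open>The monomials below \<open>z^(l + 1)\<close> have exponents from \<open>-l\<close> to
  \<open>l\<close>. For those of matching parity, \<open>N div 2\<close> runs exactly through
  \<open>m + 1, ..., m + l\<close>, the range in which the differences of \<open>ecoef\<close>
  vanish.\<close>

lemma nonsym_jacobi_plus:
  assumes m: "m \<ge> 1"
  shows "nonsym_jacobi (int l + 1) (0, real m) = jacobi_sum m l (\<lambda>s. int l + 1 - 2 * int s)"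
proof (rule nonsym_jacobi_eq[OF m])
  let ?f = "\<lambda>s. int l + 1 - 2 * int s" and ?n = "int l + 1"
  have inj: "inj_on ?f {..l}" by (auto simp: inj_on_def)
  have lk: "Poly_Mapping.lookup (jacobi_sum m l ?f) k = (if k \<in> ?f ` {..l} then ecoef m l (int (the_inv_into {..l} ?f k)) / ecoef m l 0 else 0)" for k
    unfolding jacobi_sum_def lookup_sum_single[OF inj] ..
  have "?n = ?f 0" by simp
  then have "the_inv_into {..l} ?f ?n = 0" using the_inv_into_f_f[OF inj, of 0] by simp
  moreover have "?n \<in> ?f ` {..l}" by (rule image_eqI[of _ _ 0]) auto
  ultimately have 1: "Poly_Mapping.lookup (jacobi_sum m l ?f) ?n = 1"
    unfolding lk using ecoef_0_neq[OF m, of l] by simp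
  have 2: "k = ?n \<or> monom_less k ?n" if "k \<in> Poly_Mapping.keys (jacobi_sum m l ?f)" for k
  proof -
    from that obtain s where "s \<le> l" "k = ?f s" by (auto simp: in_keys_iff lk split: if_splits)
    then show ?thesis by (auto simp: monom_less_def monom_rank_def)
  qed
  have 3: "jacobi_inner (0, real m) (jacobi_sum m l ?f) (laurent_monom i) = 0" if "monom_less i ?n" for i
  proof (rule jacobi_inner_sum[OF m inj, where N="int l + 1 + 2 * int m - i" and g=id])
    have i: "- int l \<le> i" "i \<le> int l" using that by (auto simp: monom_less_def monom_rank_def split: if_splits)
    show "int m < (int l + 1 + 2 * int m - i) div 2 \<and> (int l + 1 + 2 * int m - i) div 2 \<le> int m + int l"
      if "even (int l + 1 + 2 * int m - i)" using that i by presburger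
    show "i - ?f s + 2 * int r - 2 * int m = 0 \<longleftrightarrow>
        even (int l + 1 + 2 * int m - i) \<and> int s = (int l + 1 + 2 * int m - i) div 2 - int (id r)" for s r
      unfolding id_apply by presburger
  qed simp
  show "is_nonsym_jacobi ?n (0, real m) (jacobi_sum m l ?f)"
    unfolding is_nonsym_jacobi_def using 1 2 3 by blast
qed

text \<open>Now the lower exponents run from \<open>1 - l\<close> to \<open>l\<close>, and
  \<open>N div 2\<close> again covers exactly \<open>m + 1, ..., m + l\<close>. The exponents
  increase with \<open>s\<close>, so \<open>g\<close> is the reversal.\<close>

lemma nonsym_jacobi_minus:
  assumes m: "m \<ge> 1"
  shows "nonsym_jacobi (- int l) (0, real m) = jacobi_sum m l (\<lambda>s. 2 * int s - int l)"
proof (rule nonsym_jacobi_eq[OF m])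
  let ?f = "\<lambda>s. 2 * int s - int l" and ?n = "- int l"
  have inj: "inj_on ?f {..l}" by (auto simp: inj_on_def)
  have lk: "Poly_Mapping.lookup (jacobi_sum m l ?f) k = (if k \<in> ?f ` {..l} then ecoef m l (int (the_inv_into {..l} ?f k)) / ecoef m l 0 else 0)" for k
    unfolding jacobi_sum_def lookup_sum_single[OF inj] ..
  have "?n = ?f 0" by simp
  then have "the_inv_into {..l} ?f ?n = 0" using the_inv_into_f_f[OF inj, of 0] by simp
  moreover have "?n \<in> ?f ` {..l}" by (rule image_eqI[of _ _ 0]) auto
  ultimately have 1: "Poly_Mapping.lookup (jacobi_sum m l ?f) ?n = 1"
    unfolding lk using ecoef_0_neq[OF m, of l] by simp
  have 2: "k = ?n \<or> monom_less k ?n" if "k \<in> Poly_Mapping.keys (jacobi_sum m l ?f)" for k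
  proof -
    from that obtain s where "s \<le> l" "k = ?f s" by (auto simp: in_keys_iff lk split: if_splits)
    then show ?thesis by (auto simp: monom_less_def monom_rank_def)
  qed
  have 3: "jacobi_inner (0, real m) (jacobi_sum m l ?f) (laurent_monom i) = 0" if "monom_less i ?n" for i
  proof (rule jacobi_inner_sum[OF m inj, where N="i + int l + 2 * int m" and g="\<lambda>r. 2 * m - r"])
    have i: "- int l < i" "i \<le> int l" using that by (auto simp: monom_less_def monom_rank_def split: if_splits)
    show "int m < (i + int l + 2 * int m) div 2 \<and> (i + int l + 2 * int m) div 2 \<le> int m + int l"
      if "even (i + int l + 2 * int m)" using that i by presburger
    show "i - ?f s + 2 * int r - 2 * int m = 0 \<longleftrightarrow>
        even (i + int l + 2 * int m) \<and> int s = (i + int l + 2 * int m) div 2 - int (2 * m - r)" if "r \<le> 2 * m" for s r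
      using that by (simp add: of_nat_diff) presburger
  qed simp
  show "is_nonsym_jacobi ?n (0, real m) (jacobi_sum m l ?f)"
    unfolding is_nonsym_jacobi_def using 1 2 3 by blast
qed

section \<open>Semisimple matrices and periodic one-parameter groups\<close>

text \<open>Horner's scheme for the vector \<open>q(A) v\<close>.\<close>

definition poly_vec :: "complex^'n^'n \<Rightarrow> complex^'n \<Rightarrow> complex poly \<Rightarrow> complex^'n" where
  "poly_vec A v q = fold_coeffs (\<lambda>a w. a *s v + A *v w) q 0"

lemma poly_vec_0 [simp]: "poly_vec A v 0 = 0" by (simp add: poly_vec_def)

lemma poly_vec_pCons [simp]: "poly_vec A v (pCons a q) = a *s v + A *v poly_vec A v q"
  by (cases "pCons a q = 0") (auto simp: poly_vec_def vec.zero)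

lemma poly_vec_add: "poly_vec A v (p + q) = poly_vec A v p + poly_vec A v q"
  by (induction p q rule: poly_induct2) (auto simp: vec.add vector_sadd_rdistrib)

lemma poly_vec_smult: "poly_vec A v (smult c q) = c *s poly_vec A v q"
  by (induction q) (auto simp: vec.scale vector_add_ldistrib vector_smult_assoc)

lemma poly_vec_linear_factor: "poly_vec A v ([:-r, 1:] * q) = A *v poly_vec A v q - r *s poly_vec A v q"
proof -
  have "[:-r, 1:] * q = smult (-r) q + pCons 0 q" by simp
  then show ?thesis by (simp only: poly_vec_add poly_vec_smult) simp
qed

lemma poly_vec_prod: "poly_vec A v (\<Prod>r\<leftarrow>rs. [:-r, 1:]) = foldr (\<lambda>r w. A *v w - r *s w) rs v"
  by (induction rs) (auto simp: poly_vec_linear_factor one_pCons simp del: mult_pCons_left)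

lemma poly_vec_monom: "poly_vec A v (monom c k) = c *s ((*v) A ^^ k) v"
  by (induction k) (auto simp: monom_0 monom_Suc vec.scale)

text \<open>The \<open>CARD('n) + 1\<close> iterates of \<open>v\<close> cannot be independent.
  Dependence concerns the set of iterates, so a repetition among them is a separate case.\<close>

lemma ex_annihilating_poly: "\<exists>q. q \<noteq> 0 \<and> poly_vec A v q = 0" for A :: "complex^'n^'n"
proof -
  define f where "f k = ((*v) A ^^ k) v" for k :: nat
  define I where "I = {..CARD('n)}"
  show ?thesis
  proof (cases "inj_on f I")
    case False
    then obtain i k where ik: "i \<noteq> k" "f i = f k" by (auto simp: inj_on_def)
    have "monom 1 i - monom 1 k \<noteq> (0 :: complex poly)"
      using ik by (simp add: monom_eq_iff')
    moreover have "poly_vec A v (monom 1 i - monom 1 k) = 0"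
      using ik poly_vec_add[of A v "monom 1 i" "smult (-1) (monom 1 k)"] poly_vec_smult[of A v "-1" "monom 1 k"]
      by (simp add: poly_vec_monom f_def smult_monom minus_monom diff_conv_add_uminus
          del: add_uminus_conv_diff)
    ultimately show ?thesis by blast
  next
    case True
    have "card (f ` I) = CARD('n) + 1" using card_image[OF True] by (simp add: I_def)
    then have "vec.dim (UNIV :: (complex^'n) set) < card (f ` I)" by (simp only: vec_dim_card)
    then have "vec.dependent (f ` I)"
      using vec.independent_card_le_dim[of "f ` I" UNIV] by auto
    then obtain u where u: "\<exists>x\<in>f ` I. u x \<noteq> 0" "(\<Sum>x\<in>f ` I. u x *s x) = 0"
      using vec.dependent_finite[of "f ` I"] by (auto simp: I_def)
    define q where "q = (\<Sum>k\<in>I. monom (u (f k)) k)"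
    have pvs: "poly_vec A v (\<Sum>k\<in>J. monom (c k) k) = (\<Sum>k\<in>J. c k *s f k)" for J c
      by (induction J rule: infinite_finite_induct) (auto simp: poly_vec_add poly_vec_monom f_def)
    have "poly_vec A v q = 0"
      using u(2) by (simp add: q_def pvs sum.reindex[OF True])
    moreover obtain k where k: "k \<in> I" "u (f k) \<noteq> 0" using u(1) by auto
    have "coeff q k = u (f k)"
      using k by (simp add: q_def coeff_sum I_def sum.delta' if_distrib cong: if_cong)
    with k have "q \<noteq> 0" by auto
    ultimately show ?thesis by blast
  qed
qed

lemma ex_annihilating_roots:
  fixes A :: "complex^'n^'n"
  shows "\<exists>rs. foldr (\<lambda>r w. A *v w - r *s w) rs v = 0"
proof -
  obtain q where q: "q \<noteq> 0" "poly_vec A v q = 0" using ex_annihilating_poly by blast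
  obtain R where R: "size R = degree q" "q = smult (lead_coeff q) (\<Prod>x\<in>#R. [:-x, 1:])"
    using q(1) alg_closed_imp_factorization by blast
  obtain rs where rs: "mset rs = R" using ex_mset by blast
  have "q = smult (lead_coeff q) (\<Prod>r\<leftarrow>rs. [:-r, 1:])"
    using R(2) unfolding rs[symmetric] by (simp only: prod_mset_prod_list mset_map[symmetric])
  then have "lead_coeff q *s poly_vec A v (\<Prod>r\<leftarrow>rs. [:-r, 1:]) = 0"
    using q(2) poly_vec_smult by metis
  then show ?thesis using q(1) by (auto simp: poly_vec_prod)
qed

text \<open>No Jordan chain of length two: \<open>(A - s)^2\<close> and \<open>A - s\<close> have
  the same kernel for every \<open>s\<close>. Over the complex numbers this is diagonalizability, in
  the form in which it follows from periodicity.\<close>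

definition semisimple :: "complex^'n^'n \<Rightarrow> bool" where
  "semisimple A \<longleftrightarrow> (\<forall>s u. A *v (A *v u - s *s u) = s *s (A *v u - s *s u) \<longrightarrow> A *v u = s *s u)"

text \<open>Induction on the linear factors that annihilate \<open>v\<close>. By hypothesis
  \<open>(A - r) v\<close> is a combination of eigenvectors. Those with eigenvalue \<open>s\<close>
  other than \<open>r\<close> are \<open>A - r\<close> applied to their multiple by
  \<open>1 / (s - r)\<close>; the others are collected in \<open>w0\<close>. Thus
  \<open>(A - r) (v - u) = w0\<close> is killed by \<open>A - r\<close>, and semisimplicity makes
  \<open>v - u\<close> an eigenvector.\<close>

lemma semisimple_span:
  fixes A :: "complex^'n^'n"
  assumes W: "vec.subspace W" "\<And>w. w \<in> W \<Longrightarrow> A *v w \<in> W" and A: "semisimple A" and "v \<in> W"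
  shows "v \<in> vec.span {w\<in>W. \<exists>s. A *v w = s *s w}"
proof -
  let ?E = "{w\<in>W. \<exists>s. A *v w = s *s w}"
  obtain rs where "foldr (\<lambda>r w. A *v w - r *s w) rs v = 0" using ex_annihilating_roots by blast
  then show ?thesis using \<open>v \<in> W\<close>
  proof (induction rs arbitrary: v rule: rev_induct)
    case Nil
    then show ?case by (simp add: vec.span_zero)
  next
    case (snoc r rs)
    let ?w = "A *v v - r *s v"
    have "?w \<in> W" using W snoc.prems by (simp add: vec.subspace_diff vec.subspace_scale)
    then have "?w \<in> vec.span ?E" using snoc by simp
    then have "\<exists>u\<in>vec.span ?E. \<exists>w0\<in>W. ?w = A *v u - r *s u + w0 \<and> A *v w0 = r *s w0"
    proof (induction rule: vec.span_induct_alt)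
      case base
      show ?case using vec.span_zero[of ?E] W(1)
        by (intro bexI[of _ 0]) (auto simp: vec.subspace_0)
    next
      case (step c x y)
      then obtain s where x: "x \<in> W" "A *v x = s *s x" by auto
      from step obtain u w0 where u: "u \<in> vec.span ?E" "w0 \<in> W" "y = A *v u - r *s u + w0"
        "A *v w0 = r *s w0" by auto
      have xE: "x \<in> vec.span ?E" using x by (intro vec.span_base) auto
      show ?case
      proof (cases "s = r")
        case True
        have "w0 + c *s x \<in> W" using u x W(1) by (simp add: vec.subspace_add vec.subspace_scale)
        moreover have "c *s x + y = A *v u - r *s u + (w0 + c *s x)" using u(3) by simp
        moreover have "A *v (w0 + c *s x) = r *s (w0 + c *s x)"
          using u(4) x(2) True by (simp add: vec.add vec.scale vector_add_ldistrib mult.commute)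
        ultimately show ?thesis using u(1) by blast
      next
        case False
        define d where "d = c / (s - r)"
        have "A *v (d *s x) - r *s (d *s x) = (d * (s - r)) *s x"
          by (simp add: vec.scale x(2) right_diff_distrib vec.scale_left_diff_distrib mult.commute)
        also have "d * (s - r) = c" using False by (simp add: d_def)
        finally have "c *s x + y = A *v (u + d *s x) - r *s (u + d *s x) + w0"
          using u(3) by (simp add: vec.add vector_add_ldistrib)
        moreover have "u + d *s x \<in> vec.span ?E"
          using u(1) xE by (simp add: vec.span_add vec.span_scale)
        ultimately show ?thesis using u(2,4) by blast
      qed
    qed
    then obtain u w0 where u: "u \<in> vec.span ?E" "w0 \<in> W" "?w = A *v u - r *s u + w0"
        "A *v w0 = r *s w0" by auto
    have *: "A *v (v - u) - r *s (v - u) = w0"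
      using u(3) by (simp add: vec.diff vec.scale_right_diff_distrib algebra_simps del: vector_ssub_ldistrib)
    then have "A *v (v - u) = r *s (v - u)"
      using A u(4) unfolding semisimple_def by metis
    moreover have "u \<in> W" using u(1) vec.span_minimal[of ?E W] W(1) by blast
    ultimately have "v - u \<in> vec.span ?E"
      using snoc.prems W(1) by (intro vec.span_base) (auto simp: vec.subspace_diff)
    then show ?case using vec.span_add[OF _ u(1)] by fastforce
  qed
qed

text \<open>Simultaneous diagonalization: every eigenspace of the first matrix is stable under the
  others.\<close>

lemma common_eigenvectors_span:
  fixes As :: "(complex^'n^'n) list"
  assumes "vec.subspace W" "\<And>A w. A \<in> set As \<Longrightarrow> w \<in> W \<Longrightarrow> A *v w \<in> W"
    and "\<And>A. A \<in> set As \<Longrightarrow> semisimple A"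
    and "\<And>A B. A \<in> set As \<Longrightarrow> B \<in> set As \<Longrightarrow> A ** B = B ** A"
  shows "W \<subseteq> vec.span {w\<in>W. \<forall>A\<in>set As. \<exists>s. A *v w = s *s w}"
  using assms
proof (induction As arbitrary: W)
  case Nil
  then show ?case by (auto intro: vec.span_base)
next
  case (Cons A As)
  have "W \<subseteq> vec.span {w\<in>W. \<exists>s. A *v w = s *s w}"
    using semisimple_span[of W A] Cons.prems by auto
  also have "\<dots> \<subseteq> vec.span {w\<in>W. \<forall>A\<in>set (A # As). \<exists>s. A *v w = s *s w}"
  proof (intro vec.span_minimal vec.subspace_span subsetI)
    fix x assume "x \<in> {w\<in>W. \<exists>s. A *v w = s *s w}"
    then obtain s where x: "x \<in> W" "A *v x = s *s x" by auto
    define W' where "W' = {w\<in>W. A *v w = s *s w}"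
    have sub: "vec.subspace W'"
      using Cons.prems(1) unfolding W'_def vec.subspace_def
      by (auto simp: vec.add vec.scale vector_add_ldistrib vector_smult_assoc mult.commute)
    have inv: "B *v w \<in> W'" if "B \<in> set As" "w \<in> W'" for B w
    proof -
      have "A *v (B *v w) = B *v (A *v w)"
        using Cons.prems(4)[of A B] that by (simp add: matrix_vector_mul_assoc)
      then show ?thesis using that Cons.prems(2) by (auto simp: W'_def vec.scale)
    qed
    have "W' \<subseteq> vec.span {w\<in>W'. \<forall>A\<in>set As. \<exists>s. A *v w = s *s w}"
      using Cons.prems sub inv by (intro Cons.IH) auto
    also have "\<dots> \<subseteq> vec.span {w\<in>W. \<forall>A\<in>set (A # As). \<exists>s. A *v w = s *s w}"
      by (intro vec.span_mono) (auto simp: W'_def)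
    finally show "x \<in> vec.span {w\<in>W. \<forall>A\<in>set (A # As). \<exists>s. A *v w = s *s w}"
      using x by (auto simp: W'_def)
  qed
  finally show ?case .
qed

section \<open>Matrix products as bounded bilinear maps\<close>

lemma matrix_add_rdistrib: "(A + B) ** C = A ** C + B ** C" for A B :: "'a::semiring_1^'m^'n"
  by (simp add: matrix_matrix_mult_def vec_eq_iff sum.distrib distrib_right)

lemma bounded_bilinear_matrix_mult: "bounded_bilinear ((**) :: complex^'m^'n \<Rightarrow> complex^'k^'m \<Rightarrow> _)"
proof -
  have "bilinear ((**) :: complex^'m^'n \<Rightarrow> complex^'k^'m \<Rightarrow> _)"
    by (auto simp: bilinear_def matrix_add_ldistrib matrix_add_rdistrib matrix_scalar_ac
        scalar_matrix_assoc intro!: linearI)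
  then show ?thesis by (simp add: bilinear_conv_bounded_bilinear)
qed

interpretation mm: bounded_bilinear "(**) :: complex^'m^'n \<Rightarrow> complex^'k^'m \<Rightarrow> complex^'k^'n"
  by (rule bounded_bilinear_matrix_mult)

lemma bounded_bilinear_matrix_vector: "bounded_bilinear ((*v) :: complex^'m^'n \<Rightarrow> complex^'m \<Rightarrow> _)"
proof -
  have "bilinear ((*v) :: complex^'m^'n \<Rightarrow> complex^'m \<Rightarrow> _)"
    by (auto simp: bilinear_def matrix_vector_mult_add_rdistrib vec.add matrix_vector_mult_scaleR intro!: linearI)
      (simp add: matrix_vector_mult_def vec_eq_iff scaleR_sum_right)
  then show ?thesis by (simp add: bilinear_conv_bounded_bilinear)
qed

interpretation mv: bounded_bilinear "(*v) :: complex^'m^'n \<Rightarrow> complex^'m \<Rightarrow> complex^'n"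
  by (rule bounded_bilinear_matrix_vector)

lemma bounded_bilinear_smult_vec: "bounded_bilinear ((*s) :: complex \<Rightarrow> complex^'n \<Rightarrow> _)"
proof -
  have "bilinear ((*s) :: complex \<Rightarrow> complex^'n \<Rightarrow> _)"
    by (auto simp: bilinear_def vec_eq_iff distrib_left distrib_right intro!: linearI)
  then show ?thesis by (simp add: bilinear_conv_bounded_bilinear)
qed

interpretation sv: bounded_bilinear "(*s) :: complex \<Rightarrow> complex^'n \<Rightarrow> complex^'n"
  by (rule bounded_bilinear_smult_vec)

section \<open>Periodic one-parameter groups and their generators\<close>

lemma zero_vector_derivative_imp_eq:
  fixes f :: "real \<Rightarrow> 'a::real_normed_vector"
  assumes "\<And>t. (f has_vector_derivative 0) (at t)"
  shows "f x = f y"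
  using has_vector_derivative_zero_constant[of UNIV f] assms by (metis UNIV_I convex_UNIV)

text \<open>The period is that of a lifted rotation: a full turn lifts to \<open>-1\<close> in the
  spin group, and only two turns give the identity.\<close>

locale periodic_group =
  fixes U :: "real \<Rightarrow> complex^'n^'n"
  assumes cont: "continuous_on UNIV U"
    and add: "U (s + t) = U s ** U t"
    and zero: "U 0 = mat 1"
    and period: "U (pi * 4) = mat 1"
begin

definition "gen = vector_derivative U (at 0)"

text \<open>\<open>U t\<close> times the integral of \<open>U\<close> over a short interval is an integral with moving limits, and
  the integral over a short enough interval is invertible.\<close>

lemma differentiable_0: "U differentiable (at 0)"
proof -
  have int: "U integrable_on {a..b}" for a b
    using cont continuous_on_subset integrable_continuous_real by blast
  \<comment> \<open>The primitive starts at \<open>-1\<close> so that 0 is an interior point and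
    two-sided derivatives are available.\<close>
  define G where "G x = integral {-1..x} U" for x
  have G: "(G has_vector_derivative U x) (at x)" if "x > -1" for x
  proof -
    have "((\<lambda>u. integral {-1..u} U) has_vector_derivative U x) (at x within {-1..x + 1})"
      using that by (intro integral_has_vector_derivative continuous_on_subset[OF cont]) auto
    moreover have "at x within {-1..x + 1} = at x"
      using that by (intro at_within_interior) auto
    ultimately show ?thesis by (simp add: G_def[abs_def])
  qed
  have GG: "integral {a..b} U = G b - G a" if "-1 \<le> a" "a \<le> b" for a b
    unfolding G_def using Henstock_Kurzweil_Integration.integral_combine[of "-1" a b U] that int
    by (simp add: algebra_simps)
  have "((\<lambda>h. inverse h *\<^sub>R (G h - G 0)) \<longlongrightarrow> U 0) (at 0)"
  proof -
    have "(\<lambda>h. norm (G h - G 0 - h *\<^sub>R U 0) / norm h) \<midarrow>0\<rightarrow> 0"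
      using G[of 0] by (simp add: has_vector_derivative_def has_derivative_at)
    moreover have "eventually (\<lambda>h. norm (G h - G 0 - h *\<^sub>R U 0) / norm h =
        norm (inverse h *\<^sub>R (G h - G 0) - U 0)) (at 0)"
    proof (rule eventually_mono[OF eventually_neq_at_within[of 0]])
      fix h :: real assume h: "h \<noteq> 0"
      have "inverse h *\<^sub>R (G h - G 0) - U 0 = inverse h *\<^sub>R (G h - G 0 - h *\<^sub>R U 0)"
        using h by (simp add: algebra_simps)
      then show "norm (G h - G 0 - h *\<^sub>R U 0) / norm h = norm (inverse h *\<^sub>R (G h - G 0) - U 0)"
        by (simp only: norm_scaleR) (simp add: divide_inverse mult.commute)
    qed
    ultimately have "(\<lambda>h. norm (inverse h *\<^sub>R (G h - G 0) - U 0)) \<midarrow>0\<rightarrow> 0"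
      by (rule Lim_transform_eventually)
    then show ?thesis by (rule LIM_zero_cancel[OF tendsto_norm_zero_cancel])
  qed
  then have lim: "((\<lambda>h. inverse h *\<^sub>R (G h - G 0)) \<longlongrightarrow> U 0) (at_right 0)"
    by (rule tendsto_mono[OF at_le, rotated]) simp
  \<comment> \<open>The means of \<open>U\<close> over short intervals tend to
    \<open>U 0 = mat 1\<close>, so their determinants are eventually nonzero.\<close>
  have "((\<lambda>h. det (inverse h *\<^sub>R (G h - G 0))) \<longlongrightarrow> det (U 0)) (at_right 0)"
    unfolding det_def by (intro tendsto_sum tendsto_mult tendsto_const tendsto_prod tendsto_vec_nth lim)
  then have "eventually (\<lambda>h. det (inverse h *\<^sub>R (G h - G 0)) \<noteq> 0) (at_right 0)"
    by (rule tendsto_imp_eventually_ne) (simp add: zero det_I)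
  moreover have "eventually (\<lambda>h::real. h > 0) (at_right 0)" by (simp add: eventually_at_right_less)
  ultimately have "eventually (\<lambda>h. h > 0 \<and> det (inverse h *\<^sub>R (G h - G 0)) \<noteq> 0) (at_right 0)"
    by eventually_elim auto
  then obtain a where a: "a > 0" "det (inverse a *\<^sub>R (G a - G 0)) \<noteq> 0"
    using eventually_happens'[OF trivial_limit_at_right_real] by blast
  then obtain B where "(inverse a *\<^sub>R (G a - G 0)) ** B = mat 1"
    using invertible_det_nz invertible_right_inverse by blast
  then have B: "(G a - G 0) ** (inverse a *\<^sub>R B) = mat 1"
    by (simp add: mm.scaleR_left mm.scaleR_right)
  have U_eq: "U t = (G (a + t) - G t) ** (inverse a *\<^sub>R B)" if t: "t > -1" for t
  proof -
    have "U t ** integral {0..a} U = integral {0..a} (\<lambda>s. U t ** U s)"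
      using integral_linear[OF int mm.bounded_linear_right, of 0 a "U t"] by (simp add: o_def)
    also have "\<dots> = integral {0..a} (\<lambda>s. U (s + t))"
      by (simp add: add[symmetric] add.commute)
    also have "\<dots> = integral {t..a + t} U"
      using integral_shift_Icc_real[of 0 a U t] by (simp add: o_def add.commute)
    finally have "U t ** (G a - G 0) = G (a + t) - G t" using GG[of 0 a] GG[of t "a + t"] t a by simp
    then show ?thesis using B by (metis matrix_mul_assoc matrix_mul_rid)
  qed
  have "((\<lambda>t. G (a + t) - G t) has_vector_derivative (U a - U 0)) (at 0)"
  proof (rule has_vector_derivative_diff)
    have "((\<lambda>t. a + t) has_vector_derivative 1) (at 0)"
      by (auto intro!: derivative_eq_intros)
    then show "((\<lambda>t. G (a + t)) has_vector_derivative U a) (at 0)"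
      using vector_diff_chain_at[of "\<lambda>t. a + t" 1 0 G "U a"] G[of a] a by (simp add: o_def)
    show "(G has_vector_derivative U 0) (at 0)" using G by simp
  qed
  then have "((\<lambda>t. (G (a + t) - G t) ** (inverse a *\<^sub>R B)) has_vector_derivative
      (U a - U 0) ** (inverse a *\<^sub>R B)) (at 0)"
    by (rule bounded_linear.has_vector_derivative[OF mm.bounded_linear_left])
  then have "(U has_vector_derivative (U a - U 0) ** (inverse a *\<^sub>R B)) (at 0)"
    by (rule has_vector_derivative_transform_within_open[where S="{-1<..}"]) (auto simp: U_eq)
  then show ?thesis by (rule differentiableI_vector)
qed

lemma deriv_0: "(U has_vector_derivative gen) (at 0)"
  unfolding gen_def using differentiable_0 vector_derivative_works by blast

lemma deriv_right: "(U has_vector_derivative (U t ** gen)) (at t)"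
proof -
  have "((\<lambda>s. U (s - t)) has_vector_derivative gen) (at t)"
    using vector_diff_chain_at[of "\<lambda>s. s - t" 1 t U gen] deriv_0
    by (simp add: o_def has_vector_derivative_diff_const)
  then have "((\<lambda>s. U t ** U (s - t)) has_vector_derivative U t ** gen) (at t)"
    by (rule bounded_linear.has_vector_derivative[OF mm.bounded_linear_right])
  then show ?thesis by (simp add: add[symmetric])
qed

lemma commute: "U s ** U t = U t ** U s"
  by (metis add add.commute)

lemma commute_gen_of_commute:
  assumes "\<And>t. A ** U t = U t ** A"
  shows "A ** gen = gen ** A"
proof -
  have "((\<lambda>s. A ** U s) has_vector_derivative A ** gen) (at 0)"
    by (rule bounded_linear.has_vector_derivative[OF mm.bounded_linear_right deriv_0])
  moreover have "((\<lambda>s. A ** U s) has_vector_derivative gen ** A) (at 0)"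
    unfolding assms by (rule bounded_linear.has_vector_derivative[OF mm.bounded_linear_left deriv_0])
  ultimately show ?thesis using vector_derivative_unique_at by blast
qed

lemma gen_commute: "U t ** gen = gen ** U t"
  using commute_gen_of_commute commute by blast

lemma scaled_deriv:
  "((\<lambda>t. exp (- s * of_real t) *s (U t *v u)) has_vector_derivative
     exp (- s * of_real t) *s (U t *v (gen *v u - s *s u))) (at t)"
proof -
  have e: "((\<lambda>t. exp (- s * of_real t)) has_vector_derivative exp (- s * of_real t) * (- s)) (at t)"
    by (rule has_vector_derivative_real_field) (auto intro!: derivative_eq_intros)
  have "((\<lambda>t. U t *v u) has_vector_derivative (U t ** gen) *v u) (at t)"
    by (rule bounded_linear.has_vector_derivative[OF mv.bounded_linear_left deriv_right])
  from sv.has_vector_derivative[OF e this] show ?thesis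
    by (simp add: vec.diff vec.scale vector_smult_assoc matrix_vector_mul_assoc[symmetric]
        vec.scale_right_diff_distrib)
qed

lemma eigen:
  assumes "gen *v u = s *s u"
  shows "U t *v u = exp (s * of_real t) *s u"
proof -
  have "((\<lambda>t. exp (- s * of_real t) *s (U t *v u)) has_vector_derivative 0) (at t)" for t
    using scaled_deriv[of s u t] assms by simp
  then have "exp (- s * of_real t) *s (U t *v u) = exp (- s * of_real 0) *s (U 0 *v u)"
    by (rule zero_vector_derivative_imp_eq)
  then have "exp (s * of_real t) *s (exp (- s * of_real t) *s (U t *v u)) = exp (s * of_real t) *s u"
    by (simp add: zero)
  then show ?thesis by (simp add: exp_minus)
qed

text \<open>A Jordan block would make \<open>U t\<close> grow linearly in \<open>t\<close>.\<close>

lemma semisimple_gen: "semisimple gen"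
  unfolding semisimple_def
proof (intro allI impI)
  fix s u assume *: "gen *v (gen *v u - s *s u) = s *s (gen *v u - s *s u)"
  let ?w = "gen *v u - s *s u"
  let ?g = "\<lambda>t. exp (- s * of_real t) *s (U t *v u) - t *\<^sub>R ?w"
  have "(?g has_vector_derivative 0) (at t)" for t
  proof -
    have "(?g has_vector_derivative exp (- s * of_real t) *s (U t *v ?w) - 1 *\<^sub>R ?w) (at t)"
      by (intro has_vector_derivative_diff scaled_deriv has_vector_derivative_scaleR[where g="\<lambda>_. ?w" and g'=0, simplified]) auto
    moreover have "exp (- s * of_real t) *s (U t *v ?w) = ?w"
      using eigen[OF *, of t] by (simp add: vector_smult_assoc exp_minus)
    ultimately show ?thesis by simp
  qed
  then have "?g (pi * 4) = ?g 0"
    by (rule zero_vector_derivative_imp_eq)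
  then have 1: "exp (- s * of_real (pi * 4)) *s u = u + (pi * 4) *\<^sub>R ?w"
    using period by (simp add: zero algebra_simps)
  have 2: "exp (s * of_real (pi * 4)) *s ?w = ?w"
    using eigen[OF *, of "pi * 4"] unfolding period matrix_vector_mul_lid by (rule sym)
  show "gen *v u = s *s u"
  proof (rule ccontr)
    assume "gen *v u \<noteq> s *s u"
    then have "exp (s * of_real (pi * 4)) = 1" using 2
      by (metis eq_iff_diff_eq_0 vec.scale_cancel_right vector_smult_lid)
    then have "exp (- s * of_real (pi * 4)) = 1" by (simp add: exp_minus)
    with 1 have "(pi * 4) *\<^sub>R ?w = 0" by simp
    then show False using \<open>gen *v u \<noteq> s *s u\<close> by simp
  qed
qed

lemma eigenvalue_half_integer:
  assumes "gen *v u = s *s u" "u \<noteq> 0"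
  obtains k :: int where "s = \<i> * of_real (of_int k / 2)"
proof -
  have "exp (s * of_real (pi * 4)) *s u = 1 *s u"
    using eigen[OF assms(1), of "pi * 4"] by (simp add: period)
  then have "exp (s * of_real (pi * 4)) = 1" using assms(2) by (metis vec.scale_cancel_right)
  then obtain k :: int where k: "Re (s * of_real (pi * 4)) = 0"
      "Im (s * of_real (pi * 4)) = of_int (2 * k) * pi"
    by (auto simp: exp_eq_1)
  then have "Re s = 0" "Im s = of_int k / 2" by (auto simp: field_simps)
  then show ?thesis by (intro that[of k]) (simp add: complex_eq_iff)
qed

lemma eigen_converse:
  assumes "\<And>t. U t *v u = cis (\<mu> * t) *s u"
  shows "gen *v u = (\<i> * of_real \<mu>) *s u"
proof -
  have "((\<lambda>t. U t *v u) has_vector_derivative gen *v u) (at 0)"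
    by (rule bounded_linear.has_vector_derivative[OF mv.bounded_linear_left deriv_0])
  moreover have "((\<lambda>t. cis (\<mu> * t)) has_vector_derivative \<i> * of_real \<mu>) (at 0)"
    unfolding cis_conv_exp of_real_mult
    by (rule has_vector_derivative_real_field) (auto intro!: derivative_eq_intros)
  then have "((\<lambda>t. cis (\<mu> * t) *s u) has_vector_derivative (\<i> * of_real \<mu>) *s u) (at 0)"
    by (rule bounded_linear.has_vector_derivative[OF sv.bounded_linear_left])
  ultimately show ?thesis using assms vector_derivative_unique_at by auto
qed

end

section \<open>The Clifford algebra\<close>

text \<open>The type \<open>cliff\<close> also contains families with coordinates outside
  \<open>{1..N}\<close>. Since \<open>cl_mult N\<close> discards these, \<open>cl_one\<close> is
  neutral only on this domain.\<close>

definition cl_dom :: "nat \<Rightarrow> cliff \<Rightarrow> bool" where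
  "cl_dom N x \<longleftrightarrow> (\<forall>R. \<not> R \<subseteq> {1..N} \<longrightarrow> x R = 0)"

definition symdiff :: "'a set \<Rightarrow> 'a set \<Rightarrow> 'a set" where
  "symdiff S T = (S - T) \<union> (T - S)"

lemma symdiff_assoc: "symdiff (symdiff S T) V = symdiff S (symdiff T V)"
  by (auto simp: symdiff_def)

lemma symdiff_subset: "S \<subseteq> A \<Longrightarrow> T \<subseteq> A \<Longrightarrow> symdiff S T \<subseteq> A"
  by (auto simp: symdiff_def)

lemma minus_one_card_symdiff:
  assumes "finite A" "finite B"
  shows "(-1 :: real) ^ card (symdiff A B) = (-1) ^ card A * (-1) ^ card B"
proof -
  have "card A = card (A - B) + card (A \<inter> B)" "card B = card (B - A) + card (A \<inter> B)"
    using assms by (metis Int_commute card_Diff_subset_Int card_mono finite_Int inf_le1 inf_le2 le_add_diff_inverse2)+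
  moreover have "card (symdiff A B) = card (A - B) + card (B - A)"
    using assms unfolding symdiff_def by (intro card_Un_disjoint) auto
  ultimately show ?thesis by (simp add: power_add mult_ac flip: power_mult_distrib)
qed

lemma finite_sign_pairs: "finite S \<Longrightarrow> finite T \<Longrightarrow> finite {(s, t). s \<in> S \<and> t \<in> T \<and> t \<le> s}"
  for S T :: "nat set"
  by (rule finite_subset[of _ "S \<times> T"]) auto

text \<open>Parity of cardinality is additive for symmetric differences, so
  \<open>blade_sign\<close> is multiplicative in each argument. Such a bicharacter is a 2-cocycle,
  which is what associativity on blades amounts to.\<close>

lemma blade_sign_symdiff_left:
  assumes "finite S" "finite S'" "finite T"
  shows "blade_sign (symdiff S S') T = blade_sign S T * blade_sign S' T"
proof -
  have "{(s, t). s \<in> symdiff S S' \<and> t \<in> T \<and> t \<le> s} =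
      symdiff {(s, t). s \<in> S \<and> t \<in> T \<and> t \<le> s} {(s, t). s \<in> S' \<and> t \<in> T \<and> t \<le> s}"
    by (auto simp: symdiff_def)
  then show ?thesis unfolding blade_sign_def
    using assms by (simp only: minus_one_card_symdiff finite_sign_pairs)
qed

lemma blade_sign_symdiff_right:
  assumes "finite S" "finite T" "finite T'"
  shows "blade_sign S (symdiff T T') = blade_sign S T * blade_sign S T'"
proof -
  have "{(s, t). s \<in> S \<and> t \<in> symdiff T T' \<and> t \<le> s} =
      symdiff {(s, t). s \<in> S \<and> t \<in> T \<and> t \<le> s} {(s, t). s \<in> S \<and> t \<in> T' \<and> t \<le> s}"
    by (auto simp: symdiff_def)
  then show ?thesis unfolding blade_sign_def
    using assms by (simp only: minus_one_card_symdiff finite_sign_pairs)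
qed

lemma cl_mult_symdiff: "cl_mult N x y = (\<lambda>R. \<Sum>S\<in>Pow {1..N}. \<Sum>T\<in>Pow {1..N}.
      x S * y T * blade_sign S T * blade (symdiff S T) R)"
  by (simp add: cl_mult_def symdiff_def)

lemma cl_mult_add_left: "cl_mult N (\<lambda>R. x R + y R) z = (\<lambda>R. cl_mult N x z R + cl_mult N y z R)"
  by (simp add: cl_mult_def algebra_simps sum.distrib)

lemma cl_mult_add_right: "cl_mult N z (\<lambda>R. x R + y R) = (\<lambda>R. cl_mult N z x R + cl_mult N z y R)"
  by (simp add: cl_mult_def algebra_simps sum.distrib)

lemma cl_mult_scale_left: "cl_mult N (\<lambda>R. c * x R) z = (\<lambda>R. c * cl_mult N x z R)"
  by (simp add: cl_mult_def sum_distrib_left mult_ac)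

lemma cl_mult_scale_right: "cl_mult N z (\<lambda>R. c * x R) = (\<lambda>R. c * cl_mult N z x R)"
  by (simp add: cl_mult_def sum_distrib_left mult_ac)

lemma cl_mult_sum_left: "cl_mult N (\<lambda>R. \<Sum>i\<in>A. x i R) z = (\<lambda>R. \<Sum>i\<in>A. cl_mult N (x i) z R)"
proof (induction A rule: infinite_finite_induct)
  case (insert i A)
  then show ?case by (simp add: cl_mult_add_left)
qed (simp_all add: cl_mult_def)

lemma cl_mult_sum_right: "cl_mult N z (\<lambda>R. \<Sum>i\<in>A. x i R) = (\<lambda>R. \<Sum>i\<in>A. cl_mult N z (x i) R)"
proof (induction A rule: infinite_finite_induct)
  case (insert i A)
  then show ?case by (simp add: cl_mult_add_right)
qed (simp_all add: cl_mult_def)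

lemmas cl_linear = cl_mult_add_left cl_mult_add_right cl_mult_scale_left cl_mult_scale_right

lemma blade_mult:
  assumes "S \<subseteq> {1..N}" "T \<subseteq> {1..N}"
  shows "cl_mult N (blade S) (blade T) = (\<lambda>R. blade_sign S T * blade (symdiff S T) R)"
proof
  fix R
  have "cl_mult N (blade S) (blade T) R = (\<Sum>S'\<in>Pow {1..N}. if S' = S then
      (\<Sum>T'\<in>Pow {1..N}. if T' = T then blade_sign S T * blade (symdiff S T) R else 0) else 0)"
    unfolding cl_mult_symdiff
  proof (rule sum.cong[OF refl])
    fix S'
    show "(\<Sum>T'\<in>Pow {1..N}. blade S S' * blade T T' * blade_sign S' T' * blade (symdiff S' T') R) =
      (if S' = S then (\<Sum>T'\<in>Pow {1..N}. if T' = T then blade_sign S T * blade (symdiff S T) R else 0) else 0)"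
    proof (cases "S' = S")
      case True
      then show ?thesis unfolding if_P[OF True]
        by (intro sum.cong) (auto simp: blade_def[of S] blade_def[of T])
    qed (simp add: blade_def[of S])
  qed
  also have "\<dots> = blade_sign S T * blade (symdiff S T) R"
    using assms by (simp add: sum.delta)
  finally show "cl_mult N (blade S) (blade T) R = blade_sign S T * blade (symdiff S T) R" .
qed

lemma cl_dom_mult: "cl_dom N (cl_mult N x y)"
proof -
  have "blade (symdiff S T) R = 0" if "S \<in> Pow {1..N}" "T \<in> Pow {1..N}" "\<not> R \<subseteq> {1..N}" for S T R
    using that symdiff_subset[of S "{1..N}" T] by (auto simp: blade_def)
  then show ?thesis unfolding cl_dom_def cl_mult_symdiff
    by (auto intro!: sum.neutral)
qed

lemma cl_dom_blade: "S \<subseteq> {1..N} \<Longrightarrow> cl_dom N (blade S)"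
  by (auto simp: cl_dom_def blade_def)

lemma cl_dom_one: "cl_dom N cl_one"
  by (simp add: cl_one_def cl_dom_blade)

lemma cl_expand: "cl_dom N x \<Longrightarrow> x = (\<lambda>R. \<Sum>S\<in>Pow {1..N}. x S * blade S R)"
proof
  fix R assume x: "cl_dom N x"
  have "(\<Sum>S\<in>Pow {1..N}. x S * blade S R) = (\<Sum>S\<in>Pow {1..N}. if S = R then x R else 0)"
    by (intro sum.cong) (auto simp: blade_def)
  also have "\<dots> = x R" using x by (auto simp: cl_dom_def)
  finally show "x R = (\<Sum>S\<in>Pow {1..N}. x S * blade S R)" ..
qed

lemma cl_mult_trunc_left: "cl_mult N x y = cl_mult N (\<lambda>R. \<Sum>S\<in>Pow {1..N}. x S * blade S R) y"
proof -
  have "(\<Sum>S\<in>Pow {1..N}. x S * blade S R) = x R" if "R \<in> Pow {1..N}" for R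
  proof -
    have "(\<Sum>S\<in>Pow {1..N}. x S * blade S R) = (\<Sum>S\<in>Pow {1..N}. if S = R then x R else 0)"
      by (intro sum.cong) (auto simp: blade_def)
    also have "\<dots> = x R" using that by simp
    finally show ?thesis .
  qed
  then show ?thesis by (simp add: cl_mult_def)
qed

lemma cl_mult_trunc_right: "cl_mult N x y = cl_mult N x (\<lambda>R. \<Sum>S\<in>Pow {1..N}. y S * blade S R)"
proof -
  have "(\<Sum>S\<in>Pow {1..N}. y S * blade S R) = y R" if "R \<in> Pow {1..N}" for R
  proof -
    have "(\<Sum>S\<in>Pow {1..N}. y S * blade S R) = (\<Sum>S\<in>Pow {1..N}. if S = R then y R else 0)"
      by (intro sum.cong) (auto simp: blade_def)
    also have "\<dots> = y R" using that by simp
    finally show ?thesis .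
  qed
  then show ?thesis by (simp add: cl_mult_def)
qed

lemma blade_mult_assoc:
  assumes "S \<subseteq> {1..N}" "T \<subseteq> {1..N}" "V \<subseteq> {1..N}"
  shows "cl_mult N (cl_mult N (blade S) (blade T)) (blade V) = cl_mult N (blade S) (cl_mult N (blade T) (blade V))"
proof -
  have "finite S" "finite T" "finite V" using assms finite_subset finite_atLeastAtMost by blast+
  then show ?thesis using assms
    by (simp add: blade_mult cl_linear symdiff_subset symdiff_assoc blade_sign_symdiff_left blade_sign_symdiff_right mult_ac)
qed

text \<open>A product sees only the coordinates inside \<open>{1..N}\<close>, so each factor may be
  replaced by its truncation, a combination of blades.\<close>

lemma cl_mult_assoc: "cl_mult N (cl_mult N x y) z = cl_mult N x (cl_mult N y z)"
proof -
  let ?P = "Pow {1..N}"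
  define tr where "tr x = (\<lambda>R. \<Sum>S\<in>?P. x S * blade S R)" for x :: cliff
  have tl: "cl_mult N (tr x) y = cl_mult N x y" for x y
    unfolding tr_def by (rule cl_mult_trunc_left[symmetric])
  have tr: "cl_mult N x (tr y) = cl_mult N x y" for x y
    unfolding tr_def by (rule cl_mult_trunc_right[symmetric])
  have "cl_mult N (cl_mult N x y) z = cl_mult N (cl_mult N (tr x) (tr y)) (tr z)"
    by (simp only: tl tr)
  also have "\<dots> = (\<lambda>R. \<Sum>S\<in>?P. \<Sum>T\<in>?P. \<Sum>V\<in>?P. x S * (y T * (z V *
      cl_mult N (cl_mult N (blade S) (blade T)) (blade V) R)))"
    by (simp only: tr_def cl_mult_sum_left cl_mult_sum_right cl_linear sum_distrib_left)
  also have "\<dots> = (\<lambda>R. \<Sum>S\<in>?P. \<Sum>T\<in>?P. \<Sum>V\<in>?P. x S * (y T * (z V *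
      cl_mult N (blade S) (cl_mult N (blade T) (blade V)) R)))"
    by (intro ext sum.cong refl arg_cong2[of _ _ _ _ "(*)"]) (simp add: blade_mult_assoc)
  also have "\<dots> = cl_mult N (tr x) (cl_mult N (tr y) (tr z))"
    by (simp only: tr_def cl_mult_sum_left cl_mult_sum_right cl_linear sum_distrib_left)
  also have "\<dots> = cl_mult N x (cl_mult N y z)"
    by (simp only: tl tr)
  finally show ?thesis .
qed

lemma cl_one_mult: "cl_dom N x \<Longrightarrow> cl_mult N cl_one x = x"
proof -
  assume x: "cl_dom N x"
  have "cl_mult N cl_one x = (\<lambda>R. \<Sum>S\<in>Pow {1..N}. x S * blade S R)"
    by (subst cl_expand[OF x])
      (simp add: cl_mult_sum_right cl_linear cl_one_def blade_mult blade_sign_def symdiff_def)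
  then show ?thesis using cl_expand[OF x] by simp
qed

lemma cl_mult_one: "cl_dom N x \<Longrightarrow> cl_mult N x cl_one = x"
proof -
  assume x: "cl_dom N x"
  have "cl_mult N x cl_one = (\<lambda>R. \<Sum>S\<in>Pow {1..N}. x S * blade S R)"
    by (subst cl_expand[OF x])
      (simp add: cl_mult_sum_left cl_linear cl_one_def blade_mult blade_sign_def symdiff_def)
  then show ?thesis using cl_expand[OF x] by simp
qed

abbreviation cl_e :: "nat \<Rightarrow> cliff" where "cl_e i \<equiv> blade {i}"

lemma e_square: "i \<in> {1..N} \<Longrightarrow> cl_mult N (cl_e i) (cl_e i) = (\<lambda>R. - 1 * cl_one R)"
proof -
  have "{(s, t). s = i \<and> t = i \<and> t \<le> s} = {(i, i)}" by auto
  then show "i \<in> {1..N} \<Longrightarrow> ?thesis" by (simp add: blade_mult blade_sign_def symdiff_def cl_one_def)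
qed

lemma blade_sign_single: "blade_sign {i} {j} = (if j \<le> i then -1 else 1)"
proof -
  have "{(s, t). s = i \<and> t = j \<and> t \<le> s} = (if j \<le> i then {(i, j)} else {})" by auto
  then show ?thesis by (simp add: blade_sign_def)
qed

lemma e_anticommute: "i \<in> {1..N} \<Longrightarrow> j \<in> {1..N} \<Longrightarrow> i \<noteq> j \<Longrightarrow>
    cl_mult N (cl_e i) (cl_e j) = (\<lambda>R. - 1 * cl_mult N (cl_e j) (cl_e i) R)"
  by (auto simp: blade_mult blade_sign_single symdiff_def insert_commute Diff_insert_absorb)

section \<open>Systems of plane rotations\<close>

lemmas mm_simps = mm.add_left mm.add_right mm.diff_left mm.diff_right mm.minus_left mm.minus_right
  mm.scaleR_left mm.scaleR_right mm.zero_left mm.zero_right matrix_mul_assoc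

text \<open>The axioms hold in the spin group, where \<open>\<rho> a b t\<close> is the lift of the rotation by \<open>t\<close> in the
  plane of \<open>e\<^sub>a, e\<^sub>b\<close>. The last one describes the conjugate of a rotation in the plane of \<open>e\<^sub>u, e\<^sub>v\<close> by
  a right-angled spherical triangle with hypotenuse \<open>\<phi>\<close>; differentiating it at \<open>\<phi> = 0\<close> gives the
  commutation relations of the generators without exponentials of matrices.\<close>

locale rotation_system =
  fixes I :: "nat set" and \<rho> :: "nat \<Rightarrow> nat \<Rightarrow> real \<Rightarrow> complex^'d^'d"
  assumes group: "a \<in> I \<Longrightarrow> b \<in> I \<Longrightarrow> a \<noteq> b \<Longrightarrow> periodic_group (\<rho> a b)"
    and swap: "a \<in> I \<Longrightarrow> b \<in> I \<Longrightarrow> a \<noteq> b \<Longrightarrow> \<rho> b a t = \<rho> a b (- t)"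
    and disjoint: "{a, b, c, d} \<subseteq> I \<Longrightarrow> distinct [a, b, c, d] \<Longrightarrow> \<rho> a b s ** \<rho> c d t = \<rho> c d t ** \<rho> a b s"
    and flip: "{u, v, w} \<subseteq> I \<Longrightarrow> distinct [u, v, w] \<Longrightarrow> \<rho> u v t ** \<rho> v w pi = \<rho> v w pi ** \<rho> u v (- t)"
    and triangle: "{u, v, w} \<subseteq> I \<Longrightarrow> distinct [u, v, w] \<Longrightarrow> cos \<phi> = cos \<theta> * cos t \<Longrightarrow>
        sin \<phi> * cos s = cos \<theta> * sin t \<Longrightarrow> sin \<phi> * sin s = sin \<theta> \<Longrightarrow>
        \<rho> v w s ** \<rho> u v (2 * \<phi>) ** \<rho> v w (- s) = \<rho> u v t ** \<rho> u w (2 * \<theta>) ** \<rho> u v t"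
begin

definition X :: "nat \<Rightarrow> nat \<Rightarrow> complex^'d^'d" where "X a b = periodic_group.gen (\<rho> a b)"

lemma zero [simp]: "a \<in> I \<Longrightarrow> b \<in> I \<Longrightarrow> a \<noteq> b \<Longrightarrow> \<rho> a b 0 = mat 1"
  using periodic_group.zero group by blast

lemma inverse: "a \<in> I \<Longrightarrow> b \<in> I \<Longrightarrow> a \<noteq> b \<Longrightarrow> \<rho> a b t ** \<rho> a b (- t) = mat 1"
  using periodic_group.add[OF group, of a b t "- t"] by simp

lemma inverse': "a \<in> I \<Longrightarrow> b \<in> I \<Longrightarrow> a \<noteq> b \<Longrightarrow> \<rho> a b (- t) ** \<rho> a b t = mat 1"
  using inverse[of a b "- t"] by simp

lemma deriv: "a \<in> I \<Longrightarrow> b \<in> I \<Longrightarrow> a \<noteq> b \<Longrightarrow> (\<rho> a b has_vector_derivative X a b) (at 0)"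
  unfolding X_def using periodic_group.deriv_0 group by blast

lemma X_swap: assumes "a \<in> I" "b \<in> I" "a \<noteq> b" shows "X b a = - X a b"
proof -
  have "(uminus has_vector_derivative (-1::real)) (at 0)"
    by (auto intro!: derivative_eq_intros)
  then have "((\<lambda>t. \<rho> a b (- t)) has_vector_derivative - X a b) (at 0)"
    using vector_diff_chain_at[of uminus "-1" 0 "\<rho> a b" "X a b"] deriv[OF assms] by (simp add: o_def)
  moreover have "\<rho> b a = (\<lambda>t. \<rho> a b (- t))" using swap[OF assms] by blast
  ultimately have "(\<rho> b a has_vector_derivative - X a b) (at 0)" by simp
  then show ?thesis using deriv[of b a] assms vector_derivative_unique_at by blast
qed

lemma disjoint_X:
  assumes "{a, b, c, d} \<subseteq> I" "distinct [a, b, c, d]"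
  shows "\<rho> a b s ** X c d = X c d ** \<rho> a b s"
  unfolding X_def using assms disjoint group by (intro periodic_group.commute_gen_of_commute) auto

lemma disjoint_XX:
  assumes "{a, b, c, d} \<subseteq> I" "distinct [a, b, c, d]"
  shows "X a b ** X c d = X c d ** X a b"
proof -
  have "X c d ** X a b = X a b ** X c d"
    unfolding X_def[of a b] using assms disjoint_X group
    by (intro periodic_group.commute_gen_of_commute) auto
  then show ?thesis ..
qed

text \<open>By Napier's rules a right spherical triangle with hypotenuse \<open>phi\<close> and
  angle \<open>s\<close> has the legs \<open>arcsin (sin phi * sin s)\<close> and
  \<open>arctan (tan phi * cos s)\<close>. Their derivatives at \<open>phi = 0\<close> are
  \<open>sin s\<close> and \<open>cos s\<close>, so differentiating \<open>triangle\<close> there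
  gives twice the claim.\<close>

lemma Ad:
  assumes "{u, v, w} \<subseteq> I" "distinct [u, v, w]"
  shows "\<rho> v w s ** X u v ** \<rho> v w (- s) = cos s *\<^sub>R X u v + sin s *\<^sub>R X u w"
proof -
  define \<theta> where "\<theta> \<phi> = arcsin (sin \<phi> * sin s)" for \<phi>
  define \<tau> where "\<tau> \<phi> = arctan (tan \<phi> * cos s)" for \<phi>
  have cond: "cos \<phi> = cos (\<theta> \<phi>) * cos (\<tau> \<phi>) \<and> sin \<phi> * cos s = cos (\<theta> \<phi>) * sin (\<tau> \<phi>) \<and>
      sin \<phi> * sin s = sin (\<theta> \<phi>)" if "\<phi> \<in> {-pi/2<..<pi/2}" for \<phi>
  proof -
    have c: "cos \<phi> > 0" using that by (intro cos_gt_zero_pi) auto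
    define x where "x = tan \<phi> * cos s"
    have le: "\<bar>sin \<phi> * sin s\<bar> \<le> 1" by (simp add: abs_mult mult_le_one)
    have x: "cos \<phi> * x = sin \<phi> * cos s" using c by (simp add: x_def tan_def)
    have "1 - (sin \<phi> * sin s)\<^sup>2 = (cos \<phi>)\<^sup>2 + (sin \<phi> * cos s)\<^sup>2"
      by (simp add: power_mult_distrib sin_squared_eq algebra_simps)
    also have "\<dots> = (cos \<phi>)\<^sup>2 * (1 + x\<^sup>2)"
      unfolding x[symmetric] by (simp add: power_mult_distrib algebra_simps)
    finally have "cos (\<theta> \<phi>) = cos \<phi> * sqrt (1 + x\<^sup>2)"
      using le c by (simp add: \<theta>_def cos_arcsin abs_le_iff real_sqrt_mult)
    moreover have "cos (\<tau> \<phi>) = 1 / sqrt (1 + x\<^sup>2)" "sin (\<tau> \<phi>) = x / sqrt (1 + x\<^sup>2)"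
      by (simp_all add: \<tau>_def x_def cos_arctan sin_arctan)
    moreover have "sqrt (1 + x\<^sup>2) \<noteq> 0" by (simp add: add_nonneg_eq_0_iff)
    ultimately show ?thesis using le x by (simp add: \<theta>_def abs_le_iff)
  qed
  have d1: "(\<theta> has_vector_derivative sin s) (at 0)"
    unfolding \<theta>_def has_real_derivative_iff_has_vector_derivative[symmetric]
    by (auto intro!: derivative_eq_intros)
  have d2: "(\<tau> has_vector_derivative cos s) (at 0)"
    unfolding \<tau>_def has_real_derivative_iff_has_vector_derivative[symmetric]
    by (auto intro!: derivative_eq_intros)
  have [simp]: "\<theta> 0 = 0" "\<tau> 0 = 0" by (simp_all add: \<theta>_def \<tau>_def)
  have uv: "u \<in> I" "v \<in> I" "w \<in> I" "u \<noteq> v" "u \<noteq> w" "v \<noteq> w" using assms by auto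
  have D2: "((\<lambda>\<phi>. 2 * \<phi>) has_vector_derivative 2) (at (0::real))"
    by (auto intro!: derivative_eq_intros)
  have L: "((\<lambda>\<phi>. \<rho> v w s ** \<rho> u v (2 * \<phi>) ** \<rho> v w (- s)) has_vector_derivative
      \<rho> v w s ** (2 *\<^sub>R X u v) ** \<rho> v w (- s)) (at 0)"
    using vector_diff_chain_at[OF D2, of "\<rho> u v" "X u v"] deriv[of u v] uv
    by (intro bounded_linear.has_vector_derivative[OF mm.bounded_linear_left]
        bounded_linear.has_vector_derivative[OF mm.bounded_linear_right]) (simp add: o_def)
  have D3: "((\<lambda>\<phi>. 2 * \<theta> \<phi>) has_vector_derivative 2 * sin s) (at (0::real))"
    using d1 unfolding has_real_derivative_iff_has_vector_derivative[symmetric]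
    by (auto intro!: derivative_eq_intros)
  have R1: "((\<lambda>\<phi>. \<rho> u w (2 * \<theta> \<phi>)) has_vector_derivative (2 * sin s) *\<^sub>R X u w) (at 0)"
    using vector_diff_chain_at[OF D3, of "\<rho> u w" "X u w"] deriv[of u w] uv by (simp add: o_def)
  have R2: "((\<lambda>\<phi>. \<rho> u v (\<tau> \<phi>)) has_vector_derivative cos s *\<^sub>R X u v) (at 0)"
    using vector_diff_chain_at[OF d2, of "\<rho> u v" "X u v"] deriv[of u v] uv by (simp add: o_def)
  have eq: "\<rho> u v (\<tau> 0) ** \<rho> u w (2 * \<theta> 0) ** (cos s *\<^sub>R X u v) +
      (\<rho> u v (\<tau> 0) ** ((2 * sin s) *\<^sub>R X u w) + cos s *\<^sub>R X u v ** \<rho> u w (2 * \<theta> 0)) ** \<rho> u v (\<tau> 0)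
      = (2 * cos s) *\<^sub>R X u v + (2 * sin s) *\<^sub>R X u w"
    unfolding mult_2[of "cos s"] scaleR_add_left using uv by (simp add: add_ac)
  have "((\<lambda>\<phi>. \<rho> u v (\<tau> \<phi>) ** \<rho> u w (2 * \<theta> \<phi>) ** \<rho> u v (\<tau> \<phi>)) has_vector_derivative
      (2 * cos s) *\<^sub>R X u v + (2 * sin s) *\<^sub>R X u w) (at 0)"
    using mm.has_vector_derivative[OF mm.has_vector_derivative[OF R2 R1] R2] unfolding eq .
  then have "((\<lambda>\<phi>. \<rho> v w s ** \<rho> u v (2 * \<phi>) ** \<rho> v w (- s)) has_vector_derivative
      (2 * cos s) *\<^sub>R X u v + (2 * sin s) *\<^sub>R X u w) (at 0)"
    by (rule has_vector_derivative_transform_within_open[where S="{-pi/2<..<pi/2}"])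
      (use cond triangle[OF assms] in auto)
  with L have "\<rho> v w s ** (2 *\<^sub>R X u v) ** \<rho> v w (- s) = (2 * cos s) *\<^sub>R X u v + (2 * sin s) *\<^sub>R X u w"
    using vector_derivative_unique_at by blast
  then have "2 *\<^sub>R (\<rho> v w s ** X u v ** \<rho> v w (- s)) = 2 *\<^sub>R (cos s *\<^sub>R X u v + sin s *\<^sub>R X u w)"
    by (simp add: mm_simps scaleR_add_right)
  then show ?thesis by simp
qed

lemma Ad_left:
  assumes "{u, v, w} \<subseteq> I" "distinct [u, v, w]"
  shows "\<rho> v w s ** X u v = cos s *\<^sub>R (X u v ** \<rho> v w s) + sin s *\<^sub>R (X u w ** \<rho> v w s)"
proof -
  have "\<rho> v w s ** X u v = (\<rho> v w s ** X u v ** \<rho> v w (- s)) ** \<rho> v w s"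
    using assms by (simp add: matrix_mul_assoc[symmetric] inverse')
  also have "\<dots> = cos s *\<^sub>R (X u v ** \<rho> v w s) + sin s *\<^sub>R (X u w ** \<rho> v w s)"
    by (simp only: Ad[OF assms] mm_simps)
  finally show ?thesis .
qed

text \<open>The derivative of \<open>Ad_left\<close> at \<open>s = 0\<close>.\<close>

lemma commutator:
  assumes "{u, v, w} \<subseteq> I" "distinct [u, v, w]"
  shows "X v w ** X u v = X u v ** X v w + X u w"
proof -
  have uv: "u \<in> I" "v \<in> I" "w \<in> I" "u \<noteq> v" "u \<noteq> w" "v \<noteq> w" using assms by auto
  have L: "((\<lambda>s. \<rho> v w s ** X u v) has_vector_derivative X v w ** X u v) (at 0)"
    by (rule bounded_linear.has_vector_derivative[OF mm.bounded_linear_left deriv]) (use uv in auto)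
  have c: "(cos has_vector_derivative 0) (at (0::real))" "(sin has_vector_derivative 1) (at (0::real))"
    unfolding has_real_derivative_iff_has_vector_derivative[symmetric]
    by (auto intro!: derivative_eq_intros)
  have m: "((\<lambda>s. Y ** \<rho> v w s) has_vector_derivative Y ** X v w) (at 0)" for Y
    by (rule bounded_linear.has_vector_derivative[OF mm.bounded_linear_right deriv]) (use uv in auto)
  have R: "((\<lambda>s. cos s *\<^sub>R (X u v ** \<rho> v w s) + sin s *\<^sub>R (X u w ** \<rho> v w s)) has_vector_derivative
      X u v ** X v w + X u w) (at 0)"
    using has_vector_derivative_add[OF has_vector_derivative_scaleR has_vector_derivative_scaleR,
        OF _ m _ m, of cos 0 sin 1 "X u v" "X u w"] uv
    by (simp add: has_real_derivative_iff_has_vector_derivative c)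
  show ?thesis by (rule vector_derivative_unique_at[OF L[unfolded Ad_left[OF assms]] R])
qed

text \<open>Conjugation rotates the pair \<open>X u v\<close>, \<open>X u w\<close> like a vector in
  the plane; in the sum of the two squares the mixed products cancel.\<close>

lemma Ad_square:
  assumes "{u, v, w} \<subseteq> I" "distinct [u, v, w]"
  shows "\<rho> v w s ** (X u v ** X u v + X u w ** X u w) = (X u v ** X u v + X u w ** X u w) ** \<rho> v w s"
proof -
  have a: "\<rho> v w s ** X u v = cos s *\<^sub>R (X u v ** \<rho> v w s) + sin s *\<^sub>R (X u w ** \<rho> v w s)"
    by (rule Ad_left[OF assms])
  have "\<rho> w v (- s) ** X u w = cos (- s) *\<^sub>R (X u w ** \<rho> w v (- s)) + sin (- s) *\<^sub>R (X u v ** \<rho> w v (- s))"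
    by (rule Ad_left) (use assms in auto)
  then have b: "\<rho> v w s ** X u w = cos s *\<^sub>R (X u w ** \<rho> v w s) - sin s *\<^sub>R (X u v ** \<rho> v w s)"
    using swap[of v w "- s"] assms by simp
  let ?r = "\<rho> v w s"
  have "?r ** (X u v ** X u v + X u w ** X u w) = ?r ** X u v ** X u v + ?r ** X u w ** X u w"
    by (simp add: mm_simps)
  also have "\<dots> = cos s *\<^sub>R (X u v ** (?r ** X u v)) + sin s *\<^sub>R (X u w ** (?r ** X u v))
       + cos s *\<^sub>R (X u w ** (?r ** X u w)) - sin s *\<^sub>R (X u v ** (?r ** X u w))"
    by (simp add: a b mm.add_left mm.diff_left mm.scaleR_left matrix_mul_assoc[symmetric])
  also have "\<dots> = (cos s * cos s + sin s * sin s) *\<^sub>R ((X u v ** X u v) ** ?r + (X u w ** X u w) ** ?r)"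
    unfolding a b by (simp add: mm_simps algebra_simps del: sin_cos_squared_add3)
  also have "\<dots> = (X u v ** X u v + X u w ** X u w) ** ?r" by (simp add: mm_simps)
  finally show ?thesis .
qed

text \<open>The Casimir operator up to a factor: the sum is over ordered pairs, so each plane counts
  twice. Hence the 2 in \<open>Cas_insert\<close>.\<close>

definition Cas :: "nat set \<Rightarrow> complex^'d^'d" where
  "Cas J = (\<Sum>a\<in>J. \<Sum>b\<in>J - {a}. X a b ** X a b)"

lemma Cas_insert:
  assumes "finite J" "v \<notin> J" "insert v J \<subseteq> I"
  shows "Cas (insert v J) = Cas J + 2 *\<^sub>R (\<Sum>a\<in>J. X v a ** X v a)"
proof -
  have "Cas (insert v J) = (\<Sum>b\<in>J. X v b ** X v b) + (\<Sum>a\<in>J. \<Sum>b\<in>insert v J - {a}. X a b ** X a b)"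
    using assms by (simp add: Cas_def)
  also have "(\<Sum>a\<in>J. \<Sum>b\<in>insert v J - {a}. X a b ** X a b)
      = (\<Sum>a\<in>J. X v a ** X v a + (\<Sum>b\<in>J - {a}. X a b ** X a b))"
  proof (rule sum.cong[OF refl])
    fix a assume a: "a \<in> J"
    then have "insert v J - {a} = insert v (J - {a})" using assms by auto
    moreover have "X a v = - X v a" using X_swap[of v a] a assms by auto
    ultimately show "(\<Sum>b\<in>insert v J - {a}. X a b ** X a b) = X v a ** X v a + (\<Sum>b\<in>J - {a}. X a b ** X a b)"
      using assms by (simp add: mm_simps)
  qed
  finally show ?thesis by (simp add: Cas_def sum.distrib scaleR_2)
qed

text \<open>Splitting off \<open>v\<close> and \<open>w\<close> leaves planes that avoid both axes,
  the pairs of \<open>Ad_square\<close>, and the plane of \<open>v\<close>, \<open>w\<close> itself;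
  each of the three parts commutes.\<close>

lemma Cas_commute:
  assumes "finite J" "J \<subseteq> I" "v \<in> J" "w \<in> J" "v \<noteq> w"
  shows "\<rho> v w s ** Cas J = Cas J ** \<rho> v w s"
proof -
  define J' where "J' = J - {v, w}"
  have J: "J = insert v (insert w J')" "v \<notin> insert w J'" "w \<notin> J'" "finite J'"
    using assms by (auto simp: J'_def)
  have mem: "v \<in> I" "w \<in> I" using assms by auto
  have eq: "Cas J = Cas J' + 2 *\<^sub>R (\<Sum>a\<in>J'. X v a ** X v a + X w a ** X w a) + 2 *\<^sub>R (X v w ** X v w)"
    using J assms by (simp add: Cas_insert sum.distrib algebra_simps)
  have 1: "\<rho> v w s ** Cas J' = Cas J' ** \<rho> v w s"
  proof -
    have "\<rho> v w s ** (X a b ** X a b) = (X a b ** X a b) ** \<rho> v w s" if "a \<in> J'" "b \<in> J' - {a}" for a b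
    proof -
      have "\<rho> v w s ** X a b = X a b ** \<rho> v w s"
        using that assms by (intro disjoint_X) (auto simp: J'_def)
      then show ?thesis by (metis matrix_mul_assoc)
    qed
    then show ?thesis by (simp add: Cas_def mm.sum_left mm.sum_right)
  qed
  have 2: "\<rho> v w s ** (X v a ** X v a + X w a ** X w a) = (X v a ** X v a + X w a ** X w a) ** \<rho> v w s"
    if "a \<in> J'" for a
  proof -
    have "X v a = - X a v" "X w a = - X a w" using that assms X_swap[of a v] X_swap[of a w] by (auto simp: J'_def)
    then show ?thesis using Ad_square[of a v w s] that assms by (auto simp: J'_def mm_simps)
  qed
  have "\<rho> v w s ** X v w = X v w ** \<rho> v w s"
    unfolding X_def using mem assms periodic_group.gen_commute[OF group] by blast
  then have 3: "\<rho> v w s ** (X v w ** X v w) = (X v w ** X v w) ** \<rho> v w s"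
    by (metis matrix_mul_assoc)
  have 2: "\<rho> v w s ** (\<Sum>a\<in>J'. X v a ** X v a + X w a ** X w a) = (\<Sum>a\<in>J'. X v a ** X v a + X w a ** X w a) ** \<rho> v w s"
    unfolding mm.sum_left mm.sum_right using 2 by (rule sum.cong[OF refl])
  show ?thesis unfolding eq mm.add_left mm.add_right mm.scaleR_left mm.scaleR_right 1 2 3 ..
qed

end

section \<open>Rotations in the spin group\<close>

lemma cl_mult_minus_left: "cl_mult N (\<lambda>R. - x R) z = (\<lambda>R. - cl_mult N x z R)"
  using cl_mult_scale_left[of N "-1" x z] by simp

lemma cl_mult_minus_right: "cl_mult N z (\<lambda>R. - x R) = (\<lambda>R. - cl_mult N z x R)"
  using cl_mult_scale_right[of N z "-1" x] by simp

lemma cl_mult_diff_left: "cl_mult N (\<lambda>R. x R - y R) z = (\<lambda>R. cl_mult N x z R - cl_mult N y z R)"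
  using cl_mult_add_left[of N x "\<lambda>R. - y R" z] by (simp add: cl_mult_minus_left)

lemmas cl_linear_minus = cl_mult_diff_left cl_linear cl_mult_minus_left cl_mult_minus_right

lemma cl_dom_lin: "cl_dom N x \<Longrightarrow> cl_dom N y \<Longrightarrow> cl_dom N (\<lambda>R. a * x R + b * y R)"
  by (simp add: cl_dom_def)

lemma cl_dom_e: "i \<in> {1..N} \<Longrightarrow> cl_dom N (cl_e i)"
  by (rule cl_dom_blade) auto

lemma e_left_square: "i \<in> {1..N} \<Longrightarrow> cl_dom N x \<Longrightarrow> cl_mult N (cl_e i) (cl_mult N (cl_e i) x) = (\<lambda>R. - x R)"
  by (simp add: e_square cl_linear_minus cl_one_mult flip: cl_mult_assoc)

lemma e_left_anticommute: "i \<in> {1..N} \<Longrightarrow> j \<in> {1..N} \<Longrightarrow> i \<noteq> j \<Longrightarrow>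
    cl_mult N (cl_e i) (cl_mult N (cl_e j) x) = (\<lambda>R. - cl_mult N (cl_e j) (cl_mult N (cl_e i) x) R)"
  by (simp add: e_anticommute[of i N j] cl_linear_minus flip: cl_mult_assoc)

definition cl_E :: "nat \<Rightarrow> nat \<Rightarrow> nat \<Rightarrow> cliff" where
  "cl_E N a b = cl_mult N (cl_e a) (cl_e b)"

definition rot :: "nat \<Rightarrow> nat \<Rightarrow> nat \<Rightarrow> real \<Rightarrow> cliff" where
  "rot N a b t = (\<lambda>R. cos (t / 2) * cl_one R + sin (t / 2) * cl_E N a b R)"

text \<open>The even part of the Clifford algebra on three axes, a copy of the quaternions.
  Identities among rotations about these axes become identities between four real
  coordinates.\<close>

definition quat :: "nat \<Rightarrow> nat \<Rightarrow> nat \<Rightarrow> nat \<Rightarrow> real \<Rightarrow> real \<Rightarrow> real \<Rightarrow> real \<Rightarrow> cliff" where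
  "quat N u v w a b c d = (\<lambda>R. a * cl_one R + b * cl_E N u v R + c * cl_E N u w R + d * cl_E N v w R)"

lemma cl_dom_E: "cl_dom N (cl_E N a b)"
  by (simp add: cl_E_def cl_dom_mult)

lemma cl_dom_rot: "cl_dom N (rot N a b t)"
  by (simp add: rot_def cl_dom_lin cl_dom_one cl_dom_E)

context
  fixes N u v w :: nat
  assumes uvw: "u \<in> {1..N}" "v \<in> {1..N}" "w \<in> {1..N}" "distinct [u, v, w]"
begin

text \<open>Oriented rules: products are sorted into the order \<open>u\<close>, \<open>v\<close>,
  \<open>w\<close>, and squares are removed.\<close>

lemmas norm_rules = e_left_square[OF uvw(1)] e_left_square[OF uvw(2)] e_left_square[OF uvw(3)]
  e_square[OF uvw(1)] e_square[OF uvw(2)] e_square[OF uvw(3)]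
  e_left_anticommute[OF uvw(2,1)] e_left_anticommute[OF uvw(3,1)] e_left_anticommute[OF uvw(3,2)]
  e_anticommute[OF uvw(2,1)] e_anticommute[OF uvw(3,1)] e_anticommute[OF uvw(3,2)]

lemma quat_mult: "cl_mult N (quat N u v w a b c d) (quat N u v w a' b' c' d') =
   quat N u v w (a * a' - b * b' - c * c' - d * d') (a * b' + b * a' + c * d' - d * c')
     (a * c' + c * a' + d * b' - b * d') (a * d' + d * a' + b * c' - c * b')"
proof -
  have u: "u \<noteq> v" "u \<noteq> w" "v \<noteq> w" using uvw by auto
  have d: "cl_dom N (cl_e u)" "cl_dom N (cl_e v)" "cl_dom N (cl_e w)" using uvw cl_dom_e by auto
  have E: "cl_mult N (cl_E N u v) (cl_E N u v) = (\<lambda>R. - cl_one R)"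
    "cl_mult N (cl_E N u w) (cl_E N u w) = (\<lambda>R. - cl_one R)"
    "cl_mult N (cl_E N v w) (cl_E N v w) = (\<lambda>R. - cl_one R)"
    "cl_mult N (cl_E N u v) (cl_E N u w) = cl_E N v w"
    "cl_mult N (cl_E N u w) (cl_E N u v) = (\<lambda>R. - cl_E N v w R)"
    "cl_mult N (cl_E N u v) (cl_E N v w) = (\<lambda>R. - cl_E N u w R)"
    "cl_mult N (cl_E N v w) (cl_E N u v) = cl_E N u w"
    "cl_mult N (cl_E N u w) (cl_E N v w) = cl_E N u v"
    "cl_mult N (cl_E N v w) (cl_E N u w) = (\<lambda>R. - cl_E N u v R)"
    using u by (simp_all add: cl_E_def cl_mult_assoc norm_rules cl_linear_minus d cl_dom_mult cl_dom_one cl_one_mult cl_mult_one)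
  show ?thesis
    by (rule ext) (simp add: quat_def cl_linear E cl_one_mult cl_mult_one cl_dom_E cl_dom_one algebra_simps)
qed

lemma rot_uv: "rot N u v t = quat N u v w (cos (t / 2)) (sin (t / 2)) 0 0"
  by (simp add: rot_def quat_def)

lemma rot_uw: "rot N u w t = quat N u v w (cos (t / 2)) 0 (sin (t / 2)) 0"
  by (simp add: rot_def quat_def)

lemma rot_vw: "rot N v w t = quat N u v w (cos (t / 2)) 0 0 (sin (t / 2))"
  by (simp add: rot_def quat_def)

lemma rot_flip: "cl_mult N (rot N u v t) (rot N v w pi) = cl_mult N (rot N v w pi) (rot N u v (- t))"
  by (simp add: rot_uv rot_vw quat_mult)

text \<open>On both sides the \<open>E v w\<close> coordinate cancels; the three remaining
  coordinates are matched by the three relations of the triangle.\<close>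

lemma rot_triangle:
  assumes "cos \<phi> = cos \<theta> * cos t" "sin \<phi> * cos s = cos \<theta> * sin t" "sin \<phi> * sin s = sin \<theta>"
  shows "cl_mult N (cl_mult N (rot N v w s) (rot N u v (2 * \<phi>))) (rot N v w (- s)) =
    cl_mult N (cl_mult N (rot N u v t) (rot N u w (2 * \<theta>))) (rot N u v t)"
proof -
  have c: "cos x = cos (x / 2) * cos (x / 2) - sin (x / 2) * sin (x / 2)" for x :: real
    using cos_add[of "x / 2" "x / 2"] by simp
  have s: "sin x = sin (x / 2) * cos (x / 2) + cos (x / 2) * sin (x / 2)" for x :: real
    using sin_add[of "x / 2" "x / 2"] by simp
  have one: "cos (x / 2) * cos (x / 2) = 1 - sin (x / 2) * sin (x / 2)" for x :: real
    using sin_cos_squared_add3[of "x / 2"] by linarith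
  have L: "cl_mult N (cl_mult N (rot N v w s) (rot N u v (2 * \<phi>))) (rot N v w (- s)) =
      quat N u v w (cos \<phi>) (sin \<phi> * cos s) (sin \<phi> * sin s) 0"
    unfolding rot_uv rot_vw quat_mult
    by (rule arg_cong4[where f="quat N u v w"]) (simp_all add: c[of s] s[of s] one algebra_simps)
  have R: "cl_mult N (cl_mult N (rot N u v t) (rot N u w (2 * \<theta>))) (rot N u v t) =
      quat N u v w (cos \<theta> * cos t) (cos \<theta> * sin t) (sin \<theta>) 0"
    unfolding rot_uv rot_uw quat_mult
    by (rule arg_cong4[where f="quat N u v w"]) (simp_all add: c[of t] s[of t] one algebra_simps)
  show ?thesis unfolding L R assms ..
qed

end

lemma cl_E_square: "a \<in> {1..N} \<Longrightarrow> b \<in> {1..N} \<Longrightarrow> a \<noteq> b \<Longrightarrow> cl_mult N (cl_E N a b) (cl_E N a b) = (\<lambda>R. - cl_one R)"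
  by (simp add: cl_E_def cl_mult_assoc e_left_anticommute[of b N a] e_left_square e_square cl_linear_minus
     cl_dom_mult cl_dom_e cl_mult_one cl_dom_one)

lemma rot_mult: "cl_mult N (rot N a b s) (rot N c d t) =
    (\<lambda>R. cos (s / 2) * (cos (t / 2) * cl_one R + sin (t / 2) * cl_E N c d R) +
          sin (s / 2) * (cos (t / 2) * cl_E N a b R + sin (t / 2) * cl_mult N (cl_E N a b) (cl_E N c d) R))"
  by (simp add: rot_def cl_linear cl_one_mult cl_mult_one cl_dom_E cl_dom_one distrib_left)

lemma rot_add: "a \<in> {1..N} \<Longrightarrow> b \<in> {1..N} \<Longrightarrow> a \<noteq> b \<Longrightarrow>
    cl_mult N (rot N a b s) (rot N a b t) = rot N a b (s + t)"
  unfolding rot_mult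
  by (rule ext) (simp add: rot_def cl_E_square cos_add sin_add add_divide_distrib algebra_simps)

lemma rot_0 [simp]: "rot N a b 0 = cl_one"
  by (simp add: rot_def)

lemma rot_2pi: "rot N a b (2 * pi) = (\<lambda>R. - cl_one R)"
  by (simp add: rot_def)

lemma rot_4pi: "rot N a b (pi * 4) = cl_one"
proof -
  have "pi * 4 / 2 = 2 * pi" by simp
  then show ?thesis unfolding rot_def by (simp only:) simp
qed

lemma rot_swap: "a \<in> {1..N} \<Longrightarrow> b \<in> {1..N} \<Longrightarrow> a \<noteq> b \<Longrightarrow> rot N b a t = rot N a b (- t)"
  by (simp add: rot_def cl_E_def e_anticommute[of b N a])

lemma rot_disjoint:
  assumes "{a, b, c, d} \<subseteq> {1..N}" "distinct [a, b, c, d]"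
  shows "cl_mult N (rot N a b s) (rot N c d t) = cl_mult N (rot N c d t) (rot N a b s)"
proof -
  have "cl_mult N (cl_E N c d) (cl_E N a b) = cl_mult N (cl_E N a b) (cl_E N c d)"
    using assms by (simp add: cl_E_def cl_mult_assoc e_left_anticommute[of d N a] e_left_anticommute[of c N a]
      e_left_anticommute[of d N b] e_left_anticommute[of c N b] e_anticommute[of d N b] cl_linear_minus)
  then show ?thesis unfolding rot_mult by (intro ext) (simp add: algebra_simps)
qed

lemma rot_e_commute:
  assumes "{a, b, c} \<subseteq> {1..N}" "distinct [a, b, c]"
  shows "cl_mult N (rot N a b s) (cl_e c) = cl_mult N (cl_e c) (rot N a b s)"
proof -
  have "cl_mult N (cl_E N a b) (cl_e c) = cl_mult N (cl_e c) (cl_E N a b)"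
    using assms by (simp add: cl_E_def cl_mult_assoc e_left_anticommute[of c N a] e_anticommute[of c N b] cl_linear_minus)
  moreover have "cl_dom N (cl_e c)" using assms by (auto intro: cl_dom_e)
  ultimately show ?thesis
    by (simp add: rot_def cl_linear cl_one_mult cl_mult_one cl_dom_E cl_dom_one distrib_left)
qed

lemma rot_e_left:
  assumes "a \<in> {1..N}" "b \<in> {1..N}" "a \<noteq> b"
  shows "cl_mult N (cl_e a) (rot N a b s) = cl_mult N (rot N a b (- s)) (cl_e a)"
proof -
  have d: "cl_dom N (cl_e a)" "cl_dom N (cl_e b)" using assms by (auto intro: cl_dom_e)
  have "cl_mult N (cl_e a) (cl_E N a b) = (\<lambda>R. - cl_e b R)"
    using assms d by (simp add: cl_E_def e_left_square)
  moreover have "cl_mult N (cl_E N a b) (cl_e a) = cl_e b"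
    using assms d by (simp add: cl_E_def cl_mult_assoc e_anticommute[of b N a] e_left_square cl_linear_minus)
  ultimately show ?thesis using d
    by (simp add: rot_def cl_linear_minus cl_one_mult cl_mult_one cl_dom_one)
qed

section \<open>The spin group and its generation by rotations\<close>

lemma cl_dom_foldr: "cl_dom N (foldr (cl_mult N) vs cl_one)"
  by (cases vs) (auto simp: cl_dom_one cl_dom_mult)

lemma foldr_cl_mult_append: "foldr (cl_mult N) (vs @ ws) cl_one =
    cl_mult N (foldr (cl_mult N) vs cl_one) (foldr (cl_mult N) ws cl_one)"
  by (induction vs) (auto simp: cl_one_mult cl_dom_foldr cl_mult_assoc)

lemma Spin_mult: "mult (Spin N) = cl_mult N" and Spin_one: "one (Spin N) = cl_one"
  by (simp_all add: Spin_def)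

lemma cl_dom_Spin: "x \<in> carrier (Spin N) \<Longrightarrow> cl_dom N x"
  by (auto simp: Spin_def cl_dom_foldr)

lemma Spin_monoid: "Group.monoid (Spin N)"
proof (rule monoidI)
  show "x \<otimes>\<^bsub>Spin N\<^esub> y \<in> carrier (Spin N)" if "x \<in> carrier (Spin N)" "y \<in> carrier (Spin N)" for x y
  proof -
    from that obtain vs ws where "x = foldr (cl_mult N) vs cl_one" "even (length vs)" "set vs \<subseteq> unit_vectors N"
       "y = foldr (cl_mult N) ws cl_one" "even (length ws)" "set ws \<subseteq> unit_vectors N"
      by (auto simp: Spin_def)
    then show ?thesis
      by (auto simp: Spin_def foldr_cl_mult_append[symmetric] intro!: exI[of _ "vs @ ws"])
  qed
  show "\<one>\<^bsub>Spin N\<^esub> \<in> carrier (Spin N)" by (auto simp: Spin_def intro!: exI[of _ "[]"])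
qed (auto simp: Spin_mult Spin_one cl_mult_assoc cl_one_mult cl_mult_one cl_dom_Spin)

lemma pair_in_Spin:
  assumes "v \<in> unit_vectors N" "w \<in> unit_vectors N" "cl_dom N w"
  shows "cl_mult N v w \<in> carrier (Spin N)"
proof -
  have "cl_mult N v w = foldr (cl_mult N) [v, w] cl_one \<and> even (length [v, w]) \<and> set [v, w] \<subseteq> unit_vectors N"
    using assms by (simp add: cl_mult_one)
  then show ?thesis unfolding Spin_def partial_object.select_convs mem_Collect_eq by (rule exI)
qed

lemma sum_remove_two:
  fixes f :: "'a \<Rightarrow> 'b::comm_monoid_add"
  assumes "finite A" "a \<in> A" "b \<in> A" "a \<noteq> b"
  shows "sum f A = f a + (f b + sum f (A - {a, b}))"
proof -
  have "A - {a, b} = A - {a} - {b}" by blast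
  then show ?thesis using assms sum.remove[of A a f] sum.remove[of "A - {a}" b f] by simp
qed

lemma cl_vec_two:
  assumes "a \<in> {1..N}" "b \<in> {1..N}" "a \<noteq> b"
  shows "cl_vec N (\<lambda>i. if i = a then x else if i = b then y else 0) = (\<lambda>R. x * cl_e a R + y * cl_e b R)"
    "(\<Sum>i=1..N. (if i = a then x else if i = b then y else 0 :: real)\<^sup>2) = x\<^sup>2 + y\<^sup>2"
proof -
  have *: "(\<Sum>i=1..N. f i) = f a + f b" if "\<And>i. i \<noteq> a \<Longrightarrow> i \<noteq> b \<Longrightarrow> f i = 0" for f :: "nat \<Rightarrow> real"
  proof -
    have "(\<Sum>i=1..N. f i) = (\<Sum>i\<in>{a, b}. f i)"
      using assms that by (intro sum.mono_neutral_right) auto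
    then show ?thesis using assms by simp
  qed
  show "cl_vec N (\<lambda>i. if i = a then x else if i = b then y else 0) = (\<lambda>R. x * cl_e a R + y * cl_e b R)"
    unfolding cl_vec_def using assms by (intro ext, subst *) auto
  show "(\<Sum>i=1..N. (if i = a then x else if i = b then y else 0 :: real)\<^sup>2) = x\<^sup>2 + y\<^sup>2"
    using assms by (subst *) auto
qed

lemma unit_vector_two:
  assumes "a \<in> {1..N}" "b \<in> {1..N}" "a \<noteq> b" "x\<^sup>2 + y\<^sup>2 = 1"
  shows "(\<lambda>R. x * cl_e a R + y * cl_e b R) \<in> unit_vectors N"
  unfolding unit_vectors_def mem_Collect_eq
  by (rule exI, rule conjI, rule cl_vec_two(1)[OF assms(1-3), symmetric])
    (simp only: cl_vec_two(2)[OF assms(1-3)] assms(4))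

lemma rot_in_Spin:
  assumes "a \<in> {1..N}" "b \<in> {1..N}" "a \<noteq> b"
  shows "rot N a b t \<in> carrier (Spin N)"
proof -
  \<comment> \<open>Two unit vectors at half the angle: because \<open>e_a^2 = -1\<close>, their
    product is \<open>cos (t/2) + sin (t/2) e_a e_b\<close>.\<close>
  let ?v = "\<lambda>R. 1 * cl_e a R + 0 * cl_e b R" and ?w = "\<lambda>R. (- cos (t / 2)) * cl_e a R + sin (t / 2) * cl_e b R"
  have "cl_mult N ?v ?w \<in> carrier (Spin N)"
    using assms by (intro pair_in_Spin unit_vector_two cl_dom_lin cl_dom_e) auto
  also have "cl_mult N ?v ?w = rot N a b t"
    unfolding cl_linear using assms by (intro ext) (simp add: rot_def cl_E_def e_square)
  finally show ?thesis .
qed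

lemma cl_dom_vec: "cl_dom N (cl_vec N x)"
  by (auto simp: cl_dom_def cl_vec_def blade_def intro!: sum.neutral)

lemma cl_E_mult_e:
  assumes "a \<in> {1..N}" "b \<in> {1..N}" "a \<noteq> b"
  shows "cl_mult N (cl_E N a b) (cl_e a) = cl_e b" "cl_mult N (cl_E N a b) (cl_e b) = (\<lambda>R. - cl_e a R)"
     "cl_mult N (cl_e a) (cl_E N a b) = (\<lambda>R. - cl_e b R)" "cl_mult N (cl_e b) (cl_E N a b) = cl_e a"
proof -
  have d: "cl_dom N (cl_e a)" "cl_dom N (cl_e b)" using assms(1,2) cl_dom_e by blast+
  show "cl_mult N (cl_E N a b) (cl_e a) = cl_e b" "cl_mult N (cl_E N a b) (cl_e b) = (\<lambda>R. - cl_e a R)"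
     "cl_mult N (cl_e a) (cl_E N a b) = (\<lambda>R. - cl_e b R)" "cl_mult N (cl_e b) (cl_E N a b) = cl_e a"
    using assms d e_anticommute[of b N a] e_left_anticommute[OF assms(2,1)]
    by (simp_all add: cl_E_def cl_mult_assoc e_left_square e_square cl_linear_minus cl_mult_one)
qed

text \<open>The rotation of vectors covered by \<open>rot N 1 k s\<close>, written as an exchange
  relation so that no inverse appears.\<close>

lemma rot_vec:
  assumes k: "k \<in> {2..N}"
  shows "cl_mult N (rot N 1 k s) (cl_vec N x) = cl_mult N
    (cl_vec N (x(1 := cos s * x 1 - sin s * x k, k := sin s * x 1 + cos s * x k))) (rot N 1 k s)"
proof -
  let ?r = "rot N 1 k s" and ?A = "{1..N} - {1, k}"
  define x' where "x' = x(1 := cos s * x 1 - sin s * x k, k := sin s * x 1 + cos s * x k)"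
  have split: "cl_vec N y = (\<lambda>R. y 1 * cl_e 1 R + (y k * cl_e k R + (\<Sum>i\<in>?A. y i * cl_e i R)))" for y
  proof -
    have "(\<Sum>i=1..N. f i) = f 1 + (f k + (\<Sum>i\<in>?A. f i))" for f :: "nat \<Rightarrow> real"
      using k by (intro sum_remove_two) auto
    then show ?thesis by (simp add: cl_vec_def)
  qed
  have k1: "k \<in> {1..N}" "1 \<in> {1..N}" "k \<noteq> 1" using k by auto
  have d: "cl_dom N (cl_e 1)" "cl_dom N (cl_e k)" using k1 by (auto intro: cl_dom_e)
  note E = cl_E_mult_e[OF k1(2,1) k1(3)[symmetric]]
  have half: "cos s * cos (s/2) + sin s * sin (s/2) = cos (s/2)" "sin s * cos (s/2) - cos s * sin (s/2) = sin (s/2)"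
    using cos_diff[of s "s/2"] sin_diff[of s "s/2"] by simp_all
  have r1: "cl_mult N ?r (cl_e 1) = (\<lambda>R. cos (s/2) * cl_e 1 R + sin (s/2) * cl_e k R)"
    "cl_mult N ?r (cl_e k) = (\<lambda>R. cos (s/2) * cl_e k R - sin (s/2) * cl_e 1 R)"
    "cl_mult N (cl_e 1) ?r = (\<lambda>R. cos (s/2) * cl_e 1 R - sin (s/2) * cl_e k R)"
    "cl_mult N (cl_e k) ?r = (\<lambda>R. cos (s/2) * cl_e k R + sin (s/2) * cl_e 1 R)"
    using d by (simp_all add: rot_def cl_linear E cl_one_mult cl_mult_one del: One_nat_def)
  have rest: "cl_mult N ?r (\<lambda>R. \<Sum>i\<in>?A. x i * cl_e i R) = cl_mult N (\<lambda>R. \<Sum>i\<in>?A. x i * cl_e i R) ?r"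
    unfolding cl_mult_sum_left cl_mult_sum_right cl_linear
    using k1 by (intro ext sum.cong refl arg_cong2[of _ _ _ _ "(*)"] fun_cong[OF rot_e_commute]) auto
  have rest': "(\<lambda>R. \<Sum>i\<in>?A. x' i * cl_e i R) = (\<lambda>R. \<Sum>i\<in>?A. x i * cl_e i R)"
    by (auto simp: x'_def)
  have x': "x' 1 = cos s * x 1 - sin s * x k" "x' k = sin s * x 1 + cos s * x k"
    using k1 by (simp_all add: x'_def)
  have "cl_mult N ?r (cl_vec N x) = cl_mult N (cl_vec N x') ?r"
    unfolding split[of x] split[of x'] cl_linear rest rest' r1
  proof (rule ext)
    fix R
    have "x' 1 * cos (s/2) + x' k * sin (s/2) = x 1 * (cos s * cos (s/2) + sin s * sin (s/2)) -
        x k * (sin s * cos (s/2) - cos s * sin (s/2))" unfolding x' by (simp add: algebra_simps)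
    then have 1: "(x' 1 * cos (s/2) + x' k * sin (s/2)) * cl_e 1 R = (x 1 * cos (s/2) - x k * sin (s/2)) * cl_e 1 R"
      unfolding half by simp
    have "x' k * cos (s/2) - x' 1 * sin (s/2) = x 1 * (sin s * cos (s/2) - cos s * sin (s/2)) +
        x k * (cos s * cos (s/2) + sin s * sin (s/2))" unfolding x' by (simp add: algebra_simps)
    then have 2: "(x' k * cos (s/2) - x' 1 * sin (s/2)) * cl_e k R = (x 1 * sin (s/2) + x k * cos (s/2)) * cl_e k R"
      unfolding half by simp
    show "x 1 * (cos (s/2) * cl_e 1 R + sin (s/2) * cl_e k R) + (x k * (cos (s/2) * cl_e k R - sin (s/2) * cl_e 1 R) +
        cl_mult N (\<lambda>R. \<Sum>i\<in>?A. x i * cl_e i R) ?r R) =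
      x' 1 * (cos (s/2) * cl_e 1 R - sin (s/2) * cl_e k R) + (x' k * (cos (s/2) * cl_e k R + sin (s/2) * cl_e 1 R) +
        cl_mult N (\<lambda>R. \<Sum>i\<in>?A. x i * cl_e i R) ?r R)"
      using 1 2 by (simp only: algebra_simps)
  qed
  then show ?thesis by (simp add: x'_def)
qed

text \<open>The rotations in the planes of \<open>e\<^sub>1, e\<^sub>k\<close> generate the group: they move every unit vector
  into the first axis, one coordinate plane at a time.\<close>

lemma Spin_induct [consumes 2, case_names one rot mult]:
  assumes "u \<in> carrier (Spin N)" "2 \<le> N"
    and one: "P cl_one"
    and rot: "\<And>k s. k \<in> {2..N} \<Longrightarrow> P (rot N 1 k s)"
    and mult: "\<And>x y. x \<in> carrier (Spin N) \<Longrightarrow> y \<in> carrier (Spin N) \<Longrightarrow> P x \<Longrightarrow> P y \<Longrightarrow> P (cl_mult N x y)"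
  shows "P u"
proof -
  interpret Spin: Group.monoid "Spin N" by (rule Spin_monoid)
  let ?e = "cl_e 1"
  define G where "G = {x \<in> carrier (Spin N). P x}"
  have G_mult: "cl_mult N x y \<in> G" if "x \<in> G" "y \<in> G" for x y
    using that mult Spin.m_closed by (auto simp: G_def Spin_mult)
  have G_rot: "rot N 1 k s \<in> G" if "k \<in> {2..N}" for k s
    using that rot rot_in_Spin[of 1 N k] by (auto simp: G_def)
  have G_one: "cl_one \<in> G" using one Spin.one_closed by (auto simp: G_def Spin_one)
  have G_neg: "(\<lambda>R. - cl_one R) \<in> G"
    using G_rot[of 2 "2 * pi"] assms(2) by (simp add: rot_2pi)
  have e: "1 \<in> {1..N}" "cl_dom N ?e" using assms(2) by (auto intro: cl_dom_e)
  \<comment> \<open>A single vector is odd, so it is paired with \<open>e_1\<close> on either side.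
    The induction is on a bound \<open>K\<close> for the indices of nonzero coordinates.\<close>
  have key: "cl_mult N ?e (cl_vec N x) \<in> G \<and> cl_mult N (cl_vec N x) ?e \<in> G"
    if "(\<Sum>i=1..N. (x i)\<^sup>2) = 1" "\<And>i. i > K \<Longrightarrow> x i = 0" "1 \<le> K" "K \<le> N" for x K
    using that(3,4,1,2)
  proof (induction K arbitrary: x rule: dec_induct)
    case base
    have s: "(\<Sum>i=1..N. f i) = f 1" if "\<And>i. i > 1 \<Longrightarrow> f i = 0" for f :: "nat \<Rightarrow> real"
    proof -
      have "(\<Sum>i=1..N. f i) = (\<Sum>i\<in>{1}. f i)"
        using assms(2) that by (intro sum.mono_neutral_right) auto
      then show ?thesis by simp
    qed
    have v: "cl_vec N x = (\<lambda>R. x 1 * ?e R)" unfolding cl_vec_def using base by (intro ext s) auto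
    have "(x 1)\<^sup>2 = 1" using base s[of "\<lambda>i. (x i)\<^sup>2"] by auto
    then have "x 1 = 1 \<or> x 1 = -1" by (simp add: power2_eq_1_iff)
    then show ?case unfolding v cl_linear e_square[OF e(1)] using G_one G_neg by auto
  next
    case (step K)
    obtain r a where ra: "x 1 = r * cos a" "x (Suc K) = r * sin a" using polar_Ex by blast
    \<comment> \<open>Rotating by minus the polar angle of \<open>(x 1, x (Suc K))\<close>
      annihilates coordinate \<open>Suc K\<close>.\<close>
    define s where "s = - a"
    define x' where "x' = x(1 := cos s * x 1 - sin s * x (Suc K), Suc K := sin s * x 1 + cos s * x (Suc K))"
    have SK: "Suc K \<in> {2..N}" using step by auto
    let ?g = "rot N 1 (Suc K) s" and ?h = "rot N 1 (Suc K) (- s)"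
    have eqs: "cl_mult N ?g (cl_vec N x) = cl_mult N (cl_vec N x') ?g"
      unfolding x'_def using rot_vec[OF SK] .
    have "(\<Sum>i=1..N. (x' i)\<^sup>2) = 1"
    proof -
      have sp: "(\<Sum>i=1..N. f i) = f 1 + (f (Suc K) + (\<Sum>i\<in>{1..N} - {1, Suc K}. f i))" for f :: "nat \<Rightarrow> real"
        using SK step(1) by (intro sum_remove_two) auto
      have "(x' 1)\<^sup>2 + (x' (Suc K))\<^sup>2 = (cos s * cos s + sin s * sin s) * ((x 1)\<^sup>2 + (x (Suc K))\<^sup>2)"
        using step(1) by (simp add: x'_def power2_eq_square algebra_simps del: sin_cos_squared_add3)
      moreover have "(\<Sum>i\<in>{1..N} - {1, Suc K}. (x' i)\<^sup>2) = (\<Sum>i\<in>{1..N} - {1, Suc K}. (x i)\<^sup>2)"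
        by (intro sum.cong) (auto simp: x'_def)
      ultimately show ?thesis using step.prems(2) sp[of "\<lambda>i. (x i)\<^sup>2"] sp[of "\<lambda>i. (x' i)\<^sup>2"] by simp
    qed
    moreover have "x' i = 0" if "i > K" for i
    proof (cases "i = Suc K")
      case True
      then show ?thesis by (simp add: x'_def ra s_def del: One_nat_def)
    next
      case False
      then show ?thesis using that step.prems(3)[of i] step(1) by (simp add: x'_def)
    qed
    ultimately have IH: "cl_mult N ?e (cl_vec N x') \<in> G" "cl_mult N (cl_vec N x') ?e \<in> G"
      using step.IH[of x'] step.prems by auto
    have inv: "cl_mult N ?h ?g = cl_one" "cl_mult N ?g ?h = cl_one"
      using SK by (simp_all add: rot_add)
    have eh: "cl_mult N ?e ?h = cl_mult N ?g ?e" "cl_mult N ?g ?e = cl_mult N ?e ?h"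
      using rot_e_left[of 1 N "Suc K" "- s"] SK by auto
    have v: "cl_vec N x = cl_mult N ?h (cl_mult N (cl_vec N x') ?g)"
      unfolding eqs[symmetric] cl_mult_assoc[symmetric] inv by (simp add: cl_one_mult cl_dom_vec)
    have "cl_mult N ?e (cl_vec N x) = cl_mult N ?g (cl_mult N (cl_mult N ?e (cl_vec N x')) ?g)"
      unfolding v by (simp add: eh(1) del: One_nat_def flip: cl_mult_assoc)
    moreover have "cl_mult N (cl_vec N x) ?e = cl_mult N ?h (cl_mult N (cl_mult N (cl_vec N x') ?e) ?h)"
      unfolding v by (simp add: eh(2) cl_mult_assoc del: One_nat_def)
    ultimately show ?case using IH G_mult G_rot[OF SK] by simp
  qed
  have pair: "cl_mult N v w \<in> G" if vw: "v \<in> unit_vectors N" "w \<in> unit_vectors N" for v w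
  proof -
    obtain x y where x: "v = cl_vec N x" "(\<Sum>i=1..N. (x i)\<^sup>2) = 1" and y: "w = cl_vec N y" "(\<Sum>i=1..N. (y i)\<^sup>2) = 1"
      using vw unfolding unit_vectors_def by blast
    have trunc: "cl_vec N z = cl_vec N (\<lambda>i. if i \<le> N then z i else 0)" for z
      by (auto simp: cl_vec_def intro!: sum.cong)
    have k: "cl_mult N ?e (cl_vec N z) \<in> G \<and> cl_mult N (cl_vec N z) ?e \<in> G" if "(\<Sum>i=1..N. (z i)\<^sup>2) = 1" for z
    proof -
      have "(\<Sum>i=1..N. (if i \<le> N then z i else 0)\<^sup>2) = (\<Sum>i=1..N. (z i)\<^sup>2)"
        by (intro sum.cong) auto
      then show ?thesis unfolding trunc[of z] using that assms(2) by (intro key[of _ N]) auto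
    qed
    \<comment> \<open>Since \<open>e_1^2 = -1\<close>, inserting \<open>e_1\<close> twice gives
      \<open>v w = - (v e_1) (e_1 w)\<close>.\<close>
    have "cl_mult N (\<lambda>R. - cl_one R) (cl_mult N (cl_mult N v ?e) (cl_mult N ?e w)) \<in> G"
      using k[OF x(2)] k[OF y(2)] x y G_mult G_neg by simp
    also have "cl_mult N (\<lambda>R. - cl_one R) (cl_mult N (cl_mult N v ?e) (cl_mult N ?e w)) = cl_mult N v w"
      using e y by (simp add: cl_mult_assoc e_left_square cl_linear_minus cl_one_mult cl_dom_mult cl_dom_vec)
    finally show ?thesis .
  qed
  obtain vs where vs: "u = foldr (cl_mult N) vs cl_one" "even (length vs)" "set vs \<subseteq> unit_vectors N"
    using assms(1) by (auto simp: Spin_def)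
  have "foldr (cl_mult N) vs cl_one \<in> G" using vs(2,3)
  proof (induction vs rule: induct_list012)
    case (3 v w vs)
    then have "cl_mult N (cl_mult N v w) (foldr (cl_mult N) vs cl_one) \<in> G"
      by (intro G_mult pair) auto
    then show ?case by (simp add: cl_mult_assoc)
  qed (auto simp: G_one)
  then show ?thesis using vs by (simp add: G_def)
qed

section \<open>Generators with square \<open>-1/4\<close>\<close>

lemma mat_vector: "mat c *v v = c *s v" for c :: complex
  by (simp add: matrix_vector_mult_def mat_def vec_eq_iff if_distrib if_distribR cong: if_cong)

lemma scaleR_eq_smult: "r *\<^sub>R v = complex_of_real r *s v" for v :: "complex^'n"
  unfolding vec_eq_iff vector_scaleR_component vector_smult_component
  by (simp add: scaleR_conv_of_real)

lemma matrix_eq_on_span: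
  fixes A B :: "complex^'n^'m"
  assumes "\<And>w. w \<in> S \<Longrightarrow> A *v w = B *v w" "v \<in> vec.span S"
  shows "A *v v = B *v v"
proof -
  have "vec.subspace {v. A *v v = B *v v}"
    by (auto simp: vec.subspace_def vec.add vec.scale)
  then have "vec.span S \<subseteq> {v. A *v v = B *v v}"
    by (intro vec.span_minimal) (use assms(1) in auto)
  then show ?thesis using assms(2) by auto
qed

context periodic_group
begin

text \<open>The eigenvalues are \<open>i/2\<close> and \<open>-i/2\<close>; on each eigenvector this
  is Euler's formula at half the angle, and eigenvectors span.\<close>

lemma eq_of_gen_square:
  assumes "\<And>v. gen *v (gen *v v) = (-1/4) *s v"
  shows "U t = cos (t / 2) *\<^sub>R mat 1 + (2 * sin (t / 2)) *\<^sub>R gen"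
proof -
  have "U t *v v = (cos (t / 2) *\<^sub>R mat 1 + (2 * sin (t / 2)) *\<^sub>R gen) *v v" for v
  proof (rule matrix_eq_on_span)
    show "v \<in> vec.span {w \<in> UNIV. \<exists>s. gen *v w = s *s w}"
      by (rule semisimple_span[OF _ _ semisimple_gen]) (auto simp: vec.subspace_UNIV)
    fix w assume "w \<in> {w \<in> UNIV. \<exists>s. gen *v w = s *s w}"
    then obtain s where s: "gen *v w = s *s w" by auto
    show "U t *v w = (cos (t / 2) *\<^sub>R mat 1 + (2 * sin (t / 2)) *\<^sub>R gen) *v w"
    proof (cases "w = 0")
      case False
      have "(s * s) *s w = (-1/4) *s w" using assms[of w] by (simp add: s vec.scale)
      then have "s * s = -1/4" using False by (metis vec.scale_cancel_right)
      then have "(s - \<i> / 2) * (s + \<i> / 2) = 0" by (simp add: algebra_simps)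
      then have "s = \<i> / 2 \<or> s = - \<i> / 2" by (auto simp: add_eq_0_iff2)
      then have "exp (s * of_real t) = of_real (cos (t / 2)) + of_real (2 * sin (t / 2)) * s"
      proof
        assume "s = \<i> / 2"
        then have "s * of_real t = \<i> * of_real (t / 2)" by simp
        then show ?thesis by (simp only: cis_conv_exp[symmetric]) (simp add: \<open>s = \<i> / 2\<close> complex_eq_iff)
      next
        assume "s = - \<i> / 2"
        then have "s * of_real t = \<i> * of_real (- t / 2)" by simp
        then show ?thesis by (simp only: cis_conv_exp[symmetric]) (simp add: \<open>s = - \<i> / 2\<close> complex_eq_iff)
      qed
      then show ?thesis
        by (simp only: eigen[OF s] mv.add_left mv.scaleR_left matrix_vector_mul_lid s scaleR_eq_smult
            vector_smult_assoc vector_sadd_rdistrib)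
    qed simp
  qed
  then show ?thesis by (simp add: matrix_eq)
qed

text \<open>In a spin representation a generator is thus half a group element, so invariance and
  exchange relations known for group elements pass to generators.\<close>

lemma gen_eq_of_gen_square:
  assumes "\<And>v. gen *v (gen *v v) = (-1/4) *s v"
  shows "U pi = 2 *\<^sub>R gen"
  using eq_of_gen_square[OF assms, of pi] by simp

end

context rotation_system
begin

lemma rho_X_commute: "a \<in> I \<Longrightarrow> b \<in> I \<Longrightarrow> a \<noteq> b \<Longrightarrow> \<rho> a b t ** X a b = X a b ** \<rho> a b t"
  unfolding X_def using periodic_group.gen_commute[OF group] by blast

lemma flip_X:
  assumes "{u, v, w} \<subseteq> I" "distinct [u, v, w]"
  shows "X u v ** \<rho> v w pi = - (\<rho> v w pi ** X u v)"
proof -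
  have uv: "u \<in> I" "v \<in> I" "u \<noteq> v" using assms by auto
  have "((\<lambda>t. \<rho> u v t ** \<rho> v w pi) has_vector_derivative X u v ** \<rho> v w pi) (at 0)"
    by (rule bounded_linear.has_vector_derivative[OF mm.bounded_linear_left deriv[OF uv]])
  moreover have "(uminus has_vector_derivative (-1::real)) (at 0)"
    by (auto intro!: derivative_eq_intros)
  then have "((\<lambda>t. \<rho> u v (- t)) has_vector_derivative - X u v) (at 0)"
    using vector_diff_chain_at[of uminus "-1" 0 "\<rho> u v" "X u v"] deriv[OF uv] by (simp add: o_def)
  then have "((\<lambda>t. \<rho> v w pi ** \<rho> u v (- t)) has_vector_derivative \<rho> v w pi ** (- X u v)) (at 0)"
    by (rule bounded_linear.has_vector_derivative[OF mm.bounded_linear_right])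
  ultimately have "X u v ** \<rho> v w pi = \<rho> v w pi ** (- X u v)"
    unfolding flip[OF assms] by (rule vector_derivative_unique_at)
  then show ?thesis by (simp add: mm_simps)
qed

text \<open>A quarter turn in the plane of \<open>v\<close>, \<open>w\<close> preserves
  \<open>W\<close> and conjugates \<open>X u v\<close> into \<open>X u w\<close>.\<close>

lemma square_transfer:
  assumes "{u, v, w} \<subseteq> I" "distinct [u, v, w]"
    and W: "\<And>x t. x \<in> W \<Longrightarrow> \<rho> v w t *v x \<in> W"
    and sq: "\<And>x. x \<in> W \<Longrightarrow> X u v *v (X u v *v x) = (-1/4) *s x"
    and x: "x \<in> W"
  shows "X u w *v (X u w *v x) = (-1/4) *s x"
proof -
  let ?g = "\<rho> v w (pi/2)" and ?h = "\<rho> v w (- (pi/2))"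
  have vw: "v \<in> I" "w \<in> I" "v \<noteq> w" using assms by auto
  have inv: "?h ** ?g = mat 1" "?g ** ?h = mat 1" using inverse[OF vw] inverse'[OF vw] by auto
  have "?g ** X u v ** ?h = X u w" using Ad[OF assms(1,2), of "pi/2"] by simp
  then have Xuw: "X u w *v y = ?g *v (X u v *v (?h *v y))" for y
    by (simp add: matrix_vector_mul_assoc[symmetric] flip: \<open>?g ** X u v ** ?h = X u w\<close>)
  have hg: "?h *v (?g *v y) = y" "?g *v (?h *v y) = y" for y
    by (simp_all add: matrix_vector_mul_assoc inv)
  show ?thesis unfolding Xuw hg sq[OF W[OF x]] vec.scale hg ..
qed

text \<open>At most two transfers lead from the plane of \<open>p\<close>, \<open>q\<close> to that
  of \<open>a\<close>, \<open>b\<close>, up to orientation, which the square ignores.\<close>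

lemma squares_all:
  assumes J: "J \<subseteq> I" and W: "\<And>a b x t. a \<in> J \<Longrightarrow> b \<in> J \<Longrightarrow> a \<noteq> b \<Longrightarrow> x \<in> W \<Longrightarrow> \<rho> a b t *v x \<in> W"
    and pq: "p \<in> J" "q \<in> J" "p \<noteq> q" "\<And>x. x \<in> W \<Longrightarrow> X p q *v (X p q *v x) = (-1/4) *s x"
    and ab: "a \<in> J" "b \<in> J" "a \<noteq> b" and x: "x \<in> W"
  shows "X a b *v (X a b *v x) = (-1/4) *s x"
proof -
  have sym: "X d c *v (X d c *v y) = X c d *v (X c d *v y)" if "c \<in> J" "d \<in> J" "c \<noteq> d" for c d y
  proof -
    have "X d c = - X c d" using X_swap[of c d] that J by blast
    then show ?thesis by (simp only: mv.minus_left mv.minus_right minus_minus)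
  qed
  have 1: "X p c *v (X p c *v y) = (-1/4) *s y" if c: "c \<in> J" "c \<noteq> p" and y: "y \<in> W" for c y
  proof (cases "c = q")
    case False
    show ?thesis by (rule square_transfer[of p q c W]) (use False J pq W y c in auto)
  qed (use pq y in auto)
  show ?thesis
  proof (cases "a = p \<or> b = p")
    case True
    then show ?thesis using 1 ab x sym by metis
  next
    case False
    have "X b a *v (X b a *v x) = (-1/4) *s x"
    proof (rule square_transfer[of b p a W])
      fix y assume "y \<in> W"
      then show "X b p *v (X b p *v y) = (-1/4) *s y" using 1[of b y] sym[of p b y] False ab pq by auto
    qed (use False J pq W ab x in auto)
    then show ?thesis using sym ab by metis
  qed
qed

end

section \<open>Weights of spin group representations\<close>

lemma Spin_inverse:
  assumes "u \<in> carrier (Spin N)" "2 \<le> N"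
  shows "\<exists>u'\<in>carrier (Spin N). cl_mult N u u' = cl_one \<and> cl_mult N u' u = cl_one"
  using assms
proof (induction rule: Spin_induct)
  case one
  interpret Group.monoid "Spin N" by (rule Spin_monoid)
  show ?case using one_closed by (intro bexI[of _ cl_one]) (auto simp: Spin_one cl_one_mult cl_dom_one)
next
  case (rot k s)
  then show ?case
    by (intro bexI[of _ "rot N 1 k (- s)"]) (auto simp: rot_add intro: rot_in_Spin)
next
  case (mult x y)
  interpret Group.monoid "Spin N" by (rule Spin_monoid)
  from mult obtain x' y' where x': "x' \<in> carrier (Spin N)" "cl_mult N x x' = cl_one" "cl_mult N x' x = cl_one"
    and y': "y' \<in> carrier (Spin N)" "cl_mult N y y' = cl_one" "cl_mult N y' y = cl_one" by blast
  have "cl_mult N (cl_mult N x y) (cl_mult N y' x') = cl_mult N (cl_mult N x (cl_mult N y y')) x'"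
    by (simp only: cl_mult_assoc)
  then have 1: "cl_mult N (cl_mult N x y) (cl_mult N y' x') = cl_one"
    using x' y' mult by (simp add: cl_mult_one cl_dom_Spin)
  have "cl_mult N (cl_mult N y' x') (cl_mult N x y) = cl_mult N (cl_mult N y' (cl_mult N x' x)) y"
    by (simp only: cl_mult_assoc)
  then have 2: "cl_mult N (cl_mult N y' x') (cl_mult N x y) = cl_one"
    using x' y' mult by (simp add: cl_mult_one cl_dom_Spin)
  show ?case using 1 2 m_closed[OF y'(1) x'(1)] by (auto simp: Spin_mult)
qed

text \<open>Turns membership in \<open>K\<close> and \<open>M\<close> into commutation with
  \<open>e_1\<close> and \<open>e_2\<close>.\<close>

lemma spin_act_fix_iff:
  assumes "u \<in> carrier (Spin N)" "2 \<le> N" "cl_dom N x"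
  shows "spin_act N u x = x \<longleftrightarrow> cl_mult N u x = cl_mult N x u"
proof -
  interpret Group.monoid "Spin N" by (rule Spin_monoid)
  have "u \<in> Units (Spin N)"
    using Spin_inverse[OF assms(1,2)] assms(1) by (auto simp: Units_def Spin_mult Spin_one)
  then have inv: "cl_mult N u (inv\<^bsub>Spin N\<^esub> u) = cl_one" "cl_mult N (inv\<^bsub>Spin N\<^esub> u) u = cl_one"
    using Units_r_inv[of u] Units_l_inv[of u] by (simp_all add: Spin_mult Spin_one)
  show ?thesis
  proof
    assume "spin_act N u x = x"
    then have "cl_mult N x u = cl_mult N (spin_act N u x) u" by simp
    also have "\<dots> = cl_mult N u x"
      using assms(3) by (simp add: spin_act_def cl_mult_assoc inv cl_mult_one)
    finally show "cl_mult N u x = cl_mult N x u" ..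
  next
    assume "cl_mult N u x = cl_mult N x u"
    then show "spin_act N u x = x"
      using assms(3) by (simp add: spin_act_def cl_mult_assoc inv cl_mult_one)
  qed
qed

lemma carrier_K_group: "carrier (K_group m) =
    {u \<in> carrier (Spin (2 * m + 2)). cl_mult (2 * m + 2) u (cl_e 1) = cl_mult (2 * m + 2) (cl_e 1) u}"
  unfolding K_group_def U_group_def
  using spin_act_fix_iff[of _ "2 * m + 2" "cl_e 1"] cl_dom_e[of 1 "2 * m + 2"] by auto

lemma carrier_M_group: "carrier (M_group m) =
    {u \<in> carrier (Spin (2 * m + 2)). cl_mult (2 * m + 2) u (cl_e 1) = cl_mult (2 * m + 2) (cl_e 1) u \<and>
       cl_mult (2 * m + 2) u (cl_e 2) = cl_mult (2 * m + 2) (cl_e 2) u}"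
  unfolding M_group_def U_group_def
  using spin_act_fix_iff[of _ "2 * m + 2" "cl_e 1"] cl_dom_e[of 1 "2 * m + 2"]
    spin_act_fix_iff[of _ "2 * m + 2" "cl_e 2"] cl_dom_e[of 2 "2 * m + 2"] by auto

text \<open>Serves both groups: \<open>lo\<close> is the first axis that is moved, 1 for
  \<open>U\<close> and 2 for \<open>K\<close>.\<close>

locale spin_rep =
  fixes m N lo :: nat and G :: "cliff monoid" and \<pi> :: "cliff \<Rightarrow> complex^'d^'d"
  assumes rep: "unitary_rep G \<pi>" and N: "N = 2 * m + 2"
    and mult: "mult G = cl_mult N" and one: "one G = cl_one"
    and closed: "x \<in> carrier G \<Longrightarrow> y \<in> carrier G \<Longrightarrow> cl_mult N x y \<in> carrier G"
    and one_closed: "cl_one \<in> carrier G"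
    and lo: "1 \<le> lo"
    and rot_closed: "a \<in> {lo..N} \<Longrightarrow> b \<in> {lo..N} \<Longrightarrow> a \<noteq> b \<Longrightarrow> rot N a b t \<in> carrier G"
begin

lemma hom_mult: "x \<in> carrier G \<Longrightarrow> y \<in> carrier G \<Longrightarrow> \<pi> (cl_mult N x y) = \<pi> x ** \<pi> y"
  using rep by (auto simp: unitary_rep_def hom_def mult unitary_group_def)

text \<open>An idempotent unitary matrix is the identity.\<close>

lemma hom_one: "\<pi> cl_one = mat 1"
proof -
  have "conj_transpose (\<pi> cl_one) ** \<pi> cl_one = mat 1"
    using rep one_closed by (auto simp: unitary_rep_def hom_def unitary_group_def)
  moreover have "\<pi> cl_one ** \<pi> cl_one = \<pi> cl_one"
    using hom_mult[OF one_closed one_closed] by (simp add: cl_one_mult cl_dom_one)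
  ultimately show ?thesis by (metis matrix_mul_assoc matrix_mul_lid)
qed

abbreviation "R a b t \<equiv> \<pi> (rot N a b t)"

lemma continuous_rot: "continuous_on UNIV (rot K a b)"
  unfolding rot_def[abs_def]
  by (intro continuous_on_coordinatewise_then_product continuous_intros) auto

sublocale rotation_system "{lo..N}" R
proof (rule rotation_system.intro)
  fix a b assume ab: "a \<in> {lo..N}" "b \<in> {lo..N}" "a \<noteq> b"
  have NN: "a \<in> {1..N}" "b \<in> {1..N}" using ab lo by auto
  show "periodic_group (R a b)"
  proof
    have "continuous_on (carrier G) \<pi>" using rep by (simp add: unitary_rep_def)
    then have "continuous_on UNIV (\<pi> \<circ> rot N a b)"
      using rot_closed[OF ab] by (intro continuous_on_compose continuous_rot) (auto elim: continuous_on_subset)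
    then show "continuous_on UNIV (R a b)" by (simp add: o_def)
    show "R a b (s + t) = R a b s ** R a b t" for s t
      using hom_mult[OF rot_closed[OF ab] rot_closed[OF ab], of s t] NN ab by (simp add: rot_add)
  qed (simp_all add: rot_4pi hom_one)
next
  fix a b :: nat and t assume "a \<in> {lo..N}" "b \<in> {lo..N}" "a \<noteq> b"
  then show "R b a t = R a b (- t)"
    using rot_swap[of a N b t] lo by simp
next
  fix a b c d :: nat and s t assume "{a, b, c, d} \<subseteq> {lo..N}" "distinct [a, b, c, d]"
  then show "R a b s ** R c d t = R c d t ** R a b s"
    using rot_disjoint[of a b c d N s t] lo by (auto simp: hom_mult[symmetric] rot_closed)
next
  fix u v w :: nat and t assume *: "{u, v, w} \<subseteq> {lo..N}" "distinct [u, v, w]"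
  then show "R u v t ** R v w pi = R v w pi ** R u v (- t)"
    using rot_flip[of u N v w t] lo by (auto simp: hom_mult[symmetric] rot_closed)
next
  fix u v w :: nat and t \<phi> \<theta> s :: real assume *: "{u, v, w} \<subseteq> {lo..N}" "distinct [u, v, w]" and "cos \<phi> = cos \<theta> * cos t" "sin \<phi> * cos s = cos \<theta> * sin t" "sin \<phi> * sin s = sin \<theta>"
  then show "R v w s ** R u v (2 * \<phi>) ** R v w (- s) = R u v t ** R u w (2 * \<theta>) ** R u v t"
    using rot_triangle[of u N v w \<phi> \<theta> t s] * lo by (auto simp: hom_mult[symmetric] rot_closed closed)
qed

text \<open>The infinitesimal form of the eigenvector condition in \<open>is_weight\<close>, one
  generator for each coordinate plane.\<close>

definition weightvec :: "nat \<Rightarrow> weight \<Rightarrow> complex^'d \<Rightarrow> bool" where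
  "weightvec a \<mu> w \<longleftrightarrow> (\<forall>j. j \<notin> {a..m + 1} \<longrightarrow> \<mu> j = 0) \<and>
     (\<forall>j\<in>{a..m + 1}. X (2 * j - 1) (2 * j) *v w = (\<i> * of_real (\<mu> j)) *s w)"

lemma plane_rot_eq: "1 \<le> j \<Longrightarrow> j \<le> m + 1 \<Longrightarrow> plane_rot j t = rot N (2 * j - 1) (2 * j) t"
proof -
  assume j: "1 \<le> j" "j \<le> m + 1"
  have "cl_E N (2 * j - 1) (2 * j) = blade {2 * j - 1, 2 * j}"
  proof -
    have "symdiff {2 * j - 1} {2 * j} = {2 * j - 1, 2 * j}" using j by (auto simp: symdiff_def)
    moreover have "\<not> 2 * j \<le> 2 * j - 1" using j by simp
    moreover have "{2 * j - 1} \<subseteq> {1..N}" "{2 * j} \<subseteq> {1..N}"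
      using j unfolding N by (simp_all, arith)
    ultimately show ?thesis unfolding cl_E_def
      by (subst blade_mult) (auto simp: blade_sign_single)
  qed
  then show ?thesis by (simp add: plane_rot_def rot_def)
qed

lemma torus_list_closed:
  assumes "lo \<le> 2 * a - 1" "1 \<le> a" "set js \<subseteq> {a..m + 1}"
  shows "foldr (cl_mult N) (map (\<lambda>j. plane_rot j (t j)) js) cl_one \<in> carrier G"
  using assms(3)
proof (induction js)
  case (Cons j js)
  then have "rot N (2 * j - 1) (2 * j) (t j) \<in> carrier G"
    using assms(1,2) by (intro rot_closed) (auto simp: N)
  then show ?case using Cons assms(2) by (auto simp: plane_rot_eq simp del: One_nat_def intro!: closed)
qed (simp add: one_closed)

lemma torus_list_eigen:
  assumes "lo \<le> 2 * a - 1" "1 \<le> a" "set js \<subseteq> {a..m + 1}"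
    and "\<And>j. j \<in> set js \<Longrightarrow> X (2 * j - 1) (2 * j) *v w = (\<i> * of_real (\<mu> j)) *s w"
  shows "\<pi> (foldr (cl_mult N) (map (\<lambda>j. plane_rot j (t j)) js) cl_one) *v w = cis (\<Sum>j\<leftarrow>js. \<mu> j * t j) *s w"
  using assms(3,4)
proof (induction js)
  case (Cons j js)
  have mem: "2 * j - 1 \<in> {lo..N}" "2 * j \<in> {lo..N}" "2 * j - 1 \<noteq> 2 * j" "1 \<le> j" "j \<le> m + 1"
    using Cons.prems(1) assms(1,2) by (auto simp: N)
  have c: "foldr (cl_mult N) (map (\<lambda>j. plane_rot j (t j)) js) cl_one \<in> carrier G"
    using torus_list_closed[OF assms(1,2)] Cons.prems(1) by auto
  have IH: "\<pi> (foldr (cl_mult N) (map (\<lambda>j. plane_rot j (t j)) js) cl_one) *v w = cis (\<Sum>j\<leftarrow>js. \<mu> j * t j) *s w"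
    using Cons by auto
  have "exp (\<i> * of_real (\<mu> j) * of_real (t j)) = cis (\<mu> j * t j)" by (simp add: cis_conv_exp mult.assoc)
  then have "R (2 * j - 1) (2 * j) (t j) *v w = cis (\<mu> j * t j) *s w"
    using periodic_group.eigen[OF group[OF mem(1-3)], of w "\<i> * of_real (\<mu> j)" "t j"]
      Cons.prems(2)[of j] by (simp add: X_def)
  then show ?case
    using hom_mult[OF rot_closed[OF mem(1-3), of "t j"] c] IH
    by (simp add: plane_rot_eq[OF mem(4,5)] vec.scale cis_mult vector_smult_assoc add.commute
       mult.commute flip: matrix_vector_mul_assoc del: One_nat_def)
qed (simp add: hom_one)

lemma torus_elem_closed: "lo \<le> 2 * a - 1 \<Longrightarrow> 1 \<le> a \<Longrightarrow> torus_elem m a t \<in> carrier G"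
  unfolding torus_elem_def N[symmetric] by (rule torus_list_closed) auto

lemma torus_elem_eigen:
  assumes "lo \<le> 2 * a - 1" "1 \<le> a" "weightvec a \<mu> w"
  shows "\<pi> (torus_elem m a t) *v w = cis (\<Sum>j=a..m + 1. \<mu> j * t j) *s w"
proof -
  have "(\<Sum>j\<leftarrow>[a..<m + 2]. \<mu> j * t j) = (\<Sum>j=a..m + 1. \<mu> j * t j)"
  proof -
    have "set [a..<m + 2] = {a..m + 1}" by auto
    then show ?thesis using sum_list_distinct_conv_sum_set[of "[a..<m + 2]" "\<lambda>j. \<mu> j * t j"] by simp
  qed
  then show ?thesis
    unfolding torus_elem_def N[symmetric]
    using torus_list_eigen[OF assms(1,2), of "[a..<m + 2]" w \<mu> t] assms(3)
    by (simp add: weightvec_def atLeastLessThanSuc_atLeastAtMost del: upt_Suc)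
qed

lemma weightvec_is_weight:
  assumes "lo \<le> 2 * a - 1" "1 \<le> a" "weightvec a \<mu> w" "w \<in> W" "w \<noteq> 0"
  shows "is_weight m a \<pi> W \<mu>"
  using torus_elem_eigen[OF assms(1-3)] assms(3-5) by (auto simp: is_weight_def weightvec_def)

text \<open>The generators of the coordinate planes commute and are diagonalizable. Periodicity
  makes their eigenvalues imaginary, so the eigenvalues on a common eigenvector form a real weight,
  extended by zero.\<close>

lemma weightvec_span:
  assumes "lo \<le> 2 * a - 1" "1 \<le> a" "vec.subspace W"
    and inv: "\<And>j w. j \<in> {a..m + 1} \<Longrightarrow> w \<in> W \<Longrightarrow> X (2 * j - 1) (2 * j) *v w \<in> W"
  shows "W \<subseteq> vec.span {w\<in>W. \<exists>\<mu>. weightvec a \<mu> w}"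
proof -
  define As where "As = map (\<lambda>j. X (2 * j - 1) (2 * j)) [a..<m + 2]"
  have mem: "2 * j - 1 \<in> {lo..N}" "2 * j \<in> {lo..N}" "2 * j - 1 \<noteq> 2 * j" "1 \<le> j" if "j \<in> {a..m + 1}" for j
    using that assms(1,2) by (auto simp: N)
  have As: "A \<in> set As \<longleftrightarrow> (\<exists>j\<in>{a..m + 1}. A = X (2 * j - 1) (2 * j))" for A
    by (auto simp: As_def)
  have "W \<subseteq> vec.span {w\<in>W. \<forall>A\<in>set As. \<exists>s. A *v w = s *s w}"
  proof (rule common_eigenvectors_span[OF assms(3)])
    show "semisimple A" if "A \<in> set As" for A
      using that mem periodic_group.semisimple_gen[OF group] unfolding As X_def by blast
    show "A ** B = B ** A" if AB: "A \<in> set As" "B \<in> set As" for A B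
    proof -
      from AB obtain i k where i: "i \<in> {a..m + 1}" "A = X (2 * i - 1) (2 * i)"
        and k: "k \<in> {a..m + 1}" "B = X (2 * k - 1) (2 * k)" unfolding As by blast
      show ?thesis
      proof (cases "i = k")
        case False
        have "distinct [2 * i - 1, 2 * i, 2 * k - 1, 2 * k]"
          using False mem(4)[OF i(1)] mem(4)[OF k(1)] by (simp, presburger)
        then show ?thesis unfolding i k using mem[OF i(1)] mem[OF k(1)] by (intro disjoint_XX) auto
      qed (simp add: i k)
    qed
  qed (use inv in \<open>auto simp: As\<close>)
  also have "\<dots> \<subseteq> vec.span {w\<in>W. \<exists>\<mu>. weightvec a \<mu> w}"
  proof (intro vec.span_mono subsetI)
    fix w assume w: "w \<in> {w\<in>W. \<forall>A\<in>set As. \<exists>s. A *v w = s *s w}"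
    have "\<exists>x::real. X (2 * j - 1) (2 * j) *v w = (\<i> * of_real x) *s w" if j: "j \<in> {a..m + 1}" for j
    proof (cases "w = 0")
      case False
      have "X (2 * j - 1) (2 * j) \<in> set As" unfolding As using j by blast
      then obtain s where s: "X (2 * j - 1) (2 * j) *v w = s *s w" using w by auto
      obtain k :: int where "s = \<i> * of_real (of_int k / 2)"
        by (rule periodic_group.eigenvalue_half_integer[OF group[OF mem(1-3)[OF j]] s[unfolded X_def] False])
      then show ?thesis using s by blast
    qed simp
    then have "\<forall>j\<in>{a..m + 1}. \<exists>x::real. X (2 * j - 1) (2 * j) *v w = (\<i> * of_real x) *s w" by blast
    from bchoice[OF this] obtain f :: "nat \<Rightarrow> real" where
      f: "\<And>j. j \<in> {a..m + 1} \<Longrightarrow> X (2 * j - 1) (2 * j) *v w = (\<i> * of_real (f j)) *s w" by blast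
    have "weightvec a (\<lambda>j. if j \<in> {a..m + 1} then f j else 0) w"
      using f by (auto simp: weightvec_def)
    then show "w \<in> {w\<in>W. \<exists>\<mu>. weightvec a \<mu> w}" using w by blast
  qed
  finally show ?thesis .
qed

end

section \<open>Positive roots and dominance\<close>

lemma finite_pos_roots_D: "finite (pos_roots_D a b)"
proof -
  have fin: "finite {(i, j). a \<le> i \<and> i < j \<and> j \<le> b}"
    by (rule finite_subset[of _ "{..b} \<times> {..b}"]) auto
  have "finite {f i j :: weight | i j. a \<le> i \<and> i < j \<and> j \<le> b}" for f
    using finite_imageI[OF fin, of "\<lambda>(i, j). f i j"] by (rule finite_subset[rotated]) auto
  then show ?thesis unfolding pos_roots_D_def by simp
qed

lemma pos_roots_D_iff: "\<alpha> \<in> pos_roots_D a b \<longleftrightarrow>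
   (\<exists>i j. a \<le> i \<and> i < j \<and> j \<le> b \<and> (\<alpha> = (\<lambda>r. eps i r - eps j r) \<or> \<alpha> = (\<lambda>r. eps i r + eps j r)))"
  unfolding pos_roots_D_def Un_iff mem_Collect_eq
  by (simp only: conj_disj_distribL ex_disj_distrib conj_ac)

lemma pos_roots_D_cases:
  assumes "\<alpha> \<in> pos_roots_D a b"
  obtains i j where "a \<le> i" "i < j" "j \<le> b" "\<alpha> = (\<lambda>r. eps i r - eps j r) \<or> \<alpha> = (\<lambda>r. eps i r + eps j r)"
  using assms unfolding pos_roots_D_iff by (elim exE conjE) (rule that)

lemma pos_roots_D_first: "\<alpha> \<in> pos_roots_D a b \<Longrightarrow> 0 \<le> \<alpha> a"
  by (erule pos_roots_D_cases) (auto simp: eps_def)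

lemma pos_roots_B_first: "\<alpha> \<in> pos_roots_B a b \<Longrightarrow> 0 \<le> \<alpha> a"
  by (auto simp: pos_roots_B_def eps_def dest: pos_roots_D_first)

lemma pos_roots_D_int: "\<alpha> \<in> pos_roots_D a b \<Longrightarrow> \<alpha> r \<in> \<int>"
  by (erule pos_roots_D_cases) (auto simp: eps_def)

lemma pos_roots_B_int: "\<alpha> \<in> pos_roots_B a b \<Longrightarrow> \<alpha> r \<in> \<int>"
  by (auto simp: pos_roots_B_def eps_def dest: pos_roots_D_int)

text \<open>The coordinates of a root sum to 0 or 2. Hence all weights dominated by
  \<open>Lambda\<close> have coordinate sums congruent modulo 2, and the product of the rotations by
  \<open>pi\<close> has one eigenvalue on all of them.\<close>

lemma pos_roots_D_even:
  assumes "\<alpha> \<in> pos_roots_D a b"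
  shows "\<exists>k::int. (\<Sum>r=a..b. \<alpha> r) = 2 * of_int k"
proof -
  have s: "(\<Sum>r=a..b. eps i r) = 1" if "a \<le> i" "i \<le> b" for i
    using that by (simp add: eps_def)
  obtain i j where ij: "a \<le> i" "i < j" "j \<le> b" "\<alpha> = (\<lambda>r. eps i r - eps j r) \<or> \<alpha> = (\<lambda>r. eps i r + eps j r)"
    using assms by (rule pos_roots_D_cases)
  then have "(\<Sum>r=a..b. \<alpha> r) = 2 * of_int 0 \<or> (\<Sum>r=a..b. \<alpha> r) = 2 * of_int 1"
    by (auto simp: sum_subtractf sum.distrib s)
  then show ?thesis by blast
qed

lemma dominated_le: "dominated R \<mu> \<Lambda> \<Longrightarrow> (\<And>\<alpha>. \<alpha> \<in> R \<Longrightarrow> 0 \<le> \<alpha> r) \<Longrightarrow> \<mu> r \<le> \<Lambda> r"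
proof -
  assume dom: "dominated R \<mu> \<Lambda>" and pos: "\<And>\<alpha>. \<alpha> \<in> R \<Longrightarrow> 0 \<le> \<alpha> r"
  obtain c :: "weight \<Rightarrow> nat" where "\<forall>r. \<Lambda> r - \<mu> r = (\<Sum>\<alpha>\<in>R. real (c \<alpha>) * \<alpha> r)"
    using dom[unfolded dominated_def] ..
  note c = this[rule_format]
  have "\<Lambda> r - \<mu> r = (\<Sum>\<alpha>\<in>R. real (c \<alpha>) * \<alpha> r)" by (rule c)
  also have "\<dots> \<ge> 0" using pos by (intro sum_nonneg mult_nonneg_nonneg) auto
  finally show ?thesis by simp
qed

lemma dominated_int: "dominated R \<mu> \<Lambda> \<Longrightarrow> (\<And>\<alpha>. \<alpha> \<in> R \<Longrightarrow> \<alpha> r \<in> \<int>) \<Longrightarrow> \<Lambda> r - \<mu> r \<in> \<int>"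
proof -
  assume dom: "dominated R \<mu> \<Lambda>" and int: "\<And>\<alpha>. \<alpha> \<in> R \<Longrightarrow> \<alpha> r \<in> \<int>"
  obtain c :: "weight \<Rightarrow> nat" where "\<forall>r. \<Lambda> r - \<mu> r = (\<Sum>\<alpha>\<in>R. real (c \<alpha>) * \<alpha> r)"
    using dom[unfolded dominated_def] ..
  note c = this[rule_format]
  show ?thesis unfolding c using int by (intro Ints_sum Ints_mult) auto
qed

lemma dominated_D_even:
  assumes "dominated (pos_roots_D a b) \<mu> \<Lambda>"
  shows "\<exists>k::int. (\<Sum>r=a..b. \<Lambda> r) - (\<Sum>r=a..b. \<mu> r) = 2 * of_int k"
proof -
  obtain c :: "weight \<Rightarrow> nat" where "\<forall>r. \<Lambda> r - \<mu> r = (\<Sum>\<alpha>\<in>pos_roots_D a b. real (c \<alpha>) * \<alpha> r)"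
    using assms[unfolded dominated_def] ..
  note c = this[rule_format]
  have "\<forall>\<alpha>\<in>pos_roots_D a b. \<exists>k::int. (\<Sum>r=a..b. \<alpha> r) = 2 * of_int k" using pos_roots_D_even by blast
  from bchoice[OF this] obtain k :: "weight \<Rightarrow> int" where
    k: "\<And>\<alpha>. \<alpha> \<in> pos_roots_D a b \<Longrightarrow> (\<Sum>r=a..b. \<alpha> r) = 2 * of_int (k \<alpha>)" by blast
  have "(\<Sum>r=a..b. \<Lambda> r) - (\<Sum>r=a..b. \<mu> r) = (\<Sum>r=a..b. \<Sum>\<alpha>\<in>pos_roots_D a b. real (c \<alpha>) * \<alpha> r)"
    by (simp add: c flip: sum_subtractf)
  also have "\<dots> = (\<Sum>\<alpha>\<in>pos_roots_D a b. \<Sum>r=a..b. real (c \<alpha>) * \<alpha> r)"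
    by (rule sum.swap)
  also have "\<dots> = (\<Sum>\<alpha>\<in>pos_roots_D a b. real (c \<alpha>) * (2 * of_int (k \<alpha>)))"
    by (intro sum.cong refl) (simp add: k flip: sum_distrib_left)
  also have "\<dots> = 2 * of_int (\<Sum>\<alpha>\<in>pos_roots_D a b. int (c \<alpha>) * k \<alpha>)"
    by (simp add: sum_distrib_left mult_ac)
  finally show ?thesis by blast
qed

text \<open>Every root has a nonnegative coordinate at \<open>a\<close>, and it is zero only if the
  index \<open>a\<close> does not occur. Equality at \<open>a\<close> therefore excludes all roots
  outside the smaller system.\<close>

lemma dominated_D_descend:
  assumes "dominated (pos_roots_D a b) \<mu> \<Lambda>" "\<mu> a = \<Lambda> a"
  shows "dominated (pos_roots_D (a + 1) b) \<mu> \<Lambda>"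
proof -
  obtain c :: "weight \<Rightarrow> nat" where "\<forall>r. \<Lambda> r - \<mu> r = (\<Sum>\<alpha>\<in>pos_roots_D a b. real (c \<alpha>) * \<alpha> r)"
    using assms(1)[unfolded dominated_def] ..
  note c = this[rule_format]
  have "(\<Sum>\<alpha>\<in>pos_roots_D a b. real (c \<alpha>) * \<alpha> a) = 0" using c[of a] assms(2) by simp
  then have z: "real (c \<alpha>) * \<alpha> a = 0" if "\<alpha> \<in> pos_roots_D a b" for \<alpha>
    using that pos_roots_D_first[of _ a b]
    by (subst (asm) sum_nonneg_eq_0_iff[OF finite_pos_roots_D]) auto
  have sub: "pos_roots_D (a + 1) b \<subseteq> pos_roots_D a b"
    by (rule subsetI) (unfold pos_roots_D_iff, elim exE conjE, intro exI conjI, auto)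
  have rest: "\<alpha> \<in> pos_roots_D (a + 1) b" if al: "\<alpha> \<in> pos_roots_D a b" "\<alpha> a = 0" for \<alpha>
  proof -
    obtain i j where ij: "a \<le> i" "i < j" "j \<le> b" "\<alpha> = (\<lambda>r. eps i r - eps j r) \<or> \<alpha> = (\<lambda>r. eps i r + eps j r)"
      using al(1) by (rule pos_roots_D_cases)
    then have "i \<noteq> a" using al(2) by (auto simp: eps_def)
    then have "a + 1 \<le> i" using ij by simp
    with ij(2-4) have "a + 1 \<le> i \<and> i < j \<and> j \<le> b \<and>
        (\<alpha> = (\<lambda>r. eps i r - eps j r) \<or> \<alpha> = (\<lambda>r. eps i r + eps j r))" by (intro conjI)
    then show ?thesis unfolding pos_roots_D_iff by (rule_tac x = i in exI, rule_tac x = j in exI)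
  qed
  have "\<Lambda> r - \<mu> r = (\<Sum>\<alpha>\<in>pos_roots_D (a + 1) b. real (c \<alpha>) * \<alpha> r)" for r
  proof -
    have "real (c \<alpha>) * \<alpha> r = 0" if "\<alpha> \<in> pos_roots_D a b - pos_roots_D (a + 1) b" for \<alpha>
      using that z[of \<alpha>] rest[of \<alpha>] by (cases "c \<alpha> = 0") auto
    then have "(\<Sum>\<alpha>\<in>pos_roots_D a b. real (c \<alpha>) * \<alpha> r) = (\<Sum>\<alpha>\<in>pos_roots_D (a + 1) b. real (c \<alpha>) * \<alpha> r)"
      by (intro sum.mono_neutral_right finite_pos_roots_D sub ballI)
    then show ?thesis using c[of r] by simp
  qed
  then show ?thesis unfolding dominated_def by (rule_tac x = c in exI, rule allI)
qed

lemma Ints_half_cases: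
  fixes x :: real
  assumes "x \<le> 1/2" "- x \<le> 1/2" "1/2 - x \<in> \<int>"
  shows "x = 1/2 \<or> x = -1/2"
proof -
  obtain k :: int where k: "1/2 - x = of_int k" using assms(3) by (auto elim: Ints_cases)
  then have "0 \<le> real_of_int k" "real_of_int k \<le> 1" using assms(1,2) by linarith+
  then have "k = 0 \<or> k = 1" by linarith
  then show ?thesis using k by auto
qed

context spin_rep
begin

text \<open>The eigenspace of one generator is stable under the others, so it contains a weight
  vector. Thus bounds on weights become bounds on the spectrum of a single generator.\<close>

lemma eigenvector_weight:
  assumes "lo \<le> 2 * a - 1" "1 \<le> a" "vec.subspace W"
    and inv: "\<And>j w. j \<in> {a..m + 1} \<Longrightarrow> w \<in> W \<Longrightarrow> X (2 * j - 1) (2 * j) *v w \<in> W"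
    and i: "i \<in> {a..m + 1}" and v: "v \<in> W" "v \<noteq> 0" "X (2 * i - 1) (2 * i) *v v = (\<i> * of_real \<nu>) *s v"
  shows "\<exists>w\<in>W. \<exists>\<mu>. w \<noteq> 0 \<and> weightvec a \<mu> w \<and> \<mu> i = \<nu>"
proof -
  define W' where "W' = {w\<in>W. X (2 * i - 1) (2 * i) *v w = (\<i> * of_real \<nu>) *s w}"
  have mem: "2 * j - 1 \<in> {lo..N}" "2 * j \<in> {lo..N}" "2 * j - 1 \<noteq> 2 * j" "1 \<le> j" if "j \<in> {a..m + 1}" for j
    using that assms(1,2) by (auto simp: N)
  have sub: "vec.subspace W'"
    using assms(3) unfolding W'_def vec.subspace_def
    by (auto simp: vec.add vec.scale vector_add_ldistrib mult.commute)
  have "X (2 * j - 1) (2 * j) *v w \<in> W'" if j: "j \<in> {a..m + 1}" and w: "w \<in> W'" for j w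
  proof -
    have "X (2 * j - 1) (2 * j) ** X (2 * i - 1) (2 * i) = X (2 * i - 1) (2 * i) ** X (2 * j - 1) (2 * j)"
    proof (cases "i = j")
      case False
      have "distinct [2 * j - 1, 2 * j, 2 * i - 1, 2 * i]"
        using False mem(4)[OF i(1)] mem(4)[OF j(1)] by (simp, presburger)
      then show ?thesis using mem[OF i(1)] mem[OF j(1)] by (intro disjoint_XX) auto
    qed simp
    then have "X (2 * i - 1) (2 * i) *v (X (2 * j - 1) (2 * j) *v w) = X (2 * j - 1) (2 * j) *v (X (2 * i - 1) (2 * i) *v w)"
      by (simp only: matrix_vector_mul_assoc)
    then show ?thesis using w inv[OF j] unfolding W'_def by (simp add: vec.scale)
  qed
  then have span: "W' \<subseteq> vec.span {w\<in>W'. \<exists>\<mu>. weightvec a \<mu> w}"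
    using weightvec_span[OF assms(1,2) sub] by blast
  have "\<exists>w\<in>W'. w \<noteq> 0 \<and> (\<exists>\<mu>. weightvec a \<mu> w)"
  proof (rule ccontr)
    assume "\<not> ?thesis"
    then have "{w\<in>W'. \<exists>\<mu>. weightvec a \<mu> w} \<subseteq> {0}" by blast
    then have "vec.span {w\<in>W'. \<exists>\<mu>. weightvec a \<mu> w} \<subseteq> vec.span {0}" by (rule vec.span_mono)
    then show False using span v unfolding W'_def by (auto simp: vec.span_insert_0)
  qed
  then obtain w \<mu> where w: "w \<in> W'" "w \<noteq> 0" "weightvec a \<mu> w" by blast
  have "(\<i> * of_real (\<mu> i)) *s w = (\<i> * of_real \<nu>) *s w"
    using w i unfolding W'_def weightvec_def by auto
  then have "\<mu> i = \<nu>" using w(2) by simp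
  then show ?thesis using w unfolding W'_def by blast
qed

lemma square_of_eigenvalues:
  assumes "a \<in> {lo..N}" "b \<in> {lo..N}" "a \<noteq> b" "vec.subspace W" "\<And>w. w \<in> W \<Longrightarrow> X a b *v w \<in> W"
    and ev: "\<And>v \<nu>. v \<in> W \<Longrightarrow> v \<noteq> 0 \<Longrightarrow> X a b *v v = (\<i> * of_real \<nu>) *s v \<Longrightarrow> \<nu> = 1/2 \<or> \<nu> = -1/2"
    and v: "v \<in> W"
  shows "X a b *v (X a b *v v) = (-1/4) *s v"
proof -
  have "(X a b ** X a b) *v v = mat (-1/4) *v v"
  proof (rule matrix_eq_on_span)
    show "v \<in> vec.span {w \<in> W. \<exists>s. X a b *v w = s *s w}"
      by (rule semisimple_span[OF assms(4,5) _ v])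
        (use periodic_group.semisimple_gen[OF group[OF assms(1-3)]] in \<open>auto simp: X_def\<close>)
    fix w assume "w \<in> {w \<in> W. \<exists>s. X a b *v w = s *s w}"
    then obtain s where w: "w \<in> W" "X a b *v w = s *s w" by blast
    show "(X a b ** X a b) *v w = mat (-1/4) *v w"
    proof (cases "w = 0")
      case False
      obtain k :: int where k: "s = \<i> * of_real (of_int k / 2)"
        by (rule periodic_group.eigenvalue_half_integer[OF group[OF assms(1-3)] w(2)[unfolded X_def] False])
      have "of_int k / 2 = (1/2::real) \<or> of_int k / 2 = (-1/2::real)"
        using ev[OF w(1) False w(2)[unfolded k]] by blast
      then have "real_of_int k = real_of_int 1 \<or> real_of_int k = real_of_int (-1)" by auto
      then have "k = 1 \<or> k = -1" unfolding of_int_eq_iff .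
      then have "s * s = -1/4" by (auto simp: k)
      then show ?thesis using w(2) by (simp add: mat_vector vec.scale flip: matrix_vector_mul_assoc)
    qed simp
  qed
  then show ?thesis by (simp add: mat_vector flip: matrix_vector_mul_assoc)
qed

end

section \<open>The spin representation of \<open>K\<close>\<close>

lemma spin_rep_U: "unitary_rep (U_group m) \<pi> \<Longrightarrow> spin_rep m (2 * m + 2) 1 (U_group m) \<pi>"
proof (rule spin_rep.intro)
  interpret Group.monoid "Spin (2 * m + 2)" by (rule Spin_monoid)
  show "cl_mult (2 * m + 2) x y \<in> carrier (U_group m)" if "x \<in> carrier (U_group m)" "y \<in> carrier (U_group m)" for x y
    using m_closed that by (simp add: U_group_def Spin_mult)
  show "cl_one \<in> carrier (U_group m)" using one_closed by (simp add: U_group_def Spin_one)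
  show "rot (2 * m + 2) a b t \<in> carrier (U_group m)"
    if "a \<in> {1..2 * m + 2}" "b \<in> {1..2 * m + 2}" "a \<noteq> b" for a b t
    using rot_in_Spin[OF that] by (simp add: U_group_def)
qed (simp_all add: U_group_def Spin_mult Spin_one)

lemma spin_rep_K: "unitary_rep (K_group m) \<tau> \<Longrightarrow> spin_rep m (2 * m + 2) 2 (K_group m) \<tau>"
proof (rule spin_rep.intro)
  interpret Group.monoid "Spin (2 * m + 2)" by (rule Spin_monoid)
  show "cl_mult (2 * m + 2) x y \<in> carrier (K_group m)" if "x \<in> carrier (K_group m)" "y \<in> carrier (K_group m)" for x y
  proof -
    have "x \<in> carrier (Spin (2 * m + 2))" "y \<in> carrier (Spin (2 * m + 2))"
      and c: "cl_mult (2 * m + 2) x (cl_e 1) = cl_mult (2 * m + 2) (cl_e 1) x"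
        "cl_mult (2 * m + 2) y (cl_e 1) = cl_mult (2 * m + 2) (cl_e 1) y"
      using that unfolding carrier_K_group by auto
    then have "cl_mult (2 * m + 2) x y \<in> carrier (Spin (2 * m + 2))" using m_closed by (simp add: Spin_mult)
    moreover have "cl_mult (2 * m + 2) (cl_mult (2 * m + 2) x y) (cl_e 1) = cl_mult (2 * m + 2) (cl_e 1) (cl_mult (2 * m + 2) x y)"
      using c by (metis cl_mult_assoc)
    ultimately show ?thesis unfolding carrier_K_group by simp
  qed
  have "cl_dom (2 * m + 2) (cl_e 1)" by (rule cl_dom_e) simp
  then show "cl_one \<in> carrier (K_group m)"
    using one_closed unfolding carrier_K_group by (simp add: Spin_one cl_one_mult cl_mult_one)
  show "rot (2 * m + 2) a b t \<in> carrier (K_group m)"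
    if "a \<in> {2..2 * m + 2}" "b \<in> {2..2 * m + 2}" "a \<noteq> b" for a b t
    using rot_in_Spin[of a "2 * m + 2" b t] rot_e_commute[of a b 1 "2 * m + 2" t] that
    unfolding carrier_K_group by auto
qed (simp_all add: K_group_def U_group_def Spin_mult Spin_one)

lemma rot_in_M:
  assumes "a \<in> {3..2 * m + 2}" "b \<in> {3..2 * m + 2}" "a \<noteq> b"
  shows "rot (2 * m + 2) a b t \<in> carrier (M_group m)"
  using rot_in_Spin[of a "2 * m + 2" b t] rot_e_commute[of a b 1 "2 * m + 2" t]
    rot_e_commute[of a b 2 "2 * m + 2" t] assms
  unfolding carrier_M_group by auto

lemma cis_pi_even: "x - y = 2 * of_int k \<Longrightarrow> cis (pi * x) = cis (pi * y)"
proof -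
  assume "x - y = 2 * of_int k"
  then have "pi * x = pi * y + 2 * pi * of_int k" by (simp add: algebra_simps)
  then show ?thesis by (simp flip: cis_mult)
qed

locale tau_rep = spin_rep m N 2 "K_group m" \<tau> for m N and \<tau> :: "cliff \<Rightarrow> complex^'t^'t" +
  assumes m: "m \<ge> 1" and irrep: "K_irrep m (tau_weight m) \<tau>"
begin

lemma tau_weight_bound:
  assumes "v \<noteq> 0" "X 3 4 *v v = (\<i> * of_real \<nu>) *s v"
  shows "\<nu> \<le> 1/2 \<and> 1/2 - \<nu> \<in> \<int>"
proof -
  have "\<exists>w\<in>UNIV. \<exists>\<mu>. w \<noteq> 0 \<and> weightvec 2 \<mu> w \<and> \<mu> 2 = \<nu>"
    using assms m by (intro eigenvector_weight[of 2 UNIV 2 v]) (auto simp: vec.subspace_UNIV)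
  then obtain w \<mu> where w: "w \<noteq> 0" "weightvec 2 \<mu> w" "\<mu> 2 = \<nu>" by blast
  have "is_weight m 2 \<tau> UNIV \<mu>"
    using weightvec_is_weight[of 2 \<mu> w UNIV] w by simp
  then have dom: "dominated (pos_roots_B 2 (m + 1)) \<mu> (tau_weight m)"
    using irrep unfolding K_irrep_def has_highest_weight_def by blast
  have tw: "tau_weight m 2 = 1/2" using m by (simp add: tau_weight_def eps_def)
  have le: "\<mu> 2 \<le> tau_weight m 2" by (rule dominated_le[OF dom]) (rule pos_roots_B_first)
  have "tau_weight m 2 - \<mu> 2 \<in> \<int>" by (rule dominated_int[OF dom]) (rule pos_roots_B_int)
  then show ?thesis using le unfolding tw w(3) by blast
qed

text \<open>The rotation by \<open>pi\<close> in the plane of \<open>e_3\<close>, \<open>e_2\<close>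
  negates \<open>X 3 4\<close>, so with \<open>nu\<close> also \<open>- nu\<close> is an eigenvalue.
  Both are at most \<open>1/2\<close> and congruent to it modulo 1, which leaves \<open>1/2\<close>
  and \<open>-1/2\<close>.\<close>

lemma tau_square:
  assumes "a \<in> {2..N}" "b \<in> {2..N}" "a \<noteq> b"
  shows "X a b *v (X a b *v v) = (-1/4) *s v"
proof (rule squares_all[where W=UNIV and J="{2..N}" and p=3 and q=4])
  have N4: "4 \<le> N" using m N by simp
  then have mem: "3 \<in> {2..N}" "4 \<in> {2..N}" "(3::nat) \<noteq> 4" by auto
  show "3 \<in> {2..N}" "4 \<in> {2..N}" "(3::nat) \<noteq> 4" by (rule mem)+
  show "X 3 4 *v (X 3 4 *v x) = (-1/4) *s x" for x
  proof (rule square_of_eigenvalues[where W=UNIV])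
    fix v \<nu> assume v: "v \<noteq> 0" "X 3 4 *v v = (\<i> * of_real \<nu>) *s v"
    let ?g = "R 3 2 pi"
    have "X 4 3 ** ?g = - (?g ** X 4 3)" by (rule flip_X) (use N4 in auto)
    moreover have "X 4 3 = - X 3 4" using N4 by (intro X_swap) auto
    ultimately have "- (X 3 4 ** ?g) = ?g ** X 3 4" by (simp add: mm_simps)
    then have "X 3 4 ** ?g = - (?g ** X 3 4)" by (metis minus_minus)
    then have "X 3 4 *v (?g *v v) = - (?g *v (X 3 4 *v v))"
      by (simp only: matrix_vector_mul_assoc mv.minus_left)
    then have 1: "X 3 4 *v (?g *v v) = (\<i> * of_real (- \<nu>)) *s (?g *v v)"
      by (simp add: v(2) vec.scale)
    have "R 3 2 (- pi) *v (?g *v v) = v"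
      using inverse'[of 3 2 pi] N4 by (simp add: matrix_vector_mul_assoc)
    then have 2: "?g *v v \<noteq> 0" using v(1) by auto
    show "\<nu> = 1/2 \<or> \<nu> = -1/2"
      using tau_weight_bound[OF v] tau_weight_bound[OF 2 1] by (intro Ints_half_cases) auto
  qed (rule mem vec.subspace_UNIV UNIV_I)+
qed (rule subset_refl UNIV_I assms)+

lemma tau_rot_pi:
  assumes "a \<in> {2..N}" "b \<in> {2..N}" "a \<noteq> b"
  shows "R a b pi = 2 *\<^sub>R X a b" "R a b (2 * pi) = - mat 1"
proof -
  interpret P: periodic_group "R a b" by (rule group[OF assms])
  have sq: "P.gen *v (P.gen *v v) = (-1/4) *s v" for v
    using tau_square[OF assms, of v] unfolding X_def .
  show "R a b pi = 2 *\<^sub>R X a b" using P.gen_eq_of_gen_square[OF sq] unfolding X_def .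
  show "R a b (2 * pi) = - mat 1" using P.eq_of_gen_square[OF sq, of "2 * pi"] by simp
qed

text \<open>The product of the rotations by \<open>pi\<close> in the planes \<open>2, ..., m + 1\<close> is the volume element of the
  Clifford algebra of \<open>e\<^sub>3, ..., e\<^sub>N\<close>; it is central in \<open>M\<close> and separates the two half-spin
  constituents.\<close>

lemma torus_pi_constituent:
  assumes W: "M_constituent m \<Lambda> \<tau> W" and w: "w \<in> W"
  shows "\<tau> (torus_elem m 2 (\<lambda>_. pi)) *v w = cis (pi * (\<Sum>r=2..m + 1. \<Lambda> r)) *s w"
proof -
  have sub: "vec.subspace W" and inv: "\<And>g w. g \<in> carrier (M_group m) \<Longrightarrow> w \<in> W \<Longrightarrow> \<tau> g *v w \<in> W"
    using W unfolding M_constituent_def irreducible_on_def invariant_subspace_def by auto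
  have "X (2 * j - 1) (2 * j) *v w \<in> W" if "j \<in> {2..m + 1}" "w \<in> W" for j w
  proof -
    have j: "2 * j - 1 \<in> {3..2 * m + 2}" "2 * j \<in> {3..2 * m + 2}" "2 * j - 1 \<noteq> 2 * j" using that by auto
    \<comment> \<open>Invariance under \<open>M\<close> concerns group elements; the generator is
      reached as half the rotation by \<open>pi\<close>.\<close>
    then have "R (2 * j - 1) (2 * j) pi *v w \<in> W"
      using inv rot_in_M[of "2 * j - 1" m "2 * j" pi] that unfolding N by blast
    moreover have "R (2 * j - 1) (2 * j) pi = 2 *\<^sub>R X (2 * j - 1) (2 * j)"
      using j N by (intro tau_rot_pi) auto
    ultimately have "2 *\<^sub>R (X (2 * j - 1) (2 * j) *v w) \<in> W" by (simp add: mv.scaleR_left)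
    then have "(1/2) *s (2 *\<^sub>R (X (2 * j - 1) (2 * j) *v w)) \<in> W" by (rule vec.subspace_scale[OF sub])
    then show ?thesis by (simp add: scaleR_eq_smult vector_smult_assoc)
  qed
  then have span: "W \<subseteq> vec.span {w\<in>W. \<exists>\<mu>. weightvec 2 \<mu> w}"
    using weightvec_span[of 2 W] sub by simp
  have "\<tau> (torus_elem m 2 (\<lambda>_. pi)) *v w = mat (cis (pi * (\<Sum>r=2..m + 1. \<Lambda> r))) *v w"
  proof (rule matrix_eq_on_span)
    show "w \<in> vec.span {w\<in>W. \<exists>\<mu>. weightvec 2 \<mu> w}" using span w by blast
    fix x assume "x \<in> {w\<in>W. \<exists>\<mu>. weightvec 2 \<mu> w}"
    then obtain \<mu> where x: "x \<in> W" "weightvec 2 \<mu> x" by blast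
    show "\<tau> (torus_elem m 2 (\<lambda>_. pi)) *v x = mat (cis (pi * (\<Sum>r=2..m + 1. \<Lambda> r))) *v x"
    proof (cases "x = 0")
      case False
      then have "is_weight m 2 \<tau> W \<mu>" using weightvec_is_weight[of 2 \<mu> x W] x by simp
      then have "dominated (pos_roots_D 2 (m + 1)) \<mu> \<Lambda>"
        using W unfolding M_constituent_def has_highest_weight_def by blast
      then obtain k :: int where "(\<Sum>r=2..m + 1. \<Lambda> r) - (\<Sum>r=2..m + 1. \<mu> r) = 2 * of_int k"
        using dominated_D_even by blast
      then have "cis (pi * (\<Sum>r=2..m + 1. \<Lambda> r)) = cis (pi * (\<Sum>r=2..m + 1. \<mu> r))" by (rule cis_pi_even)
      moreover have "(\<Sum>j=2..m + 1. \<mu> j * pi) = pi * (\<Sum>r=2..m + 1. \<mu> r)"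
        by (simp only: sum_distrib_left mult.commute)
      ultimately show ?thesis using torus_elem_eigen[of 2 \<mu> x "\<lambda>_. pi"] x(2)
        by (simp add: mat_vector del: sum.cl_ivl_Suc)
    qed simp
  qed
  then show ?thesis by (simp add: mat_vector)
qed

lemma torus_rest_commute:
  assumes "set js \<subseteq> {3..m + 1}"
  shows "\<tau> (foldr (cl_mult N) (map (\<lambda>j. plane_rot j (t j)) js) cl_one) ** R 3 2 s =
    R 3 2 s ** \<tau> (foldr (cl_mult N) (map (\<lambda>j. plane_rot j (t j)) js) cl_one)"
  using assms
proof (induction js)
  case (Cons j js)
  let ?T = "\<tau> (foldr (cl_mult N) (map (\<lambda>j. plane_rot j (t j)) js) cl_one)"
  have j: "2 * j - 1 \<in> {2..N}" "2 * j \<in> {2..N}" "2 * j - 1 \<noteq> 2 * j" "1 \<le> j" "j \<le> m + 1" "2 * j - 1 > 3"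
    using Cons.prems by (auto simp: N)
  have "foldr (cl_mult N) (map (\<lambda>j. plane_rot j (t j)) js) cl_one \<in> carrier (K_group m)"
    using Cons.prems by (intro torus_list_closed[of 3]) auto
  then have eq: "\<tau> (foldr (cl_mult N) (map (\<lambda>j. plane_rot j (t j)) (j # js)) cl_one) = R (2 * j - 1) (2 * j) (t j) ** ?T"
    using hom_mult[OF rot_closed[OF j(1-3), of "t j"]] by (simp add: plane_rot_eq[OF j(4,5)] del: One_nat_def)
  have comm: "R (2 * j - 1) (2 * j) (t j) ** R 3 2 s = R 3 2 s ** R (2 * j - 1) (2 * j) (t j)"
    using j by (intro disjoint) auto
  have IH: "?T ** R 3 2 s = R 3 2 s ** ?T" using Cons by auto
  have "R (2 * j - 1) (2 * j) (t j) ** ?T ** R 3 2 s = R (2 * j - 1) (2 * j) (t j) ** R 3 2 s ** ?T"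
    unfolding matrix_mul_assoc[symmetric] IH ..
  also have "\<dots> = R 3 2 s ** (R (2 * j - 1) (2 * j) (t j) ** ?T)"
    unfolding comm matrix_mul_assoc ..
  finally show ?case unfolding eq .
qed (simp add: hom_one)

text \<open>Only the factor in the plane of \<open>e_3\<close>, \<open>e_4\<close> is affected: its
  angle \<open>pi\<close> becomes \<open>- pi\<close>, and the two differ by a full turn, which acts
  as \<open>-1\<close>. So \<open>R 3 2 pi\<close> exchanges the eigenspaces for opposite
  eigenvalues.\<close>

lemma torus_pi_swap: "\<tau> (torus_elem m 2 (\<lambda>_. pi)) ** R 3 2 pi = - (R 3 2 pi ** \<tau> (torus_elem m 2 (\<lambda>_. pi)))"
proof -
  let ?T = "\<tau> (foldr (cl_mult N) (map (\<lambda>j. plane_rot j pi) [3..<m + 2]) cl_one)" and ?g = "R 3 2 pi"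
  have N4: "4 \<le> N" using m N by simp
  then have mem: "3 \<in> {2..N}" "4 \<in> {2..N}" "(3::nat) \<noteq> 4" by auto
  have "[2..<m + 2] = 2 # [3..<m + 2]" using m by (simp add: upt_rec[of 2] del: upt_Suc)
  moreover have "foldr (cl_mult N) (map (\<lambda>j. plane_rot j pi) [3..<m + 2]) cl_one \<in> carrier (K_group m)"
    by (intro torus_list_closed[of 3 _ "\<lambda>_. pi"]) auto
  moreover have "plane_rot 2 pi = rot N 3 4 pi" using plane_rot_eq[of 2 pi] m by simp
  ultimately have eq: "\<tau> (torus_elem m 2 (\<lambda>_. pi)) = R 3 4 pi ** ?T"
    using hom_mult[OF rot_closed[OF mem, of pi]] unfolding torus_elem_def N[symmetric] by simp
  have comm: "?T ** ?g = ?g ** ?T" by (rule torus_rest_commute) auto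
  have "R 4 3 (- pi) ** ?g = ?g ** R 4 3 (- (- pi))" by (rule flip) (use N4 in auto)
  then have flip34: "R 3 4 pi ** ?g = ?g ** R 3 4 (- pi)"
    using swap[of 4 3] swap[of 3 4] mem by simp
  have "R 3 4 pi = R 3 4 (- pi) ** R 3 4 (2 * pi)"
    using periodic_group.add[OF group[OF mem], of "- pi" "2 * pi"] by simp
  then have neg: "R 3 4 (- pi) = - R 3 4 pi"
    using tau_rot_pi(2)[OF mem] by (simp add: mm_simps)
  have "R 3 4 pi ** ?T ** ?g = (R 3 4 pi ** ?g) ** ?T"
    using comm by (simp flip: matrix_mul_assoc)
  also have "\<dots> = - (?g ** (R 3 4 pi ** ?T))"
    unfolding flip34 neg by (simp add: mm_simps)
  finally show ?thesis unfolding eq .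
qed

end

section \<open>The Casimir operator of \<open>U\<close>\<close>

lemma sum_const_smult: "(\<Sum>k\<in>A. c) = of_nat (card A) *s c" for c :: "complex^'n"
  by (induction A rule: infinite_finite_induct) (auto simp: vector_sadd_rdistrib simp del: sum_constant)

lemma commuting_eigenvector:
  fixes A B :: "complex^'n^'n"
  assumes "A ** B = B ** A" "B *v v = c *s v"
  shows "B *v (A *v v) = c *s (A *v v)"
proof -
  have "B *v (A *v v) = A *v (B *v v)" by (simp only: matrix_vector_mul_assoc assms(1))
  then show ?thesis by (simp only: assms(2) vec.scale)
qed

text \<open>The second alternative for \<open>Lambda 2\<close> is \<open>varpi_minus\<close> with
  \<open>m = 1\<close>, where index 2 is the last one and carries the minus sign.\<close>

locale u_rep = spin_rep m N 1 "U_group m" \<pi> for m N and \<pi> :: "cliff \<Rightarrow> complex^'d^'d" +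
  fixes l :: nat and \<Lambda> :: weight
  assumes m: "m \<ge> 1" and irrep: "U_irrep m \<Lambda> \<pi>"
    and \<Lambda>1: "\<Lambda> 1 = real l + 1/2" and \<Lambda>2: "\<Lambda> 2 = 1/2 \<or> m = 1 \<and> \<Lambda> 2 = -1/2"
begin

lemma N4: "4 \<le> N" using m N by simp

definition "lam = real l + 1/2"

definition "Top = {v. X 1 2 *v v = (\<i> * of_real lam) *s v}"

lemma weight_dominated: "w \<noteq> 0 \<Longrightarrow> weightvec 1 \<mu> w \<Longrightarrow> dominated (pos_roots_D 1 (m + 1)) \<mu> \<Lambda>"
  using weightvec_is_weight[of 1 \<mu> w UNIV] irrep
  unfolding U_irrep_def has_highest_weight_def by simp

lemma X12_le:
  assumes "v \<noteq> 0" "X 1 2 *v v = (\<i> * of_real \<nu>) *s v"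
  shows "\<nu> \<le> lam"
proof -
  have "\<exists>w\<in>UNIV. \<exists>\<mu>. w \<noteq> 0 \<and> weightvec 1 \<mu> w \<and> \<mu> 1 = \<nu>"
    using assms m by (intro eigenvector_weight[of 1 UNIV 1 v]) (auto simp: vec.subspace_UNIV numeral_2_eq_2)
  then obtain w \<mu> where w: "w \<noteq> 0" "weightvec 1 \<mu> w" "\<mu> 1 = \<nu>" by blast
  have "\<mu> 1 \<le> \<Lambda> 1"
    by (rule dominated_le[OF weight_dominated[OF w(1,2)]]) (rule pos_roots_D_first)
  then show ?thesis using w(3) \<Lambda>1 by (simp add: lam_def)
qed

lemma X12_bound:
  assumes "v \<noteq> 0" "X 1 2 *v v = (\<i> * of_real \<nu>) *s v"
  shows "\<bar>\<nu>\<bar> \<le> lam"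
proof -
  let ?g = "R 2 3 pi"
  have "X 1 2 ** ?g = - (?g ** X 1 2)" by (rule flip_X) (use N4 in auto)
  then have "X 1 2 *v (?g *v v) = - (?g *v (X 1 2 *v v))"
    by (simp only: matrix_vector_mul_assoc mv.minus_left)
  then have 1: "X 1 2 *v (?g *v v) = (\<i> * of_real (- \<nu>)) *s (?g *v v)"
    by (simp add: assms(2) vec.scale del: One_nat_def)
  have "R 2 3 (- pi) *v (?g *v v) = v"
    using inverse'[of 2 3 pi] N4 by (simp add: matrix_vector_mul_assoc)
  then have 2: "?g *v v \<noteq> 0" using assms(1) by auto
  show ?thesis using X12_le[OF assms] X12_le[OF 2 1] by simp
qed

lemma Top_subspace: "vec.subspace Top"
  unfolding Top_def vec.subspace_def by (auto simp: vec.add vec.scale vector_add_ldistrib mult.commute)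

lemma Top_nonzero: "\<exists>v\<in>Top. v \<noteq> 0"
proof -
  have "is_weight m 1 \<pi> UNIV \<Lambda>" using irrep unfolding U_irrep_def has_highest_weight_def by blast
  then obtain v where v: "v \<noteq> 0" "\<And>t. \<pi> (torus_elem m 1 t) *v v = cis (\<Sum>j=1..m + 1. \<Lambda> j * t j) *s v"
    unfolding is_weight_def by blast
  have "R 1 2 s *v v = cis (lam * s) *s v" for s
  proof -
    let ?t = "\<lambda>j. if j = (1::nat) then s else 0"
    have p0: "plane_rot j 0 = cl_one" for j by (simp add: plane_rot_def)
    have rest: "foldr (cl_mult N) (map (\<lambda>j. plane_rot j (?t j)) js) cl_one = cl_one" if "1 \<notin> set js" for js
      using that by (induction js) (auto simp: p0 cl_one_mult cl_dom_one)
    have "[1..<m + 2] = 1 # [2..<m + 2]" using upt_conv_Cons[of 1 "m + 2"] by (simp add: numeral_2_eq_2 del: upt_Suc)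
    then have "torus_elem m 1 ?t = cl_mult N (plane_rot 1 s) cl_one"
      unfolding torus_elem_def N[symmetric] using rest[of "[2..<m + 2]"] by (simp del: upt_Suc)
    also have "\<dots> = rot N 1 2 s" using plane_rot_eq[of 1 s] by (simp add: cl_mult_one cl_dom_rot)
    finally have "torus_elem m 1 ?t = rot N 1 2 s" .
    moreover have "(\<Sum>j=1..m + 1. \<Lambda> j * ?t j) = (\<Sum>j=1..m + 1. if j = 1 then lam * s else 0)"
      by (intro sum.cong) (auto simp: \<Lambda>1[unfolded One_nat_def] lam_def)
    moreover have "\<dots> = lam * s" by (subst sum.delta) auto
    ultimately show ?thesis using v(2)[of ?t] by simp
  qed
  then have "X 1 2 *v v = (\<i> * of_real lam) *s v"
    unfolding X_def using N4 by (intro periodic_group.eigen_converse[OF group]) auto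
  then show ?thesis using v(1) unfolding Top_def by blast
qed

lemma disjoint_Top:
  assumes "a \<in> {3..N}" "b \<in> {3..N}" "a \<noteq> b" "v \<in> Top"
  shows "R a b t *v v \<in> Top" "X a b *v v \<in> Top"
proof -
  have "R a b t ** X 1 2 = X 1 2 ** R a b t" using assms N4 by (intro disjoint_X) auto
  then show "R a b t *v v \<in> Top" using assms(4) commuting_eigenvector unfolding Top_def by blast
  have "X a b ** X 1 2 = X 1 2 ** X a b" using assms N4 by (intro disjoint_XX) auto
  then show "X a b *v v \<in> Top" using assms(4) commuting_eigenvector unfolding Top_def by blast
qed

text \<open>On \<open>Top\<close> the first coordinate of a weight already equals
  \<open>Lambda 1\<close>, so dominance descends to the indices from 2 on. For \<open>m = 1\<close>
  no roots are left, and the weight is determined.\<close>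

lemma Top_X34:
  assumes "v \<in> Top" "v \<noteq> 0" "X 3 4 *v v = (\<i> * of_real \<nu>) *s v"
  shows "\<nu> \<le> \<Lambda> 2 \<and> \<Lambda> 2 - \<nu> \<in> \<int> \<and> (m = 1 \<longrightarrow> \<nu> = \<Lambda> 2)"
proof -
  have inv: "X (2 * j - 1) (2 * j) *v w \<in> Top" if j: "j \<in> {1..m + 1}" and w: "w \<in> Top" for j w
  proof (cases "j = 1")
    case True
    then have "X (2 * j - 1) (2 * j) *v w = (\<i> * of_real lam) *s w"
      using w unfolding Top_def by (simp add: numeral_2_eq_2)
    then show ?thesis using w Top_subspace by (simp add: vec.subspace_scale)
  next
    case False
    then show ?thesis using j w by (intro disjoint_Top) (auto simp: N)
  qed
  have "\<exists>w\<in>Top. \<exists>\<mu>. w \<noteq> 0 \<and> weightvec 1 \<mu> w \<and> \<mu> 2 = \<nu>"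
    using assms m inv Top_subspace by (intro eigenvector_weight[of 1 Top 2 v]) auto
  then obtain w \<mu> where w: "w \<in> Top" "w \<noteq> 0" "weightvec 1 \<mu> w" "\<mu> 2 = \<nu>" by blast
  have "(\<i> * of_real (\<mu> 1)) *s w = X (2 * 1 - 1) (2 * 1) *v w"
    using w(3) unfolding weightvec_def by (metis atLeastAtMost_iff le_add2 order_refl)
  also have "\<dots> = (\<i> * of_real lam) *s w" using w(1) unfolding Top_def by (simp add: numeral_2_eq_2)
  finally have "complex_of_real (\<mu> 1) = of_real lam" using w(2) by simp
  then have "\<mu> 1 = lam" unfolding of_real_eq_iff .
  then have "\<mu> 1 = \<Lambda> 1" by (simp only: \<Lambda>1 lam_def)
  then have dom: "dominated (pos_roots_D 2 (m + 1)) \<mu> \<Lambda>"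
    using dominated_D_descend[OF weight_dominated[OF w(2,3)]] by (simp add: numeral_2_eq_2)
  have "\<mu> 2 \<le> \<Lambda> 2" by (rule dominated_le[OF dom]) (rule pos_roots_D_first)
  moreover have "\<Lambda> 2 - \<mu> 2 \<in> \<int>" by (rule dominated_int[OF dom]) (rule pos_roots_D_int)
  moreover have "\<mu> 2 = \<Lambda> 2" if "m = 1"
  proof -
    have "pos_roots_D 2 (m + 1) = {}" using that unfolding pos_roots_D_def by auto
    then have "\<Lambda> 2 - \<mu> 2 = 0" using dom[unfolded dominated_def] by simp
    then show ?thesis by simp
  qed
  ultimately show ?thesis using w(4) by blast
qed

text \<open>The flip that makes the spectrum symmetric has to preserve \<open>Top\<close>, so it
  must avoid axis 2; for \<open>m >= 2\<close> the plane of \<open>e_3\<close>, \<open>e_5\<close>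
  is used. For \<open>m = 1\<close> there is no such plane, but there \<open>Top_X34\<close> gives
  the eigenvalue exactly.\<close>

lemma Top_square:
  assumes "a \<in> {3..N}" "b \<in> {3..N}" "a \<noteq> b" "v \<in> Top"
  shows "X a b *v (X a b *v v) = (-1/4) *s v"
proof (rule squares_all[where W=Top and J="{3..N}" and p=3 and q=4])
  have mem: "3 \<in> {3..N}" "4 \<in> {3..N}" "(3::nat) \<noteq> 4" using N4 by auto
  show "3 \<in> {3..N}" "4 \<in> {3..N}" "(3::nat) \<noteq> 4" by (rule mem)+
  show "{3..N} \<subseteq> {1..N}" by auto
  show "R a b t *v x \<in> Top" if "a \<in> {3..N}" "b \<in> {3..N}" "a \<noteq> b" "x \<in> Top" for a b x t
    using disjoint_Top(1)[OF that] .
  show "X 3 4 *v (X 3 4 *v x) = (-1/4) *s x" if "x \<in> Top" for x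
  proof (rule square_of_eigenvalues[where W=Top])
    show "3 \<in> {1..N}" "4 \<in> {1..N}" using N4 by auto
    show "X 3 4 *v w \<in> Top" if "w \<in> Top" for w using disjoint_Top(2)[OF mem that] .
    fix v \<nu> assume v: "v \<in> Top" "v \<noteq> 0" "X 3 4 *v v = (\<i> * of_real \<nu>) *s v"
    have b: "\<nu> \<le> \<Lambda> 2" "\<Lambda> 2 - \<nu> \<in> \<int>" "m = 1 \<longrightarrow> \<nu> = \<Lambda> 2" using Top_X34[OF v] by auto
    show "\<nu> = 1/2 \<or> \<nu> = -1/2"
    proof (cases "m = 1")
      case True
      then show ?thesis using b(3) \<Lambda>2 by auto
    next
      case False
      then have N6: "6 \<le> N" using m N by simp
      have \<Lambda>: "\<Lambda> 2 = 1/2" using \<Lambda>2 False by blast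
      let ?g = "R 3 5 pi"
      have "X 4 3 ** ?g = - (?g ** X 4 3)" by (rule flip_X) (use N6 in auto)
      moreover have "X 4 3 = - X 3 4" using N6 by (intro X_swap) auto
      ultimately have "- (X 3 4 ** ?g) = ?g ** X 3 4" by (simp add: mm_simps)
      then have "X 3 4 ** ?g = - (?g ** X 3 4)" by (metis minus_minus)
      then have "X 3 4 *v (?g *v v) = - (?g *v (X 3 4 *v v))"
        by (simp only: matrix_vector_mul_assoc mv.minus_left)
      then have 1: "X 3 4 *v (?g *v v) = (\<i> * of_real (- \<nu>)) *s (?g *v v)"
        by (simp add: v(3) vec.scale)
      have "R 3 5 (- pi) *v (?g *v v) = v"
        using inverse'[of 3 5 pi] N6 by (simp add: matrix_vector_mul_assoc)
      then have 2: "?g *v v \<noteq> 0" using v(2) by auto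
      have 3: "?g *v v \<in> Top" using v(1) N6 by (intro disjoint_Top(1)) auto
      have "- \<nu> \<le> \<Lambda> 2" using Top_X34[OF 3 2 1] by blast
      then show ?thesis using b(1,2) unfolding \<Lambda> by (intro Ints_half_cases)
    qed
  qed (rule mem Top_subspace that)+
qed (rule assms)+

text \<open>The difference of the two sides would be an eigenvector of \<open>X 1 2\<close> for \<open>\<i> * (lam + 1)\<close>.\<close>

lemma raising_zero:
  assumes v: "v \<in> Top" and k: "k \<in> {3..N}"
  shows "X 1 k *v v = \<i> *s (X 2 k *v v)"
proof -
  have kI: "{1, 2, k} \<subseteq> {1..N}" "distinct [1, 2, k]" using k by auto
  have sw: "X k 1 = - X 1 k" "X k 2 = - X 2 k" "X 2 1 = - X 1 2"
    using k by (auto intro!: X_swap)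
  have "X 1 2 ** X k 1 = X k 1 ** X 1 2 + X k 2" by (rule commutator) (use k in auto)
  then have "- (X 1 2 ** X 1 k) = - (X 1 k ** X 1 2 + X 2 k)" unfolding sw by (simp only: mm_simps minus_add_distrib)
  then have c1: "X 1 2 ** X 1 k = X 1 k ** X 1 2 + X 2 k" by (simp only: neg_equal_iff_equal)
  have "X 2 1 ** X k 2 = X k 2 ** X 2 1 + X k 1" by (rule commutator) (use k in auto)
  then have c2: "X 1 2 ** X 2 k = X 2 k ** X 1 2 - X 1 k" unfolding sw by (simp only: mm_simps minus_minus) simp
  let ?w = "X 1 k *v v - \<i> *s (X 2 k *v v)"
  have Xv: "X 1 2 *v v = (\<i> * of_real lam) *s v" using v unfolding Top_def by blast
  have "X 1 2 *v ?w = (X 1 2 ** X 1 k) *v v - \<i> *s ((X 1 2 ** X 2 k) *v v)"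
    by (simp only: vec.diff vec.scale matrix_vector_mul_assoc)
  also have "\<dots> = (\<i> * of_real lam) *s (X 1 k *v v) + X 2 k *v v - \<i> *s ((\<i> * of_real lam) *s (X 2 k *v v) - X 1 k *v v)"
    unfolding c1 c2 mv.add_left mv.diff_left matrix_vector_mul_assoc[symmetric] Xv vec.scale ..
  also have "\<dots> = (\<i> * of_real (lam + 1)) *s ?w"
    by (simp add: vec_eq_iff algebra_simps)
  finally have "X 1 2 *v ?w = (\<i> * of_real (lam + 1)) *s ?w" .
  then have "?w = 0" using X12_le[of ?w "lam + 1"] by force
  then show ?thesis by simp
qed

text \<open>Replacing \<open>X 1 k\<close> by \<open>i X 2 k\<close> before and after exchanging the
  factors cancels the squares and leaves the commutator \<open>X 1 2\<close>, which contributes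
  \<open>- lam\<close>.\<close>

lemma Top_pair:
  assumes v: "v \<in> Top" and k: "k \<in> {3..N}"
  shows "(X 1 k ** X 1 k + X 2 k ** X 2 k) *v v = of_real (- lam) *s v"
proof -
  have sw: "X k 2 = - X 2 k" using k by (auto intro!: X_swap)
  have "X k 2 ** X 1 k = X 1 k ** X k 2 + X 1 2" by (rule commutator) (use k in auto)
  then have c: "X 1 k ** X 2 k = X 2 k ** X 1 k + X 1 2" unfolding sw by (simp only: mm_simps) (simp add: algebra_simps)
  have Xv: "X 1 2 *v v = (\<i> * of_real lam) *s v" using v unfolding Top_def by blast
  note r = raising_zero[OF v k]
  have "X 1 k *v (X 1 k *v v) = \<i> *s ((X 1 k ** X 2 k) *v v)"
    unfolding r vec.scale matrix_vector_mul_assoc ..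
  also have "\<dots> = \<i> *s (X 2 k *v (\<i> *s (X 2 k *v v)) + (\<i> * of_real lam) *s v)"
    unfolding c mv.add_left matrix_vector_mul_assoc[symmetric] r Xv ..
  also have "\<dots> = - (X 2 k *v (X 2 k *v v)) + of_real (- lam) *s v"
    by (simp add: vec.scale vec_eq_iff algebra_simps)
  finally show ?thesis by (simp add: mv.add_left flip: matrix_vector_mul_assoc)
qed

text \<open>The three terms come from the \<open>2m (2m - 1)\<close> ordered pairs of axes in
  \<open>{3..N}\<close>, each with square \<open>-1/4\<close>; from the \<open>2m\<close> pairs of
  \<open>Top_pair\<close>, counted twice; and from \<open>X 1 2\<close>, counted twice.\<close>

definition "cas = - (real (2 * m * (2 * m - 1)) / 4 + 4 * real m * lam + 2 * lam\<^sup>2)"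

lemma Cas_Top: assumes v: "v \<in> Top" shows "Cas {1..N} *v v = of_real cas *s v"
proof -
  have e: "{1..N} = insert 1 (insert 2 {3..N})" using N4 by auto
  have "Cas {1..N} = Cas {3..N} + 2 *\<^sub>R (\<Sum>k\<in>{3..N}. X 1 k ** X 1 k + X 2 k ** X 2 k) + 2 *\<^sub>R (X 1 2 ** X 1 2)"
  proof -
    have "Cas {1..N} = Cas (insert 2 {3..N}) + 2 *\<^sub>R (\<Sum>k\<in>insert 2 {3..N}. X 1 k ** X 1 k)"
      unfolding e using N4 by (intro Cas_insert) auto
    also have "Cas (insert 2 {3..N}) = Cas {3..N} + 2 *\<^sub>R (\<Sum>k\<in>{3..N}. X 2 k ** X 2 k)"
      using N4 by (intro Cas_insert) auto
    also have "(\<Sum>k\<in>insert 2 {3..N}. X 1 k ** X 1 k) = X 1 2 ** X 1 2 + (\<Sum>k\<in>{3..N}. X 1 k ** X 1 k)"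
      by (intro sum.insert) auto
    finally show ?thesis by (simp only: sum.distrib scaleR_add_right) (simp only: add_ac)
  qed
  then have "Cas {1..N} *v v = Cas {3..N} *v v
     + of_real 2 *s (\<Sum>k\<in>{3..N}. (X 1 k ** X 1 k + X 2 k ** X 2 k) *v v) + of_real 2 *s ((X 1 2 ** X 1 2) *v v)"
    by (simp only: mv.add_left mv.scaleR_left mv.sum_left scaleR_eq_smult)
  also have "(\<Sum>k\<in>{3..N}. (X 1 k ** X 1 k + X 2 k ** X 2 k) *v v) = of_nat (2 * m) *s (of_real (- lam) *s v)"
  proof -
    have "(\<Sum>k\<in>{3..N}. (X 1 k ** X 1 k + X 2 k ** X 2 k) *v v) = (\<Sum>k\<in>{3..N}. of_real (- lam) *s v)"
      by (intro sum.cong refl Top_pair v)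
    also have "\<dots> = of_nat (2 * m) *s (of_real (- lam) *s v)"
      unfolding sum_const_smult using N by simp
    finally show ?thesis .
  qed
  also have "(X 1 2 ** X 1 2) *v v = of_real (- (lam\<^sup>2)) *s v"
  proof -
    have Xv: "X 1 2 *v v = (\<i> * of_real lam) *s v" using v unfolding Top_def by blast
    have "(\<i> * of_real lam) * (\<i> * of_real lam) = of_real (- (lam\<^sup>2))"
      by (simp add: power2_eq_square complex_eq_iff)
    then show ?thesis unfolding matrix_vector_mul_assoc[symmetric] Xv vec.scale vector_smult_assoc by simp
  qed
  also have "Cas {3..N} *v v = of_real (- (real (2 * m * (2 * m - 1)) / 4)) *s v"
  proof -
    have "Cas {3..N} *v v = (\<Sum>a\<in>{3..N}. \<Sum>b\<in>{3..N} - {a}. X a b *v (X a b *v v))"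
      by (simp only: Cas_def mv.sum_left matrix_vector_mul_assoc)
    also have "\<dots> = (\<Sum>a\<in>{3..N}. \<Sum>b\<in>{3..N} - {a}. (-1/4) *s v)"
      by (intro sum.cong refl Top_square v) auto
    also have "\<dots> = (\<Sum>a\<in>{3..N}. of_nat (2 * m - 1) *s ((-1/4) *s v))"
    proof (rule sum.cong[OF refl])
      fix a assume "a \<in> {3..N}"
      then have "card ({3..N} - {a}) = 2 * m - 1" using N by (simp add: card_Diff_singleton)
      then show "(\<Sum>b\<in>{3..N} - {a}. (-1/4) *s v) = of_nat (2 * m - 1) *s ((-1/4) *s v)"
        unfolding sum_const_smult by (simp only:)
    qed
    also have "\<dots> = of_nat (2 * m) *s (of_nat (2 * m - 1) *s ((-1/4) *s v))"
      unfolding sum_const_smult using N by simp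
    finally show ?thesis by (simp add: vec_eq_iff)
  qed
  finally show ?thesis by (simp add: cas_def vec_eq_iff algebra_simps)
qed

lemma Cas_commute_rep:
  assumes "u \<in> carrier (Spin N)"
  shows "\<pi> u ** Cas {1..N} = Cas {1..N} ** \<pi> u"
proof -
  have "2 \<le> N" using N4 by simp
  with assms show ?thesis
  proof (induction rule: Spin_induct)
  show "\<pi> cl_one ** Cas {1..N} = Cas {1..N} ** \<pi> cl_one" by (simp add: hom_one)
  show "R 1 k s ** Cas {1..N} = Cas {1..N} ** R 1 k s" if "k \<in> {2..N}" for k s
    using that by (intro Cas_commute) auto
  show "\<pi> (cl_mult N x y) ** Cas {1..N} = Cas {1..N} ** \<pi> (cl_mult N x y)"
    if "x \<in> carrier (Spin N)" "y \<in> carrier (Spin N)" "\<pi> x ** Cas {1..N} = Cas {1..N} ** \<pi> x"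
      "\<pi> y ** Cas {1..N} = Cas {1..N} ** \<pi> y" for x y
  proof -
    have "\<pi> (cl_mult N x y) = \<pi> x ** \<pi> y"
      using that(1,2) N by (intro hom_mult) (simp_all add: U_group_def)
    moreover have "\<pi> x ** \<pi> y ** Cas {1..N} = \<pi> x ** (Cas {1..N} ** \<pi> y)"
      unfolding that(4)[symmetric] matrix_mul_assoc ..
    moreover have "\<pi> x ** Cas {1..N} ** \<pi> y = Cas {1..N} ** (\<pi> x ** \<pi> y)"
      unfolding that(3) matrix_mul_assoc ..
    ultimately show ?thesis by (simp only: matrix_mul_assoc)
  qed
  qed
qed

text \<open>Schur's argument: the eigenspace for \<open>cas\<close> is invariant and contains
  \<open>Top\<close>.\<close>

lemma Cas_scalar: "Cas {1..N} *v v = of_real cas *s v"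
proof -
  define W where "W = {v. Cas {1..N} *v v = of_real cas *s v}"
  have "vec.subspace W"
    unfolding W_def vec.subspace_def by (auto simp: vec.add vec.scale vector_add_ldistrib mult.commute)
  moreover have "\<pi> g *v w \<in> W" if "g \<in> carrier (U_group m)" "w \<in> W" for g w
    using that commuting_eigenvector[OF Cas_commute_rep[of g]] N unfolding W_def by (simp add: U_group_def)
  ultimately have "invariant_subspace (U_group m) \<pi> W" unfolding invariant_subspace_def by blast
  moreover have "W \<noteq> {0}" using Top_nonzero Cas_Top unfolding W_def by blast
  ultimately have "W = UNIV"
    using irrep unfolding U_irrep_def irreducible_on_def by blast
  then show ?thesis unfolding W_def by blast
qed

lemma torus_pi_scalar: "\<pi> (torus_elem m 1 (\<lambda>_. pi)) *v v = cis (pi * (\<Sum>r=1..m + 1. \<Lambda> r)) *s v"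
proof -
  have "\<pi> (torus_elem m 1 (\<lambda>_. pi)) *v v = mat (cis (pi * (\<Sum>r=1..m + 1. \<Lambda> r))) *v v"
  proof (rule matrix_eq_on_span)
    show "v \<in> vec.span {w\<in>UNIV. \<exists>\<mu>. weightvec 1 \<mu> w}"
      using weightvec_span[of 1 UNIV] vec.subspace_UNIV by auto
    fix x assume "x \<in> {w\<in>UNIV. \<exists>\<mu>. weightvec 1 \<mu> w}"
    then obtain \<mu> where x: "weightvec 1 \<mu> x" by blast
    show "\<pi> (torus_elem m 1 (\<lambda>_. pi)) *v x = mat (cis (pi * (\<Sum>r=1..m + 1. \<Lambda> r))) *v x"
    proof (cases "x = 0")
      case False
      obtain k :: int where "(\<Sum>r=1..m + 1. \<Lambda> r) - (\<Sum>r=1..m + 1. \<mu> r) = 2 * of_int k"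
        using dominated_D_even[OF weight_dominated[OF False x]] by blast
      then have "cis (pi * (\<Sum>r=1..m + 1. \<Lambda> r)) = cis (pi * (\<Sum>r=1..m + 1. \<mu> r))" by (rule cis_pi_even)
      moreover have "(\<Sum>j=1..m + 1. \<mu> j * pi) = pi * (\<Sum>r=1..m + 1. \<mu> r)"
        by (simp only: sum_distrib_left mult.commute)
      ultimately show ?thesis using torus_elem_eigen[of 1 \<mu> x "\<lambda>_. pi"] x
        by (simp add: mat_vector del: sum.cl_ivl_Suc One_nat_def)
    qed simp
  qed
  then show ?thesis by (simp only: mat_vector)
qed

end

section \<open>The radial equation of the spherical functions\<close>

locale spherical = K: tau_rep m N \<tau> + U: u_rep m N \<pi> l \<Lambda>
  for m N and \<tau> :: "cliff \<Rightarrow> complex^'t^'t" and \<pi> :: "cliff \<Rightarrow> complex^'d^'d" and l \<Lambda> +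
  fixes j :: "complex^'t^'d" and p :: "complex^'d^'t"
  assumes jp: "unitary_intertwiners (K_group m) \<tau> \<pi> j p"
begin

lemma pj: "p ** j = mat 1"
  using jp by (simp add: unitary_intertwiners_def)

lemma intertwine: "g \<in> carrier (K_group m) \<Longrightarrow> \<pi> g ** j = j ** \<tau> g \<and> p ** \<pi> g = \<tau> g ** p"
  using jp by (simp add: unitary_intertwiners_def)

lemma intertwine_X:
  assumes "a \<in> {2..N}" "b \<in> {2..N}" "a \<noteq> b"
  shows "U.X a b ** j = j ** K.X a b" "p ** U.X a b = K.X a b ** p"
proof -
  have U: "(U.R a b has_vector_derivative U.X a b) (at 0)" using assms by (intro U.deriv) auto
  have K: "(K.R a b has_vector_derivative K.X a b) (at 0)" using assms by (intro K.deriv) auto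
  have "((\<lambda>t. U.R a b t ** j) has_vector_derivative U.X a b ** j) (at 0)"
    by (rule bounded_linear.has_vector_derivative[OF mm.bounded_linear_left U])
  moreover have "((\<lambda>t. j ** K.R a b t) has_vector_derivative j ** K.X a b) (at 0)"
    by (rule bounded_linear.has_vector_derivative[OF mm.bounded_linear_right K])
  moreover have "(\<lambda>t. U.R a b t ** j) = (\<lambda>t. j ** K.R a b t)"
    using intertwine K.rot_closed[OF assms] by auto
  ultimately show "U.X a b ** j = j ** K.X a b" by (metis vector_derivative_unique_at)
  have "((\<lambda>t. p ** U.R a b t) has_vector_derivative p ** U.X a b) (at 0)"
    by (rule bounded_linear.has_vector_derivative[OF mm.bounded_linear_right U])
  moreover have "((\<lambda>t. K.R a b t ** p) has_vector_derivative K.X a b ** p) (at 0)"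
    by (rule bounded_linear.has_vector_derivative[OF mm.bounded_linear_left K])
  moreover have "(\<lambda>t. p ** U.R a b t) = (\<lambda>t. K.R a b t ** p)"
    using intertwine K.rot_closed[OF assms] by auto
  ultimately show "p ** U.X a b = K.X a b ** p" by (metis vector_derivative_unique_at)
qed

abbreviation "A t \<equiv> U.R 1 2 t"

definition "F t = p ** A t ** j"

lemma F_reflect:
  assumes k: "k \<in> {3..N}"
  shows "F t ** K.R 2 k pi = K.R 2 k pi ** F (- t)"
proof -
  have "A t ** U.R 2 k pi = U.R 2 k pi ** A (- t)" by (rule U.flip) (use k in auto)
  moreover have "rot N 2 k pi \<in> carrier (K_group m)" using k by (intro K.rot_closed) auto
  note i = intertwine[OF this, THEN conjunct1] intertwine[OF this, THEN conjunct2]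
  have "F t ** K.R 2 k pi = p ** (A t ** U.R 2 k pi) ** j"
    unfolding F_def matrix_mul_assoc[symmetric] i(1) ..
  ultimately have "F t ** K.R 2 k pi = (p ** U.R 2 k pi) ** A (- t) ** j" by (simp only: matrix_mul_assoc)
  then show ?thesis unfolding i(2) F_def by (simp only: matrix_mul_assoc)
qed

lemma F_reflect_X:
  assumes k: "k \<in> {3..N}"
  shows "F t ** K.X 2 k = K.X 2 k ** F (- t)"
proof -
  have "K.R 2 k pi = 2 *\<^sub>R K.X 2 k" using k by (intro K.tau_rot_pi) auto
  then have "2 *\<^sub>R (F t ** K.X 2 k) = 2 *\<^sub>R (K.X 2 k ** F (- t))"
    using F_reflect[OF k, of t] by (simp only: mm.scaleR_left mm.scaleR_right)
  then show ?thesis by simp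
qed

text \<open>Each factor \<open>sin t\<close> trades one \<open>X 1 k\<close> for copies of
  \<open>X 2 k\<close>, which lies in \<open>K\<close>, on the two sides of \<open>A t\<close>.
  Moving the other \<open>X 1 k\<close> past \<open>X 2 k\<close> costs the commutator
  \<open>X 1 2\<close>, the source of the first-order term.\<close>

lemma radial_square:
  assumes k: "k \<in> {3..N}"
  shows "(sin t)\<^sup>2 *\<^sub>R (U.X 1 k ** U.X 1 k ** A t) =
    (cos t)\<^sup>2 *\<^sub>R (U.X 2 k ** U.X 2 k ** A t) - (2 * cos t) *\<^sub>R (U.X 2 k ** A t ** U.X 2 k)
     + A t ** U.X 2 k ** U.X 2 k + (sin t * cos t) *\<^sub>R (U.X 1 2 ** A t)"
proof -
  have sw: "U.X k 1 = - U.X 1 k" "U.X k 2 = - U.X 2 k" using k by (auto intro!: U.X_swap)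
  have "U.R 2 1 (- t) ** U.X k 2 = cos (- t) *\<^sub>R (U.X k 2 ** U.R 2 1 (- t)) + sin (- t) *\<^sub>R (U.X k 1 ** U.R 2 1 (- t))"
    by (rule U.Ad_left) (use k in auto)
  moreover have "U.R 2 1 (- t) = A t" using U.swap[of 1 2 "- t"] k by simp
  ultimately have "A t ** U.X k 2 = cos t *\<^sub>R (U.X k 2 ** A t) - sin t *\<^sub>R (U.X k 1 ** A t)" by simp
  then have S: "sin t *\<^sub>R (U.X 1 k ** A t) = cos t *\<^sub>R (U.X 2 k ** A t) - A t ** U.X 2 k"
    unfolding sw by (simp add: mm_simps algebra_simps)
  have "U.X k 2 ** U.X 1 k = U.X 1 k ** U.X k 2 + U.X 1 2" by (rule U.commutator) (use k in auto)
  then have c: "U.X 1 k ** U.X 2 k = U.X 2 k ** U.X 1 k + U.X 1 2" unfolding sw by (simp only: mm_simps) (simp add: algebra_simps)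
  have "(sin t)\<^sup>2 *\<^sub>R (U.X 1 k ** U.X 1 k ** A t) = sin t *\<^sub>R (U.X 1 k ** (sin t *\<^sub>R (U.X 1 k ** A t)))"
    by (simp add: mm_simps power2_eq_square)
  also have "\<dots> = cos t *\<^sub>R (sin t *\<^sub>R ((U.X 1 k ** U.X 2 k) ** A t)) - (sin t *\<^sub>R (U.X 1 k ** A t)) ** U.X 2 k"
    by (subst (1) S) (simp add: mm_simps scaleR_diff_right mult.commute)
  also have "(U.X 1 k ** U.X 2 k) ** A t = U.X 2 k ** (U.X 1 k ** A t) + U.X 1 2 ** A t"
    unfolding c by (simp only: mm_simps)
  also have "sin t *\<^sub>R (U.X 2 k ** (U.X 1 k ** A t) + U.X 1 2 ** A t) =
      U.X 2 k ** (sin t *\<^sub>R (U.X 1 k ** A t)) + sin t *\<^sub>R (U.X 1 2 ** A t)"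
    by (simp only: mm_simps scaleR_add_right)
  also have "cos t *\<^sub>R (U.X 2 k ** (sin t *\<^sub>R (U.X 1 k ** A t)) + sin t *\<^sub>R (U.X 1 2 ** A t)) -
      (sin t *\<^sub>R (U.X 1 k ** A t)) ** U.X 2 k =
    (cos t)\<^sup>2 *\<^sub>R (U.X 2 k ** U.X 2 k ** A t) - (2 * cos t) *\<^sub>R (U.X 2 k ** A t ** U.X 2 k)
     + A t ** U.X 2 k ** U.X 2 k + (sin t * cos t) *\<^sub>R (U.X 1 2 ** A t)"
    unfolding S by (simp add: mm_simps algebra_simps power2_eq_square mult_2 flip: scaleR_add_left)
  finally show ?thesis .
qed

text \<open>\<open>y1\<close> and \<open>y2\<close> are the first two derivatives of
  \<open>y\<close> in \<open>t\<close>, given algebraically.\<close>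

definition "y w t = F t *v w"
definition "y1 w t = p *v (U.X 1 2 *v (A t *v (j *v w)))"
definition "y2 w t = p *v (U.X 1 2 *v (U.X 1 2 *v (A t *v (j *v w))))"

text \<open>All products reduce to \<open>(X 2 k)^2 = -1/4\<close>. In the mixed one,
  \<open>F_reflect_X\<close> first carries a factor through \<open>F t\<close>, which reverses
  \<open>t\<close>.\<close>

lemma radial_square_vector:
  assumes k: "k \<in> {3..N}"
  shows "(sin t)\<^sup>2 *\<^sub>R (p *v (U.X 1 k *v (U.X 1 k *v (A t *v (j *v w))))) =
    (- (1 + (cos t)\<^sup>2) / 4) *\<^sub>R y w t + (cos t / 2) *\<^sub>R y w (- t) + (sin t * cos t) *\<^sub>R y1 w t"
proof -
  let ?Q = "K.X 2 k"
  have i: "U.X 2 k ** j = j ** ?Q" "p ** U.X 2 k = ?Q ** p" using intertwine_X[of 2 k] k by auto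
  have sq: "?Q *v (?Q *v v) = (-1/4) *s v" for v using k by (intro K.tau_square) auto
  have e1: "p ** (U.X 2 k ** U.X 2 k ** A t) ** j = ?Q ** ?Q ** F t"
    unfolding F_def matrix_mul_assoc i(2) by (simp only: matrix_mul_assoc[symmetric] i(2))
  have e2: "p ** (U.X 2 k ** A t ** U.X 2 k) ** j = ?Q ** ?Q ** F (- t)"
  proof -
    have "p ** (U.X 2 k ** A t ** U.X 2 k) ** j = ?Q ** (F t ** ?Q)"
      unfolding F_def matrix_mul_assoc i(2) by (simp only: matrix_mul_assoc[symmetric] i(1))
    then show ?thesis unfolding F_reflect_X[OF k] matrix_mul_assoc .
  qed
  have e3: "p ** (A t ** U.X 2 k ** U.X 2 k) ** j = F t ** ?Q ** ?Q"
  proof -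
    have "p ** (A t ** U.X 2 k ** U.X 2 k) ** j = p ** A t ** (U.X 2 k ** (U.X 2 k ** j))"
      by (simp only: matrix_mul_assoc)
    also have "\<dots> = p ** A t ** ((U.X 2 k ** j) ** ?Q)" by (simp only: i(1) matrix_mul_assoc)
    finally show ?thesis unfolding i(1) F_def by (simp only: matrix_mul_assoc)
  qed
  have "(sin t)\<^sup>2 *\<^sub>R (p *v (U.X 1 k *v (U.X 1 k *v (A t *v (j *v w))))) =
      (p ** ((sin t)\<^sup>2 *\<^sub>R (U.X 1 k ** U.X 1 k ** A t)) ** j) *v w"
    by (simp only: matrix_vector_mul_assoc mm.scaleR_left mm.scaleR_right mv.scaleR_left matrix_mul_assoc)
  also have "\<dots> = (cos t)\<^sup>2 *\<^sub>R ((?Q ** ?Q ** F t) *v w) - (2 * cos t) *\<^sub>R ((?Q ** ?Q ** F (- t)) *v w)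
     + (F t ** ?Q ** ?Q) *v w + (sin t * cos t) *\<^sub>R ((p ** (U.X 1 2 ** A t) ** j) *v w)"
    unfolding radial_square[OF k] mm.add_left mm.add_right mm.diff_left mm.diff_right mm.scaleR_left
      mm.scaleR_right mv.add_left mv.diff_left mv.scaleR_left e1 e2 e3 ..
  also have "(?Q ** ?Q ** F t) *v w = (-1/4) *s y w t"
    unfolding matrix_vector_mul_assoc[symmetric] sq y_def ..
  also have "(?Q ** ?Q ** F (- t)) *v w = (-1/4) *s y w (- t)"
    unfolding matrix_vector_mul_assoc[symmetric] sq y_def ..
  also have "(F t ** ?Q ** ?Q) *v w = (-1/4) *s y w t"
    unfolding matrix_vector_mul_assoc[symmetric] sq y_def vec.scale ..
  also have "(p ** (U.X 1 2 ** A t) ** j) *v w = y1 w t"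
    unfolding y1_def by (simp only: matrix_vector_mul_assoc matrix_mul_assoc)
  also have "(cos t)\<^sup>2 *\<^sub>R ((-1/4) *s y w t) - (2 * cos t) *\<^sub>R ((-1/4) *s y w (- t)) + (-1/4) *s y w t
      + (sin t * cos t) *\<^sub>R y1 w t =
    (- (1 + (cos t)\<^sup>2) / 4) *\<^sub>R y w t + (cos t / 2) *\<^sub>R y w (- t) + (sin t * cos t) *\<^sub>R y1 w t"
  proof -
    have q: "(-1/4) *s v = (- (1/4) :: real) *\<^sub>R v" for v :: "complex^'t" by (simp add: scaleR_eq_smult)
    have r: "- (1 + (cos t)\<^sup>2) / 4 = (cos t)\<^sup>2 * (- (1/4)) + (- (1/4))" "cos t / 2 = - (2 * cos t * (- (1/4)))"
      by (simp_all add: field_simps)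
    show ?thesis unfolding q r by (simp only: scaleR_add_left scaleR_scaleR scaleR_minus_left) (simp add: algebra_simps)
  qed
  finally show ?thesis .
qed

text \<open>Half the difference of the values of \<open>Cas\<close> for \<open>U\<close> and for
  \<open>K\<close>; the latter is \<open>- (2m + 1) (2m) / 4\<close>.\<close>

definition "K0 = (U.cas + real m * (2 * real m + 1) / 2) / 2"

lemma y_eq: "y w t = p *v (A t *v (j *v w))"
  unfolding y_def F_def by (simp only: matrix_vector_mul_assoc matrix_mul_assoc)

lemma Casimir_split: "(\<Sum>k\<in>{3..N}. p *v (U.X 1 k *v (U.X 1 k *v (A t *v (j *v w))))) = K0 *\<^sub>R y w t - y2 w t"
proof -
  let ?v = "A t *v (j *v w)"
  have e: "{1..N} = insert 1 {2..N}" "{2..N} = insert 2 {3..N}" using U.N4 by auto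
  have "U.Cas {1..N} = U.Cas {2..N} + 2 *\<^sub>R (\<Sum>b\<in>{2..N}. U.X 1 b ** U.X 1 b)"
    unfolding e(1) using U.N4 by (intro U.Cas_insert) auto
  also have "(\<Sum>b\<in>{2..N}. U.X 1 b ** U.X 1 b) = U.X 1 2 ** U.X 1 2 + (\<Sum>k\<in>{3..N}. U.X 1 k ** U.X 1 k)"
    unfolding e(2) by (intro sum.insert) auto
  finally have C: "U.Cas {1..N} = U.Cas {2..N} + 2 *\<^sub>R (U.X 1 2 ** U.X 1 2 + (\<Sum>k\<in>{3..N}. U.X 1 k ** U.X 1 k))" .
  have "p *v (U.Cas {1..N} *v ?v) = p *v (U.Cas {2..N} *v ?v) +
      2 *\<^sub>R (y2 w t + (\<Sum>k\<in>{3..N}. p *v (U.X 1 k *v (U.X 1 k *v ?v))))"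
    unfolding C y2_def mv.add_left mv.scaleR_left mv.sum_left matrix_vector_mul_assoc[symmetric]
      mv.add_right mv.scaleR_right mv.sum_right ..
  moreover have "p *v (U.Cas {1..N} *v ?v) = U.cas *\<^sub>R y w t"
    unfolding U.Cas_scalar y_eq vec.scale scaleR_eq_smult ..
  moreover have "p *v (U.Cas {2..N} *v ?v) = (- (real m * (2 * real m + 1) / 2)) *\<^sub>R y w t"
  proof -
    have "p *v (U.Cas {2..N} *v ?v) = (\<Sum>a\<in>{2..N}. \<Sum>b\<in>{2..N} - {a}. p *v (U.X a b *v (U.X a b *v ?v)))"
      unfolding U.Cas_def mv.sum_left matrix_vector_mul_assoc[symmetric] mv.sum_right ..
    also have "\<dots> = (\<Sum>a\<in>{2..N}. \<Sum>b\<in>{2..N} - {a}. (-1/4) *s y w t)"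
    proof (intro sum.cong refl)
      fix a b assume ab: "a \<in> {2..N}" "b \<in> {2..N} - {a}"
      then have i: "p ** U.X a b = K.X a b ** p" by (intro intertwine_X) auto
      have pX: "p *v (U.X a b *v x) = K.X a b *v (p *v x)" for x
        by (simp only: matrix_vector_mul_assoc i)
      have "p *v (U.X a b *v (U.X a b *v ?v)) = K.X a b *v (K.X a b *v (p *v ?v))"
        unfolding pX ..
      also have "K.X a b *v (K.X a b *v (p *v ?v)) = (-1/4) *s (p *v ?v)"
        using ab by (intro K.tau_square) auto
      finally show "p *v (U.X a b *v (U.X a b *v ?v)) = (-1/4) *s y w t" unfolding y_eq .
    qed
    also have "\<dots> = (\<Sum>a\<in>{2..N}. of_nat (2 * m) *s ((-1/4) *s y w t))"
    proof (rule sum.cong[OF refl])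
      fix a assume "a \<in> {2..N}"
      then have "card ({2..N} - {a}) = 2 * m" using U.N by (simp add: card_Diff_singleton)
      then show "(\<Sum>b\<in>{2..N} - {a}. (-1/4) *s y w t) = of_nat (2 * m) *s ((-1/4) *s y w t)"
        unfolding sum_const_smult by (simp only:)
    qed
    also have "\<dots> = of_nat (2 * m + 1) *s (of_nat (2 * m) *s ((-1/4) *s y w t))"
      unfolding sum_const_smult using U.N by simp
    also have "\<dots> = (- (real m * (2 * real m + 1) / 2)) *\<^sub>R y w t"
      unfolding scaleR_eq_smult vector_smult_assoc by (simp add: field_simps)
    finally show ?thesis .
  qed
  ultimately have "U.cas *\<^sub>R y w t = (- (real m * (2 * real m + 1) / 2)) *\<^sub>R y w t +
      2 *\<^sub>R (y2 w t + (\<Sum>k\<in>{3..N}. p *v (U.X 1 k *v (U.X 1 k *v ?v))))" by (simp only:)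
  then have "U.cas *\<^sub>R y w t + (real m * (2 * real m + 1) / 2) *\<^sub>R y w t =
      2 *\<^sub>R (y2 w t + (\<Sum>k\<in>{3..N}. p *v (U.X 1 k *v (U.X 1 k *v ?v))))"
    by (simp only: scaleR_minus_left) simp
  then have "(1/2) *\<^sub>R ((U.cas + real m * (2 * real m + 1) / 2) *\<^sub>R y w t) =
      (1/2) *\<^sub>R (2 *\<^sub>R (y2 w t + (\<Sum>k\<in>{3..N}. p *v (U.X 1 k *v (U.X 1 k *v ?v)))))"
    by (simp only: scaleR_add_left)
  then have "K0 *\<^sub>R y w t = y2 w t + (\<Sum>k\<in>{3..N}. p *v (U.X 1 k *v (U.X 1 k *v ?v)))"
    unfolding K0_def by simp
  then show ?thesis by simp
qed

lemma ode: "(sin t)\<^sup>2 *\<^sub>R (K0 *\<^sub>R y w t - y2 w t) =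
    (- (real m / 2) * (1 + (cos t)\<^sup>2)) *\<^sub>R y w t + (real m * cos t) *\<^sub>R y w (- t) +
    (2 * real m * (sin t * cos t)) *\<^sub>R y1 w t"
proof -
  have card: "card {3..N} = 2 * m" using U.N by simp
  have "(sin t)\<^sup>2 *\<^sub>R (K0 *\<^sub>R y w t - y2 w t) = (\<Sum>k\<in>{3..N}.
      (sin t)\<^sup>2 *\<^sub>R (p *v (U.X 1 k *v (U.X 1 k *v (A t *v (j *v w))))))"
    unfolding Casimir_split[symmetric] scaleR_sum_right ..
  also have "\<dots> = (\<Sum>k\<in>{3..N}. (- (1 + (cos t)\<^sup>2) / 4) *\<^sub>R y w t + (cos t / 2) *\<^sub>R y w (- t) + (sin t * cos t) *\<^sub>R y1 w t)"
    by (intro sum.cong refl radial_square_vector)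
  also have "\<dots> = (2 * real m) *\<^sub>R ((- (1 + (cos t)\<^sup>2) / 4) *\<^sub>R y w t + (cos t / 2) *\<^sub>R y w (- t) + (sin t * cos t) *\<^sub>R y1 w t)"
    unfolding sum_constant_scaleR card by simp
  also have "\<dots> = (- (real m / 2) * (1 + (cos t)\<^sup>2)) *\<^sub>R y w t + (real m * cos t) *\<^sub>R y w (- t) +
    (2 * real m * (sin t * cos t)) *\<^sub>R y1 w t"
    unfolding scaleR_add_right scaleR_scaleR
    by (intro arg_cong2[of _ _ _ _ "(+)"] arg_cong2[of _ _ _ _ "(*\<^sub>R)"] refl) (simp_all add: field_simps)
  finally show ?thesis .
qed

lemma y_0: "y w 0 = w"
  using U.zero[of 1 2] U.N4 pj unfolding y_eq by (simp add: matrix_vector_mul_assoc)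

text \<open>The eigenvalue of \<open>A pi\<close> fixes the frequency modulo 2, and
  \<open>X12_bound\<close> confines it to the interval from \<open>- lam\<close> to
  \<open>lam\<close>; exactly the values \<open>lam - 2s\<close> with \<open>s <= l\<close>
  remain.\<close>

lemma decomposition:
  assumes "A pi *v v = cis (pi * U.lam) *s v"
  shows "\<exists>f. (\<forall>s. U.X 1 2 *v f s = (\<i> * of_real (freq l s / 2)) *s f s) \<and> v = (\<Sum>s\<le>l. f s)"
proof -
  define W where "W = {v. A pi *v v = cis (pi * U.lam) *s v}"
  define E where "E = {w\<in>W. \<exists>s. U.X 1 2 *v w = s *s w}"
  have mem: "(1::nat) \<in> {1..N}" "(2::nat) \<in> {1..N}" "(1::nat) \<noteq> 2" using U.N4 by auto
  interpret P: periodic_group "A" by (rule U.group[OF mem])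
  have gen: "P.gen = U.X 1 2" by (simp add: U.X_def)
  have "vec.subspace W"
    unfolding W_def vec.subspace_def by (auto simp: vec.add vec.scale vector_add_ldistrib mult.commute)
  moreover have "U.X 1 2 *v w \<in> W" if "w \<in> W" for w
    using that commuting_eigenvector[of "U.X 1 2" "A pi" w] U.rho_X_commute[OF mem, of pi] unfolding W_def by simp
  moreover have "v \<in> W" using assms by (simp add: W_def)
  ultimately have "v \<in> vec.span E"
    unfolding E_def using semisimple_span[of W "U.X 1 2" v] P.semisimple_gen gen by simp
  then show ?thesis
  proof (induction rule: vec.span_induct_alt)
    case base
    show ?case by (intro exI[of _ "\<lambda>_. 0"]) auto
  next
    case (step c e v)
    then obtain f where f: "\<And>s. U.X 1 2 *v f s = (\<i> * of_real (freq l s / 2)) *s f s" "v = (\<Sum>s\<le>l. f s)" by blast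
    show ?case
    proof (cases "e = 0")
      case True
      then show ?thesis using f by auto
    next
      case False
      obtain s where e: "A pi *v e = cis (pi * U.lam) *s e" "U.X 1 2 *v e = s *s e"
        using step(1) unfolding E_def W_def by blast
      obtain k :: int where k: "s = \<i> * of_real (of_int k / 2)"
        by (rule P.eigenvalue_half_integer[of e s]) (use e(2) gen False in auto)
      have "\<bar>of_int k / 2\<bar> \<le> U.lam" using U.X12_bound[OF False e(2)[unfolded k]] .
      then have kb: "\<bar>real_of_int k\<bar> \<le> 2 * real l + 1" unfolding U.lam_def by simp
      have "A pi *v e = exp (s * of_real pi) *s e" using P.eigen[of e s pi] e(2) gen by simp
      then have "exp (s * of_real pi) = cis (pi * U.lam)" using e(1) False by simp
      moreover have "exp (s * of_real pi) = cis (of_int k * pi / 2)"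
        by (simp add: k cis_conv_exp mult_ac)
      ultimately have "cis (of_int k * pi / 2 - pi * U.lam) = 1"
        by (simp flip: cis_divide)
      then obtain n :: int where n: "of_int k * pi / 2 - pi * U.lam = 2 * pi * of_int n"
        by (auto simp: cis_conv_exp exp_eq_1)
      then have "pi * (of_int k) = pi * (2 * real l + 1 + 4 * of_int n)"
        by (simp add: U.lam_def algebra_simps)
      then have kn: "real_of_int k = 2 * real l + 1 + 4 * of_int n" by simp
      then have "real_of_int k = real_of_int (2 * int l + 1 + 4 * n)" by simp
      then have kn': "k = 2 * int l + 1 + 4 * n" by linarith
      have "real_of_int \<bar>k\<bar> \<le> real_of_int (2 * int l + 1)" using kb by simp
      then have "\<bar>k\<bar> \<le> 2 * int l + 1" by linarith
      then have n0: "n \<le> 0" "- n \<le> int l" using kn' by auto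
      define s' where "s' = nat (- n)"
      have s': "s' \<le> l" "freq l s' = of_int k" using n0 kn by (auto simp: s'_def freq_def)
      define g where "g r = (if r = s' then c *s e else 0) + f r" for r
      have "U.X 1 2 *v g r = (\<i> * of_real (freq l r / 2)) *s g r" for r
        using f(1) e(2) s'(2) by (auto simp: g_def vec.add vec.scale vector_add_ldistrib k mult.commute)
      moreover have "c *s e + v = (\<Sum>r\<le>l. g r)"
        using s'(1) by (simp add: g_def sum.distrib f(2))
      ultimately show ?thesis by blast
    qed
  qed
qed

lemma expansion:
  assumes "A pi *v (j *v w) = cis (pi * U.lam) *s (j *v w)"
  obtains u where "\<And>t. y w t = (\<Sum>s\<le>l. cis (freq l s / 2 * t) *s u s)"
    and "\<And>t. y1 w t = (\<Sum>s\<le>l. ((\<i> * of_real (freq l s / 2)) * cis (freq l s / 2 * t)) *s u s)"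
    and "\<And>t. y2 w t = (\<Sum>s\<le>l. ((\<i> * of_real (freq l s / 2)) ^ 2 * cis (freq l s / 2 * t)) *s u s)"
proof -
  obtain f where f: "\<And>s. U.X 1 2 *v f s = (\<i> * of_real (freq l s / 2)) *s f s" "j *v w = (\<Sum>s\<le>l. f s)"
    using decomposition[OF assms] by blast
  have mem: "(1::nat) \<in> {1..N}" "(2::nat) \<in> {1..N}" "(1::nat) \<noteq> 2" using U.N4 by auto
  have A: "A t *v f s = cis (freq l s / 2 * t) *s f s" for t s
    using periodic_group.eigen[OF U.group[OF mem], of "f s" "\<i> * of_real (freq l s / 2)" t] f(1)[of s]
    unfolding U.X_def by (simp add: cis_conv_exp mult_ac)
  define u where "u s = p *v f s" for s
  show ?thesis
  proof (rule that[of u])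
    show "y w t = (\<Sum>s\<le>l. cis (freq l s / 2 * t) *s u s)" for t
      unfolding y_eq f(2) mv.sum_right A vec.scale u_def ..
    show "y1 w t = (\<Sum>s\<le>l. ((\<i> * of_real (freq l s / 2)) * cis (freq l s / 2 * t)) *s u s)" for t
      unfolding y1_def f(2) mv.sum_right A vec.scale f(1) u_def vector_smult_assoc by (simp only: mult.commute)
    show "y2 w t = (\<Sum>s\<le>l. ((\<i> * of_real (freq l s / 2)) ^ 2 * cis (freq l s / 2 * t)) *s u s)" for t
      unfolding y2_def f(2) mv.sum_right A vec.scale f(1) u_def vector_smult_assoc power2_eq_square
      by (simp only: mult_ac)
  qed
qed

end

section \<open>Evaluation of the spherical functions\<close>

definition radial_fun :: "nat \<Rightarrow> nat \<Rightarrow> real \<Rightarrow> complex" where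
  "radial_fun m l t = fact l / (of_nat m * pochhammer (of_nat (2 * m + 1)) l) * trig l (\<lambda>s. ecoef m l (int s)) t"

text \<open>\<open>pochhammer (2m + 1) (2l)\<close> is computed twice: by splitting the product in
  the middle, and by the duplication formula, which brings in \<open>m + 1/2\<close> and
  \<open>2 ^ (2l)\<close>.\<close>

lemma jacobi_prefactor:
  assumes m: "m \<ge> 1"
  shows "pochhammer (of_nat (l + 2 * m + 1)) l / (2 ^ (2 * l) * pochhammer (of_nat m + 1 / 2) l) / ecoef m l 0 =
    (fact l / (of_nat m * pochhammer (of_nat (2 * m + 1)) l) :: complex)"
proof -
  let ?P = "pochhammer :: complex \<Rightarrow> nat \<Rightarrow> complex"
  define A B C D where "A = ?P (of_nat (2 * m + 1)) l" and "B = ?P (of_nat (l + 2 * m + 1)) l"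
    and "C = ?P (of_nat m + 1 / 2) l" and "D = ?P (of_nat m + 1) l"
  have e0: "ecoef m l 0 = of_nat m * D / fact l"
    using ecoef_eq[of 0 l m] m by (simp add: D_def)
  have D: "D = ?P (of_nat (m + 1)) l" unfolding D_def by (simp add: add.commute)
  have nz: "A \<noteq> 0" "B \<noteq> 0" "D \<noteq> 0"
    unfolding A_def B_def D by (rule pochhammer_of_nat_neq_0; simp)+
  have s: "of_nat (l + 2 * m + 1) = (of_nat (2 * m + 1) + of_nat l :: complex)"
    "2 * (of_nat m + 1 / 2) = (of_nat (2 * m + 1) :: complex)" "of_nat m + 1 / 2 + 1 / 2 = (of_nat m + 1 :: complex)"
    by simp_all
  have "A * B = ?P (of_nat (2 * m + 1)) (2 * l)"
    unfolding A_def B_def s(1) mult_2[of l] by (rule pochhammer_product'[symmetric])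
  also have "\<dots> = 2 ^ (2 * l) * C * D"
    using pochhammer_double[of "of_nat m + 1 / 2 :: complex" l] unfolding s C_def D_def by simp
  finally have d: "A * B = (2 ^ (2 * l) * C) * D" .
  then have "2 ^ (2 * l) * C \<noteq> 0" using nz(1,2) by (metis mult_eq_0_iff)
  then have "B / (2 ^ (2 * l) * C) = D / A"
    using nz(1) d by (metis frac_eq_eq mult.commute)
  then show ?thesis unfolding e0 A_def[symmetric] B_def[symmetric] C_def[symmetric] using nz(3) m by simp
qed

text \<open>The factor \<open>cis (- t / 2)\<close> moves integral exponents to the half-integral
  frequencies of \<open>trig\<close>; \<open>t'\<close> is \<open>t\<close> for exponents descending
  in \<open>s\<close> and \<open>- t\<close> for ascending ones.\<close>

lemma jacobi_sum_radial:
  fixes f :: "nat \<Rightarrow> int"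
  assumes m: "m \<ge> 1" and inj: "inj_on f {..l}"
    and e: "\<And>s. of_int (f s) * t - t / 2 = freq l s / 2 * t'"
  shows "pochhammer (of_nat (l + 2 * m + 1)) l / (2 ^ (2 * l) * pochhammer (of_nat m + 1 / 2) l) *
    (cis (- t / 2) * laurent_eval (jacobi_sum m l f) (cis t)) = radial_fun m l t'"
proof -
  let ?c = "pochhammer (of_nat (l + 2 * m + 1)) l / (2 ^ (2 * l) * pochhammer (of_nat m + 1 / 2) l) :: complex"
  have "cis (- t / 2) * cis (of_int (f s) * t) = cis (freq l s / 2 * t')" for s
    using e[of s] unfolding cis_mult by (intro arg_cong[of _ _ cis]) linarith
  moreover have "x * (y / z * w) = x * w * y / z" for x y z w :: complex by simp
  ultimately have *: "cis (- t / 2) * (ecoef m l (int s) / ecoef m l 0 * cis (of_int (f s) * t)) =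
      cis (freq l s / 2 * t') * ecoef m l (int s) / ecoef m l 0" for s
    by (simp only:)
  have "cis (- t / 2) * laurent_eval (jacobi_sum m l f) (cis t) = trig l (\<lambda>s. ecoef m l (int s)) t' / ecoef m l 0"
    unfolding jacobi_sum_def laurent_eval_sum_single[OF inj] trig_def sum_distrib_left sum_divide_distrib cis_powi * ..
  then show ?thesis
    unfolding radial_fun_def jacobi_prefactor[OF m, symmetric]
    by (simp only: times_divide_eq_left times_divide_eq_right)
qed

lemma jacobi_plus_radial:
  assumes m: "m \<ge> 1"
  shows "pochhammer (of_nat (l + 2 * m + 1)) l / (2 ^ (2 * l) * pochhammer (of_nat m + 1 / 2) l) *
    (cis (- t / 2) * laurent_eval (nonsym_jacobi (int l + 1) (0, real m)) (cis t)) = radial_fun m l t"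
  unfolding nonsym_jacobi_plus[OF m]
  by (rule jacobi_sum_radial[OF m]) (auto simp: inj_on_def freq_def algebra_simps)

lemma jacobi_minus_radial:
  assumes m: "m \<ge> 1"
  shows "pochhammer (of_nat (l + 2 * m + 1)) l / (2 ^ (2 * l) * pochhammer (of_nat m + 1 / 2) l) *
    (cis (- t / 2) * laurent_eval (nonsym_jacobi (- int l) (0, real m)) (cis t)) = radial_fun m l (- t)"
  unfolding nonsym_jacobi_minus[OF m]
  by (rule jacobi_sum_radial[OF m]) (auto simp: inj_on_def freq_def algebra_simps)

lemma vector_jacobi_radial:
  fixes n :: int
  assumes "\<And>t. c * (cis (- t / 2) * laurent_eval (nonsym_jacobi n k) (cis t)) = g t"
  shows "c *s ((vector [vector [inverse (cis (t / 2)), 0], vector [0, cis (t / 2)]] :: complex ^ 2 ^ 2) *v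
    vector_jacobi n k (cis (t / 2) ^ 2)) = vector [g t, g (- t)]"
proof -
  have sq: "cis (t / 2) ^ 2 = cis t" by (simp add: power2_eq_square cis_mult)
  show ?thesis
    using assms[of t] assms[of "- t"]
    by (simp add: vec_eq_iff forall_2 vector_2 sum_2 matrix_vector_mult_def vector_jacobi_def sq cis_inverse)
qed

lemma scalar_on_eq:
  assumes "irreducible_on G \<rho> W" "\<And>w. w \<in> W \<Longrightarrow> F *v w = c *s w"
  shows "scalar_on W F = c"
  unfolding scalar_on_def
proof (rule the_equality)
  have "vec.subspace W" "W \<noteq> {0}"
    using assms(1) unfolding irreducible_on_def invariant_subspace_def by auto
  then obtain w where w: "w \<in> W" "w \<noteq> 0" using vec.subspace_0 by auto
  fix d assume "\<forall>w\<in>W. F *v w = d *s w"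
  then have "d *s w = c *s w" using assms(2) w by auto
  then show "d = c" using w(2) by simp
qed (use assms(2) in auto)

context spherical
begin

lemma K0_eq: "K0 = - ((2 * real l + 1)\<^sup>2 / 4 + real m * (2 * real l + 1) - real m / 2)"
proof -
  have "real (2 * m * (2 * m - 1)) = 2 * real m * (2 * real m - 1)" using U.m by (simp add: of_nat_diff)
  then show ?thesis unfolding K0_def U.cas_def U.lam_def by (simp add: field_simps power2_eq_square)
qed

text \<open>Every coordinate of \<open>y w\<close> solves the same scalar equation, with the
  coordinate of \<open>w\<close> as initial value; so \<open>F t\<close> multiplies \<open>w\<close>
  by a common factor.\<close>

lemma F_eigen:
  assumes "A pi *v (j *v w) = cis (pi * U.lam) *s (j *v w)"
  shows "F t *v w = radial_fun m l t *s w"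
proof -
  obtain u where u: "\<And>t. y w t = (\<Sum>s\<le>l. cis (freq l s / 2 * t) *s u s)"
    and u1: "\<And>t. y1 w t = (\<Sum>s\<le>l. ((\<i> * of_real (freq l s / 2)) * cis (freq l s / 2 * t)) *s u s)"
    and u2: "\<And>t. y2 w t = (\<Sum>s\<le>l. ((\<i> * of_real (freq l s / 2)) ^ 2 * cis (freq l s / 2 * t)) *s u s)"
    by (rule expansion[OF assms], rule that, simp_all only:)
  have "y w t $ i = radial_fun m l t * w $ i" for i
  proof -
    let ?u = "\<lambda>s. u s $ i"
    have Y: "y w t $ i = trig l ?u t" for t
      unfolding u trig_def by (simp only: sum_component vector_smult_component)
    have Y1: "y1 w t $ i = trig l (\<lambda>s. (\<i> * of_real (freq l s / 2)) * ?u s) t" for t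
      unfolding u1 trig_def sum_component vector_smult_component by (intro sum.cong refl) (simp only: mult_ac)
    have Y2: "y2 w t $ i = trig l (\<lambda>s. (\<i> * of_real (freq l s / 2)) ^ 2 * ?u s) t" for t
      unfolding u2 trig_def sum_component vector_smult_component by (intro sum.cong refl) (simp only: mult_ac)
    have comp: "(c *\<^sub>R x) $ i = of_real c * x $ i" for c and x :: "complex^'t"
      unfolding vector_scaleR_component by (rule scaleR_conv_of_real)
    have "trig l ?u t = trig l ?u 0 * (fact l / (of_nat m * pochhammer (of_nat (2 * m + 1)) l) * trig l (\<lambda>s. ecoef m l (int s)) t)"
    proof (rule radial_solution[OF U.m])
      fix t
      have "((sin t)\<^sup>2 *\<^sub>R (K0 *\<^sub>R y w t - y2 w t)) $ i =
        ((- (real m / 2) * (1 + (cos t)\<^sup>2)) *\<^sub>R y w t + (real m * cos t) *\<^sub>R y w (- t) +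
         (2 * real m * (sin t * cos t)) *\<^sub>R y1 w t) $ i" by (simp only: ode)
      then show "of_real ((sin t)\<^sup>2) * (of_real (- ((2 * real l + 1)\<^sup>2 / 4 + real m * (2 * real l + 1) - real m / 2)) * trig l ?u t
          - trig l (\<lambda>s. (\<i> * of_real (freq l s / 2)) ^ 2 * ?u s) t) =
        of_real (- (real m / 2) * (1 + (cos t)\<^sup>2)) * trig l ?u t + of_real (real m * cos t) * trig l ?u (- t)
        + of_real (2 * real m * (sin t * cos t)) * trig l (\<lambda>s. (\<i> * of_real (freq l s / 2)) * ?u s) t"
        unfolding vector_add_component vector_minus_component comp Y Y1 Y2 K0_eq .
    qed
    moreover have "trig l ?u 0 = w $ i" using Y[of 0] unfolding y_0 ..
    ultimately show ?thesis unfolding Y radial_fun_def by (simp only: mult.commute)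
  qed
  then show ?thesis unfolding y_def[symmetric] by (simp add: vec_eq_iff)
qed

abbreviation "\<omega> \<equiv> torus_elem m 2 (\<lambda>_. pi)"

lemma A_pi_eigen:
  assumes w: "\<tau> \<omega> *v w = \<kappa> *s w" and \<kappa>: "\<kappa> * cis (pi * U.lam) = cis (pi * (\<Sum>r=1..m + 1. \<Lambda> r))"
  shows "A pi *v (j *v w) = cis (pi * U.lam) *s (j *v w)"
proof -
  have "[1..<m + 2] = 1 # [2..<m + 2]"
    using upt_conv_Cons[of 1 "m + 2"] by (simp add: numeral_2_eq_2 del: upt_Suc)
  then have tor: "torus_elem m 1 (\<lambda>_. pi) = cl_mult N (rot N 1 2 pi) \<omega>"
    using U.plane_rot_eq[of 1 pi] unfolding torus_elem_def U.N by simp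
  have K: "\<omega> \<in> carrier (K_group m)" by (rule K.torus_elem_closed) auto
  have U: "\<omega> \<in> carrier (U_group m)" by (rule U.torus_elem_closed) auto
  have r: "rot N 1 2 pi \<in> carrier (U_group m)" using U.N4 by (intro U.rot_closed) auto
  have "(\<kappa> * cis (pi * U.lam)) *s (j *v w) = A pi *v (\<pi> \<omega> *v (j *v w))"
    unfolding \<kappa> U.torus_pi_scalar[symmetric] tor U.hom_mult[OF r U] by (simp only: matrix_vector_mul_assoc matrix_mul_assoc)
  also have "\<pi> \<omega> *v (j *v w) = j *v (\<tau> \<omega> *v w)"
    using intertwine[OF K] by (simp only: matrix_vector_mul_assoc)
  finally have "\<kappa> *s (cis (pi * U.lam) *s (j *v w)) = \<kappa> *s (A pi *v (j *v w))"
    unfolding w vec.scale vector_smult_assoc .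
  moreover have "\<kappa> \<noteq> 0" using \<kappa> cis_neq_zero by (metis mult_zero_left)
  ultimately show ?thesis by (metis vector_mul_lcancel)
qed

lemma F_eigen_opposite:
  assumes w: "\<tau> \<omega> *v w = (- \<kappa>) *s w" and \<kappa>: "\<kappa> * cis (pi * U.lam) = cis (pi * (\<Sum>r=1..m + 1. \<Lambda> r))"
  shows "F t *v w = radial_fun m l (- t) *s w"
proof -
  have mem: "(3::nat) \<in> {2..N}" "(2::nat) \<in> {2..N}" "(3::nat) \<noteq> 2" using U.N4 by auto
  define v where "v = K.R 3 2 pi *v w"
  have "K.R 2 3 pi ** K.R 3 2 pi = mat 1"
    unfolding K.swap[OF mem] using K.inverse'[OF mem, of pi] .
  then have v: "K.R 2 3 pi *v v = w" unfolding v_def by (simp add: matrix_vector_mul_assoc)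
  have "\<tau> \<omega> *v v = \<kappa> *s v"
    unfolding v_def matrix_vector_mul_assoc K.torus_pi_swap mv.minus_left
    unfolding matrix_vector_mul_assoc[symmetric] w vec.scale by simp
  then have "F (- t) *v v = radial_fun m l (- t) *s v"
    by (rule F_eigen[OF A_pi_eigen[OF _ \<kappa>]])
  then have "(K.R 2 3 pi ** F (- t)) *v v = radial_fun m l (- t) *s (K.R 2 3 pi *v v)"
    by (simp only: matrix_vector_mul_assoc[symmetric] vec.scale)
  then have "(F t ** K.R 2 3 pi) *v v = radial_fun m l (- t) *s (K.R 2 3 pi *v v)"
    using F_reflect[of 3 t] U.N4 by simp
  then show ?thesis by (simp only: matrix_vector_mul_assoc[symmetric] v)
qed

lemma A_elem_F: "spherical_function \<pi> j p (A_elem (cis (t / 2))) = F t"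
  unfolding spherical_function_def F_def A_elem_cis using U.plane_rot_eq[of 1 t] by simp

text \<open>The condition on the sums makes \<open>A pi\<close> act by \<open>cis (pi * lam)\<close>
  on the image of \<open>W\<close>. The sum for \<open>W'\<close> differs by one, so
  \<open>omega\<close> has the opposite sign there. \<open>W\<close> will be the constituent whose
  sign agrees with that of the fundamental weight.\<close>

lemma scalar_on_constituents:
  assumes W: "M_constituent m \<mu> \<tau> W" and W': "M_constituent m \<mu>' \<tau> W'"
    and \<mu>: "(\<Sum>r=2..m + 1. \<mu> r) + U.lam = (\<Sum>r=1..m + 1. \<Lambda> r)"
    and \<mu>': "\<bar>(\<Sum>r=2..m + 1. \<mu> r) - (\<Sum>r=2..m + 1. \<mu>' r)\<bar> = 1"
  shows "scalar_on W (spherical_function \<pi> j p (A_elem (cis (t / 2)))) = radial_fun m l t"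
    and "scalar_on W' (spherical_function \<pi> j p (A_elem (cis (t / 2)))) = radial_fun m l (- t)"
proof -
  let ?\<kappa> = "cis (pi * (\<Sum>r=2..m + 1. \<mu> r))"
  have \<kappa>: "?\<kappa> * cis (pi * U.lam) = cis (pi * (\<Sum>r=1..m + 1. \<Lambda> r))"
    unfolding \<mu>[symmetric] cis_mult by (simp only: distrib_left)
  have "cis (pi * b) = - cis (pi * a)" if d: "\<bar>a - b\<bar> = 1" for a b :: real
  proof -
    consider "b = a + 1" | "b = a - 1" using d by linarith
    then show ?thesis
    proof cases
      case 1
      then show ?thesis by (simp add: distrib_left flip: cis_mult)
    next
      case 2
      then have "cis (pi * a) = - cis (pi * b)" by (simp add: right_diff_distrib flip: cis_divide)
      then show ?thesis by simp
    qed
  qed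
  then have \<kappa>': "cis (pi * (\<Sum>r=2..m + 1. \<mu>' r)) = - ?\<kappa>" using \<mu>' by blast
  show "scalar_on W (spherical_function \<pi> j p (A_elem (cis (t / 2)))) = radial_fun m l t"
    unfolding A_elem_F
  proof (rule scalar_on_eq)
    show "irreducible_on (M_group m) \<tau> W" using W by (simp add: M_constituent_def)
    show "F t *v w = radial_fun m l t *s w" if "w \<in> W" for w
      by (rule F_eigen[OF A_pi_eigen[OF K.torus_pi_constituent[OF W that] \<kappa>]])
  qed
  show "scalar_on W' (spherical_function \<pi> j p (A_elem (cis (t / 2)))) = radial_fun m l (- t)"
    unfolding A_elem_F
  proof (rule scalar_on_eq)
    show "irreducible_on (M_group m) \<tau> W'" using W' by (simp add: M_constituent_def)
    show "F t *v w = radial_fun m l (- t) *s w" if "w \<in> W'" for w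
      by (rule F_eigen_opposite[OF K.torus_pi_constituent[OF W' that, unfolded \<kappa>'] \<kappa>])
  qed
qed

end

lemma spherical_intro:
  fixes \<tau> :: "cliff \<Rightarrow> complex ^ 't ^ 't" and \<pi> :: "cliff \<Rightarrow> complex ^ 'd ^ 'd"
  assumes "m \<ge> 1" "K_irrep m (tau_weight m) \<tau>" "U_irrep m \<Lambda> \<pi>"
    and "\<Lambda> 1 = real l + 1/2" "\<Lambda> 2 = 1/2 \<or> m = 1 \<and> \<Lambda> 2 = -1/2"
    and "unitary_intertwiners (K_group m) \<tau> \<pi> j p"
  shows "spherical m (2 * m + 2) \<tau> \<pi> l \<Lambda> j p"
proof -
  have "unitary_rep (K_group m) \<tau>" "unitary_rep (U_group m) \<pi>"
    using assms(2,3) by (auto simp: K_irrep_def U_irrep_def)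
  then show ?thesis
    using assms by (intro spherical.intro spherical_axioms.intro tau_rep.intro tau_rep_axioms.intro
        u_rep.intro u_rep_axioms.intro spin_rep_K spin_rep_U) auto
qed

lemma sum_eps: "finite S \<Longrightarrow> (\<Sum>j\<in>S. eps j r) = (if r \<in> S then 1 else 0)"
  by (simp add: eps_def)

lemma weights_at_1_2:
  assumes "m \<ge> 1"
  shows "varpi_plus m 1 + real l * varpi_1 1 = real l + 1/2"
    and "varpi_plus m 2 + real l * varpi_1 2 = 1/2"
    and "varpi_minus m 1 + real l * varpi_1 1 = real l + 1/2"
    and "varpi_minus m 2 + real l * varpi_1 2 = 1/2 \<or> m = 1 \<and> varpi_minus m 2 + real l * varpi_1 2 = -1/2"
  using assms unfolding varpi_plus_def varpi_minus_def varpi_1_def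
  by (simp_all add: sum_eps del: sum.cl_ivl_Suc) (auto simp: eps_def)

lemma weight_sums:
  assumes "m \<ge> 1"
  shows "(\<Sum>r=1..m + 1. varpi_plus m r + real l * varpi_1 r) = real l + (real m + 1) / 2"
    and "(\<Sum>r=1..m + 1. varpi_minus m r + real l * varpi_1 r) = real l + (real m - 1) / 2"
    and "(\<Sum>r=2..m + 1. sigma_plus_weight m r) = real m / 2"
    and "(\<Sum>r=2..m + 1. sigma_minus_weight m r) = real m / 2 - 1"
proof -
  have e: "(\<Sum>r=a..m + 1. eps i r) = (if i \<in> {a..m + 1} then 1 else 0)" for a i
    by (simp add: eps_def del: sum.cl_ivl_Suc)
  have ss: "(\<Sum>r=a..m + 1. \<Sum>i=b..c. eps i r) = real (card {b..c})" if "a \<le> b" "c \<le> m + 1" for a b c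
  proof -
    have "(\<Sum>r=a..m + 1. \<Sum>i=b..c. eps i r) = (\<Sum>i=b..c. \<Sum>r=a..m + 1. eps i r)" by (rule sum.swap)
    also have "\<dots> = (\<Sum>i=b..c. 1)" unfolding e using that by (intro sum.cong) auto
    finally show ?thesis by simp
  qed
  note s = sum.distrib sum_subtractf sum_distrib_left[symmetric] e
  show "(\<Sum>r=1..m + 1. varpi_plus m r + real l * varpi_1 r) = real l + (real m + 1) / 2"
    unfolding varpi_plus_def varpi_1_def s by (subst ss) simp_all
  show "(\<Sum>r=1..m + 1. varpi_minus m r + real l * varpi_1 r) = real l + (real m - 1) / 2"
    unfolding varpi_minus_def varpi_1_def s by (subst ss) (simp_all add: field_simps)
  show "(\<Sum>r=2..m + 1. sigma_plus_weight m r) = real m / 2"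
    unfolding sigma_plus_weight_def s by (subst ss) (use assms in \<open>simp_all add: of_nat_diff field_simps\<close>)
  show "(\<Sum>r=2..m + 1. sigma_minus_weight m r) = real m / 2 - 1"
    unfolding sigma_minus_weight_def s by (subst ss) (use assms in \<open>simp_all add: of_nat_diff field_simps\<close>)
qed

theorem theorem3p4:
  fixes m l :: nat
    and \<tau> :: "cliff \<Rightarrow> complex ^ 't ^ 't"
    and \<pi> :: "cliff \<Rightarrow> complex ^ 'd ^ 'd"
    and j :: "complex ^ 't ^ 'd"
    and p :: "complex ^ 'd ^ 't"
    and Wplus Wminus :: "(complex ^ 't) set"
    and z :: complex
  assumes m: "m \<ge> 1"
    and tau: "K_irrep m (tau_weight m) \<tau>"
    and sigma_plus: "M_constituent m (sigma_plus_weight m) \<tau> Wplus"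
    and sigma_minus: "M_constituent m (sigma_minus_weight m) \<tau> Wminus"
    and split: "Wplus \<inter> Wminus = {0}" "{u + v | u v. u \<in> Wplus \<and> v \<in> Wminus} = UNIV"
    and jp: "unitary_intertwiners (K_group m) \<tau> \<pi> j p"
    and z: "z \<in> sphere 0 1"
  shows "(U_irrep m (\<lambda>r. varpi_plus m r + real l * varpi_1 r) \<pi> \<longrightarrow>
           restricted_spherical \<pi> j p Wplus Wminus z =
             (pochhammer (of_nat (l + 2 * m + 1)) l /
              (2 ^ (2 * l) * pochhammer (of_nat m + 1 / 2) l)) *s
             ((vector [vector [inverse z, 0], vector [0, z]] :: complex ^ 2 ^ 2) *v
              vector_jacobi (int l + 1) (0, real m) (z ^ 2)))
       \<and> (U_irrep m (\<lambda>r. varpi_minus m r + real l * varpi_1 r) \<pi> \<longrightarrow>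
           restricted_spherical \<pi> j p Wplus Wminus z =
             (pochhammer (of_nat (l + 2 * m + 1)) l /
              (2 ^ (2 * l) * pochhammer (of_nat m + 1 / 2) l)) *s
             ((vector [vector [inverse z, 0], vector [0, z]] :: complex ^ 2 ^ 2) *v
              vector_jacobi (- int l) (0, real m) (z ^ 2)))"
proof -
  \<comment> \<open>The coordinate \<open>z\<close> is the character of half the rotation
    angle.\<close>
  define t where "t = 2 * Arg z"
  have zt: "z = cis (t / 2)"
    using z cis_Arg[of z] by (force simp: t_def sgn_eq)
  have plus: "restricted_spherical \<pi> j p Wplus Wminus z = vector [radial_fun m l t, radial_fun m l (- t)]"
    if U: "U_irrep m (\<lambda>r. varpi_plus m r + real l * varpi_1 r) \<pi>"
  proof -
    interpret spherical m "2 * m + 2" \<tau> \<pi> l "\<lambda>r. varpi_plus m r + real l * varpi_1 r" j p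
      by (rule spherical_intro[OF m tau U _ _ jp]) (use weights_at_1_2[OF m] in auto)
    have *: "(\<Sum>r=2..m + 1. sigma_plus_weight m r) + U.lam = (\<Sum>r=1..m + 1. varpi_plus m r + real l * varpi_1 r)"
        "\<bar>(\<Sum>r=2..m + 1. sigma_plus_weight m r) - (\<Sum>r=2..m + 1. sigma_minus_weight m r)\<bar> = 1"
      unfolding weight_sums[OF m] U.lam_def by (simp_all add: field_simps)
    show ?thesis
      unfolding restricted_spherical_def zt scalar_on_constituents[OF sigma_plus sigma_minus *] ..
  qed
  \<comment> \<open>Here the constituent with the selected frequencies is \<open>Wminus\<close>, so
    the two components are interchanged.\<close>
  have minus: "restricted_spherical \<pi> j p Wplus Wminus z = vector [radial_fun m l (- t), radial_fun m l t]"
    if U: "U_irrep m (\<lambda>r. varpi_minus m r + real l * varpi_1 r) \<pi>"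
  proof -
    interpret spherical m "2 * m + 2" \<tau> \<pi> l "\<lambda>r. varpi_minus m r + real l * varpi_1 r" j p
      by (rule spherical_intro[OF m tau U _ _ jp]) (use weights_at_1_2[OF m] in auto)
    have *: "(\<Sum>r=2..m + 1. sigma_minus_weight m r) + U.lam = (\<Sum>r=1..m + 1. varpi_minus m r + real l * varpi_1 r)"
        "\<bar>(\<Sum>r=2..m + 1. sigma_minus_weight m r) - (\<Sum>r=2..m + 1. sigma_plus_weight m r)\<bar> = 1"
      unfolding weight_sums[OF m] U.lam_def by (simp_all add: field_simps)
    show ?thesis
      unfolding restricted_spherical_def zt scalar_on_constituents[OF sigma_minus sigma_plus *] ..
  qed
  show ?thesis
    using plus minus vector_jacobi_radial[OF jacobi_plus_radial[OF m, of l], of t]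
      vector_jacobi_radial[OF jacobi_minus_radial[OF m, of l], of t]
    unfolding zt by simp
qed

end
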